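(* Consider the one-dimensional vectorial Deffuant model with $F$ issues and confidence threshold $\theta$, started from the uniform product measure (the initial opinions $\eta_0(x)$, $x \in \mathbb{Z}$, independent and uniformly distributed on $\{0,1\}^F$), and assume $F \geq 4\theta - 1$. Then the system coexists: there is a random configuration $\eta_\infty : \mathbb{Z} \to \{0,1\}^F$ such that for every $x \in \mathbb{Z}$, almost surely $\eta_t(x) = \eta_\infty(x)$ for all sufficiently large $t$, and almost surely $\#\{\eta_\infty(x) : x \in \mathbb{Z}\} = 2^F$.
   Context: $F \geq 1$ and $\theta \geq 1$ are integers. The opinion set is $\Gamma = \{0,1\}^F$ with Hamming distance $H(u,v) = \#\{i : u_i \neq v_i\}$. The vectorial Deffuant model on $\mathbb{Z}$ is the continuous-time Markov process $(\eta_t)_{t \geq 0}$, $\eta_t : \mathbb{Z} \to \Gamma$: independently at rate one, each vertex $x$ chooses one of its two nearest neighbors $y \in \{x-1,x+1\}$ uniformly at random; if $1 \leq H(\eta(x),\eta(y)) \leq \theta$, an issue $i$ is chosen uniformly at random among those with $\eta(x)_i \neq \eta(y)_i$ and the $i$-th coordinate of $\eta(x)$ is set equal to $\eta(y)_i$; otherwise nothing happens. *)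

theory Defs
  imports "HOL-Probability.Probability"
begin

text \<open>Opinions: an opinion u in Gamma = {0,1}^F is encoded as the set of issues
  i < F with u_i = 1, i.e. Gamma corresponds to Pow {..<F}.\<close>

definition hamming :: "nat \<Rightarrow> nat set \<Rightarrow> nat set \<Rightarrow> nat" where
  "hamming F u v = card {i. i < F \<and> (i \<in> u) \<noteq> (i \<in> v)}"

text \<open>Graphical representation.  Each site x carries an initial opinion and a
  sequence of marks (e, d, p): e is an Exp(1) inter-arrival time of the rate-one
  clock at x, d \<in> {-1,1} the uniformly chosen neighbour x + d, and p a uniform
  random permutation of {..<F}; the issue adopted is the disagreeing issue i
  with smallest p i, which is uniform among the disagreeing issues.\<close>

type_synonym mark = "real \<times> int \<times> (nat \<Rightarrow> nat)"
type_synonym site = "nat set \<times> (nat \<Rightarrow> mark)"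

definition init_law :: "nat \<Rightarrow> nat set measure" where
  "init_law F = measure_pmf (pmf_of_set (Pow {..<F}))"

definition exp_law :: "real measure" where
  "exp_law = density lborel (\<lambda>x. ennreal (exponential_density 1 x))"

definition nbr_law :: "int measure" where
  "nbr_law = measure_pmf (pmf_of_set {-1, 1})"

definition perm_law :: "nat \<Rightarrow> (nat \<Rightarrow> nat) measure" where
  "perm_law F = measure_pmf (pmf_of_set {p. p permutes {..<F}})"

definition mark_law :: "nat \<Rightarrow> mark measure" where
  "mark_law F = pair_measure exp_law (pair_measure nbr_law (perm_law F))"

definition site_law :: "nat \<Rightarrow> site measure" where
  "site_law F = pair_measure (init_law F) (PiM UNIV (\<lambda>n::nat. mark_law F))"

definition deffuant_space :: "nat \<Rightarrow> (int \<Rightarrow> site) measure" where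
  "deffuant_space F = PiM UNIV (\<lambda>x::int. site_law F)"

definition init_op :: "(int \<Rightarrow> site) \<Rightarrow> int \<Rightarrow> nat set" where
  "init_op \<omega> x = fst (\<omega> x)"

definition mark_of :: "(int \<Rightarrow> site) \<Rightarrow> int \<Rightarrow> nat \<Rightarrow> mark" where
  "mark_of \<omega> x n = snd (\<omega> x) n"

definition arrival :: "(int \<Rightarrow> site) \<Rightarrow> int \<Rightarrow> nat \<Rightarrow> real" where
  "arrival \<omega> x n = (\<Sum>k\<le>n. fst (mark_of \<omega> x k))"

definition nbr :: "(int \<Rightarrow> site) \<Rightarrow> int \<Rightarrow> nat \<Rightarrow> int" where
  "nbr \<omega> x n = x + fst (snd (mark_of \<omega> x n))"

definition perm_of :: "(int \<Rightarrow> site) \<Rightarrow> int \<Rightarrow> nat \<Rightarrow> nat \<Rightarrow> nat" where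
  "perm_of \<omega> x n = snd (snd (mark_of \<omega> x n))"

definition deffuant_step ::
  "nat \<Rightarrow> nat \<Rightarrow> (nat \<Rightarrow> nat) \<Rightarrow> nat set \<Rightarrow> nat set \<Rightarrow> nat set" where
  "deffuant_step F \<theta> p u v =
     (if 1 \<le> hamming F u v \<and> hamming F u v \<le> \<theta> then
        (let S = {i. i < F \<and> (i \<in> u) \<noteq> (i \<in> v)};
             i = (THE i. i \<in> S \<and> (\<forall>j\<in>S. p i \<le> p j))
         in if i \<in> v then insert i u else u - {i})
      else u)"

definition is_deffuant_path ::
  "nat \<Rightarrow> nat \<Rightarrow> (int \<Rightarrow> site) \<Rightarrow> (real \<Rightarrow> int \<Rightarrow> nat set) \<Rightarrow> bool" where
  "is_deffuant_path F \<theta> \<omega> \<eta> \<longleftrightarrow>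
     (\<forall>x t. 0 \<le> t \<and> t < arrival \<omega> x 0 \<longrightarrow> \<eta> t x = init_op \<omega> x) \<and>
     (\<forall>x n t. arrival \<omega> x n \<le> t \<and> t < arrival \<omega> x (Suc n) \<longrightarrow>
        \<eta> t x = \<eta> (arrival \<omega> x n) x) \<and>
     (\<forall>x n v. (\<forall>\<^sub>F s in at_left (arrival \<omega> x n). \<eta> s (nbr \<omega> x n) = v) \<longrightarrow>
        \<eta> (arrival \<omega> x n) x =
          deffuant_step F \<theta> (perm_of \<omega> x n)
            (if n = 0 then init_op \<omega> x else \<eta> (arrival \<omega> x (n - 1)) x) v)"

end

theory Submission
  imports Defs
begin

text \<open>Record on each edge the issues on which its end sites disagree. An update moves one disagreement from an
  edge carrying at most \<open>\<theta>\<close> of them (an active edge) to the adjacent edge, where it is added or cancels; edges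
  carrying more than \<open>\<theta>\<close> are frozen. The sum of \<open>min h \<theta>\<close> over the edges never increases and drops at each
  collision, that is, unless a disagreement joins an edge with fewer than \<open>\<theta>\<close>. By stationarity each edge sees
  finitely many collisions, so eventually it is either frozen forever or active forever.

  If no edge were eventually frozen, the mean of \<open>phi h\<close> would tend to a nonpositive limit. It is however
  nondecreasing, and gains each time an initially frozen edge is first hit by an issue that is not already
  on it. Given the number \<open>j\<close> of its issues this has probability \<open>1 - j / F\<close>, and for \<open>F \<ge> 4 * \<theta> - 1\<close> a count
  with binomial coefficients makes the limit positive.

  By ergodicity there are frozen edges on both sides of every site. Between two of them, a left-to-right
  sequence of rings would carry any remaining movable disagreement into a collision; hence everything stops.
  Flipping issues everywhere preserves the law, so every opinion is a possible limit at a site, and by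
  ergodicity every opinion does occur as a limit.\<close>

text \<open>The path \<open>\<eta>\<close> is an arbitrary function obeying the update rules almost
  surely; neither its measurability nor its behaviour under shifts and flips is given. Events and
  expectations are therefore written with the discretised opinions \<open>opin m\<close>, through
  limits in \<open>m\<close>; paths mainly serve to show that these quantities stabilise. Up to any
  time some sites on both sides have not rung, and they cut the line into finite blocks in which,
  for fine steps, updates happen one at a time. Conservation is shown block by block and turned into
  expectations.

  \<open>phi j\<close> equals \<open>|j - \<theta>| - \<theta>\<close>. The emitting edge always
  gains 1 and the receiving edge gains or loses 1, so the sum stays or grows by 2; it grows when the
  receiving gap moves away from \<open>\<theta>\<close>. The resulting lower bound is
  \<open>(F + 2 - 4 * \<theta>) * 2 ^ (F - 1) - 2 * 2 ^ (F - 2)\<close> up to a factor, nonnegative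
  precisely when \<open>F \<ge> 4 * \<theta> - 1\<close>. Since it may vanish, strictness has a
  separate source: a gain on an initially active edge, which has positive probability.\<close>

section \<open>Independent sites on the line\<close>

text \<open>Convergence on a generating pi-system passes to the generated sigma-algebra, because the
  sets on which \<open>f n\<close> converges to \<open>g\<close> form a Dynkin system. Domination by
  the fixed probability measure \<open>P\<close> lets the limit and a countable disjoint sum be
  exchanged. It serves \<open>mixing\<close>, once for each of its two events.\<close>

lemma tendsto_measure_induct_disjoint:
  fixes P :: "'a measure" and f :: "nat \<Rightarrow> 'a set \<Rightarrow> real" and g :: "'a set \<Rightarrow> real"
  assumes "prob_space P" and G: "Int_stable G" "G \<subseteq> Pow (space P)" "sets P = sigma_sets (space P) G"
    and fc: "\<And>n A. A \<in> sets P \<Longrightarrow> f n (space P - A) = f n (space P) - f n A"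
    and fu: "\<And>n A. disjoint_family A \<Longrightarrow> range A \<subseteq> sets P \<Longrightarrow> (\<lambda>i::nat. f n (A i)) sums f n (\<Union>i. A i)"
    and fb: "\<And>n A. A \<in> sets P \<Longrightarrow> 0 \<le> f n A \<and> f n A \<le> measure P A"
    and gc: "\<And>A. A \<in> sets P \<Longrightarrow> g (space P - A) = g (space P) - g A"
    and gu: "\<And>A. disjoint_family A \<Longrightarrow> range A \<subseteq> sets P \<Longrightarrow> (\<lambda>i::nat. g (A i)) sums g (\<Union>i. A i)"
    and gb: "\<And>A. A \<in> sets P \<Longrightarrow> 0 \<le> g A \<and> g A \<le> measure P A"
    and basic: "\<And>A. A \<in> G \<Longrightarrow> (\<lambda>n. f n A) \<longlonglongrightarrow> g A"
    and space: "(\<lambda>n. f n (space P)) \<longlonglongrightarrow> g (space P)"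
    and C: "C \<in> sets P"
  shows "(\<lambda>n. f n C) \<longlonglongrightarrow> g C"
proof -
  interpret prob_space P by fact
  have "C \<in> sigma_sets (space P) G" using C G by simp
  with G(1,2) show ?thesis
  proof (induction rule: sigma_sets_induct_disjoint)
    case (basic A) then show ?case by (rule assms(11))
  next
    case empty
    have "f n {} = 0" "g {} = 0" for n using fb[of "{}" n] gb[of "{}"] by auto
    then show ?case by simp
  next
    case (compl A)
    then show ?case using fc gc G(3) space by (auto intro!: tendsto_diff)
  next
    case (union A)
    then have A: "range A \<subseteq> sets P" "disjoint_family A" using G(3) by auto
    have s: "summable (\<lambda>i. measure P (A i))"
      using finite_measure_UNION[OF A] by (rule sums_summable)
    have "\<forall>\<^sub>F (k,n) in at_top \<times>\<^sub>F sequentially. norm (f n (A k)) \<le> measure P (A k)"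
      using fb A by (intro always_eventually) (auto simp: subset_eq)
    from tannerys_theorem[OF union(3) this s]
    have "(\<lambda>n. \<Sum>k. f n (A k)) \<longlonglongrightarrow> (\<Sum>k. g (A k))" by simp
    then show ?case using fu[OF A(2,1)] gu[OF A(2,1)] by (simp add: sums_iff)
  qed
qed

text \<open>Site \<open>z\<close> becomes the origin, so \<open>Q (translate z \<omega>)\<close>
  reads at \<open>z\<close> an event about the origin.\<close>

definition translate :: "int \<Rightarrow> (int \<Rightarrow> 'a) \<Rightarrow> int \<Rightarrow> 'a" where
  "translate z \<omega> = (\<lambda>x. \<omega> (x + z))"

lemma translate_apply: "translate z \<omega> x = \<omega> (x + z)"
  by (simp add: translate_def)

lemma translate_translate [simp]: "translate a (translate b \<omega>) = translate (a + b) \<omega>"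
  by (simp add: translate_def ac_simps)

lemma translate_0 [simp]: "translate 0 \<omega> = \<omega>"
  by (simp add: translate_def)

locale iid_line = prob_space M for M :: "'a measure" +
  assumes space_M [simp]: "space M = UNIV"
begin

abbreviation "P \<equiv> \<Pi>\<^sub>M x\<in>(UNIV::int set). M"

sublocale line: product_prob_space "\<lambda>_. M" "UNIV :: int set"
  by unfold_locales

lemma space_P [simp]: "space P = UNIV"
  by (simp add: space_PiM)

lemma prob_UNIV: "line.prob UNIV = 1"
  using line.P.prob_space by simp

lemma measurable_translate [measurable]: "translate z \<in> P \<rightarrow>\<^sub>M P"
  unfolding translate_def by (rule measurable_PiM_single') auto

text \<open>Product measures are determined by cylinders, and a sitewise map pulls a cylinder back
  to a cylinder. It serves the flips of initial opinions and the time shift of all clocks.\<close>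

lemma distr_map:
  assumes [measurable]: "\<And>x. g x \<in> M \<rightarrow>\<^sub>M M" and "\<And>x. distr M M (g x) = M"
  shows "distr P P (\<lambda>\<omega> x. g x (\<omega> x)) = P"
proof (rule line.PiM_eq)
  fix J :: "int set" and A assume J: "finite J" and A: "\<And>j. j \<in> J \<Longrightarrow> A j \<in> sets M"
  have [measurable]: "(\<lambda>\<omega> x. g x (\<omega> x)) \<in> P \<rightarrow>\<^sub>M P"
    by (rule measurable_PiM_single') auto
  have "emeasure (distr P P (\<lambda>\<omega> x. g x (\<omega> x))) (line.emb UNIV J (Pi\<^sub>E J A)) =
      emeasure P ((\<lambda>\<omega> x. g x (\<omega> x)) -` line.emb UNIV J (Pi\<^sub>E J A) \<inter> space P)"
    using J A by (intro emeasure_distr sets_PiM_I) auto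
  also have "(\<lambda>\<omega> x. g x (\<omega> x)) -` line.emb UNIV J (Pi\<^sub>E J A) \<inter> space P
      = line.emb UNIV J (\<Pi>\<^sub>E j\<in>J. g j -` A j)"
    by (auto simp: prod_emb_def Pi_iff)
  also have "emeasure P \<dots> = (\<Prod>j\<in>J. emeasure M (g j -` A j))"
    using J A measurable_sets[OF assms(1)] by (intro line.emeasure_PiM_emb) auto
  also have "\<dots> = (\<Prod>j\<in>J. emeasure (distr M M (g j)) (A j))"
    using A by (intro prod.cong) (auto simp: emeasure_distr)
  finally show "emeasure (distr P P (\<lambda>\<omega> x. g x (\<omega> x))) (line.emb UNIV J (Pi\<^sub>E J A)) = (\<Prod>j\<in>J. emeasure M (A j))"
    using assms(2) by simp
qed simp

lemma distr_translate: "distr P P (translate z) = P"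
proof -
  have "distr P P (\<lambda>\<omega>. \<lambda>n\<in>UNIV. \<omega> (n + z)) = P"
    by (rule distr_PiM_reindex[where K=UNIV and I=UNIV and f="\<lambda>n. n + z" and M="\<lambda>_. M"]) (auto simp: inj_on_def prob_space_axioms)
  then show ?thesis by (simp add: translate_def[abs_def] restrict_def)
qed

lemma prob_translate:
  assumes "Measurable.pred P Q"
  shows "line.prob {\<omega>. Q (translate z \<omega>)} = line.prob {\<omega>. Q \<omega>}"
proof -
  have "measure (distr P P (translate z)) {\<omega>. Q \<omega>} = line.prob (translate z -` {\<omega>. Q \<omega>} \<inter> space P)"
    using assms by (intro measure_distr) (auto simp: pred_def)
  then show ?thesis by (simp add: distr_translate)
qed

lemma AE_translate: "AE \<omega> in P. Q \<omega> \<Longrightarrow> AE \<omega> in P. Q (translate z \<omega>)"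
  using AE_distrD[of "translate z" P P Q] measurable_translate by (simp only: distr_translate)

text \<open>Two cylinders depend on finitely many sites, so after a large shift they are exactly
  independent. General events follow by fixing one of the two and extending the other.\<close>

lemma mixing:
  assumes A: "A \<in> sets P" and C: "C \<in> sets P"
  shows "(\<lambda>n::nat. line.prob (A \<inter> translate (int n) -` C)) \<longlonglongrightarrow> line.prob A * line.prob C"
proof -
  let ?G = "prod_algebra (UNIV :: int set) (\<lambda>_. M)"
  have G: "Int_stable ?G" "?G \<subseteq> Pow (space P)" "sets P = sigma_sets (space P) ?G"
    using prod_algebra_sets_into_space[of UNIV "\<lambda>_. M"] by (auto simp: Int_stable_prod_algebra sets_PiM)
  have vs[measurable]: "translate z -` C \<in> sets P" if "C \<in> sets P" for z C
    using measurable_sets[OF measurable_translate that] by simp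
  have pv: "line.prob (translate z -` C) = line.prob C" if "C \<in> sets P" for z C
    using measure_distr[of "translate z" P P C] that by (simp add: distr_translate)
  have sp: "UNIV \<in> sets P" using sets.top[of P] by simp
  have cyl: "(\<lambda>n::nat. line.prob (A \<inter> translate (int n) -` C)) \<longlonglongrightarrow> line.prob A * line.prob C"
    if A: "A \<in> ?G" and C: "C \<in> ?G" for A C
  proof -
    from prod_algebraE[OF A] obtain J E where
      J: "A = line.emb UNIV J (Pi\<^sub>E J E)" "finite J" "\<And>i. i \<in> J \<Longrightarrow> E i \<in> sets M" by metis
    from prod_algebraE[OF C] obtain K F where
      K: "C = line.emb UNIV K (Pi\<^sub>E K F)" "finite K" "\<And>i. i \<in> K \<Longrightarrow> F i \<in> sets M" by metis
    \<comment> \<open>Shifts for which the two finite sets of sites meet; beyond the largest of them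
      the cylinders are independent.\<close>
    have "finite {n::nat. \<exists>j\<in>J. \<exists>k\<in>K. k + int n = j}"
    proof (rule finite_subset)
      show "{n::nat. \<exists>j\<in>J. \<exists>k\<in>K. k + int n = j} \<subseteq> (\<lambda>(j,k). nat (j - k)) ` (J \<times> K)"
        by force
    qed (use J K in auto)
    then obtain N where N: "\<And>n j k. n \<ge> N \<Longrightarrow> j \<in> J \<Longrightarrow> k \<in> K \<Longrightarrow> k + int n \<noteq> j"
      unfolding finite_nat_set_iff_bounded by (metis (mono_tags, lifting) mem_Collect_eq not_le)
    have "line.prob (A \<inter> translate (int n) -` C) = line.prob A * line.prob C" if "n \<ge> N" for n
    proof -
      let ?K = "(\<lambda>k. k + int n) ` K"
      let ?E = "\<lambda>i. if i \<in> J then E i else F (i - int n)"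
      have dj: "J \<inter> ?K = {}" using N[OF that] by auto
      have "A \<inter> translate (int n) -` C = line.emb UNIV (J \<union> ?K) (Pi\<^sub>E (J \<union> ?K) ?E)"
      proof (rule set_eqI)
        fix \<omega> :: "int \<Rightarrow> 'a"
        have "(\<forall>i\<in>J \<union> ?K. \<omega> i \<in> ?E i) \<longleftrightarrow> (\<forall>i\<in>J. \<omega> i \<in> E i) \<and> (\<forall>i\<in>K. \<omega> (i + int n) \<in> F i)"
          using N[OF that] by (auto simp: ball_Un)
        then show "\<omega> \<in> A \<inter> translate (int n) -` C \<longleftrightarrow> \<omega> \<in> line.emb UNIV (J \<union> ?K) (Pi\<^sub>E (J \<union> ?K) ?E)"
          unfolding J(1) K(1) prod_emb_def by (simp add: PiE_iff restrict_PiE_iff translate_apply)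
      qed
      moreover have "line.prob \<dots> = (\<Prod>i\<in>J \<union> ?K. prob (?E i))"
        using J K dj by (intro line.measure_PiM_emb) auto
      moreover have "\<dots> = (\<Prod>i\<in>J. prob (?E i)) * (\<Prod>i\<in>?K. prob (?E i))"
        using dj J K by (intro prod.union_disjoint) auto
      moreover have "(\<Prod>i\<in>J. prob (?E i)) = line.prob A"
        unfolding J(1) using J by (subst line.measure_PiM_emb) auto
      moreover have "(\<Prod>i\<in>?K. prob (?E i)) = (\<Prod>i\<in>K. prob (F i))"
        by (subst prod.reindex) (use N[OF that] in \<open>auto simp: inj_on_def intro!: prod.cong dest: N[OF that]\<close>)
      moreover have "(\<Prod>i\<in>K. prob (F i)) = line.prob C"
        unfolding K(1) using K by (subst line.measure_PiM_emb) auto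
      ultimately show ?thesis by simp
    qed
    then show ?thesis
      by (intro tendsto_eventually) (auto simp: eventually_sequentially)
  qed
  have Gs: "?G \<subseteq> sets P" unfolding G(3) by auto
  have one: "(\<lambda>n::nat. line.prob (A \<inter> translate (int n) -` C)) \<longlonglongrightarrow> line.prob A * line.prob C"
    if A: "A \<in> ?G" and C: "C \<in> sets P" for A C
  proof (rule tendsto_measure_induct_disjoint[OF line.prob_space_axioms G])
    have [measurable]: "A \<in> sets P" using A Gs by auto
    fix n :: nat and B assume B[measurable]: "B \<in> sets P"
    have "line.prob (A \<inter> translate (int n) -` (space P - B)) = line.prob (A - A \<inter> translate (int n) -` B)"
      by (rule arg_cong[where f="line.prob"]) auto
    also have "\<dots> = line.prob A - line.prob (A \<inter> translate (int n) -` B)"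
      by (rule line.finite_measure_Diff) auto
    finally show "line.prob (A \<inter> translate (int n) -` (space P - B)) = line.prob (A \<inter> translate (int n) -` space P) - line.prob (A \<inter> translate (int n) -` B)"
      by simp
    show "0 \<le> line.prob (A \<inter> translate (int n) -` B) \<and> line.prob (A \<inter> translate (int n) -` B) \<le> line.prob B"
      using line.finite_measure_mono[of "A \<inter> translate (int n) -` B" "translate (int n) -` B"] by (auto simp: pv[OF B])
    show "line.prob A * line.prob (space P - B) = line.prob A * line.prob (space P) - line.prob A * line.prob B"
      unfolding line.prob_compl[OF B] by (simp add: algebra_simps prob_UNIV)
    show "0 \<le> line.prob A * line.prob B \<and> line.prob A * line.prob B \<le> line.prob B"
      by (simp add: mult_left_le_one_le)
  next
    have [measurable]: "A \<in> sets P" using A Gs by auto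
    fix n :: nat and B :: "nat \<Rightarrow> _" assume B: "disjoint_family B" "range B \<subseteq> sets P"
    have [measurable]: "B i \<in> sets P" for i using B by auto
    have "(\<lambda>i. line.prob (A \<inter> translate (int n) -` B i)) sums line.prob (\<Union>i. A \<inter> translate (int n) -` B i)"
      using B by (intro line.finite_measure_UNION) (auto simp: disjoint_family_on_def)
    then show "(\<lambda>i. line.prob (A \<inter> translate (int n) -` B i)) sums line.prob (A \<inter> translate (int n) -` \<Union> (range B))"
      by (simp only: vimage_UN Int_UN_distrib)
    show "(\<lambda>i. line.prob A * line.prob (B i)) sums (line.prob A * line.prob (\<Union> (range B)))"
      using B by (intro sums_mult line.finite_measure_UNION) auto
  qed (use A C cyl in \<open>simp_all add: prob_UNIV\<close>)
  show ?thesis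
  proof (rule tendsto_measure_induct_disjoint[OF line.prob_space_axioms G, where f="\<lambda>n A. line.prob (A \<inter> translate (int n) -` C)" and g="\<lambda>A. line.prob A * line.prob C"])
    fix n :: nat and B assume B[measurable]: "B \<in> sets P"
    have [measurable]: "C \<in> sets P" by fact
    have "line.prob ((space P - B) \<inter> translate (int n) -` C) = line.prob (translate (int n) -` C - B \<inter> translate (int n) -` C)"
      by (rule arg_cong[where f="line.prob"]) auto
    also have "\<dots> = line.prob (translate (int n) -` C) - line.prob (B \<inter> translate (int n) -` C)"
      by (rule line.finite_measure_Diff) auto
    finally show "line.prob ((space P - B) \<inter> translate (int n) -` C) = line.prob (space P \<inter> translate (int n) -` C) - line.prob (B \<inter> translate (int n) -` C)"
      by simp
    show "0 \<le> line.prob (B \<inter> translate (int n) -` C) \<and> line.prob (B \<inter> translate (int n) -` C) \<le> line.prob B"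
      using line.finite_measure_mono[of "B \<inter> translate (int n) -` C" "B"] by auto
    show "line.prob (space P - B) * line.prob C = line.prob (space P) * line.prob C - line.prob B * line.prob C"
      unfolding line.prob_compl[OF B] by (simp add: algebra_simps prob_UNIV)
    show "0 \<le> line.prob B * line.prob C \<and> line.prob B * line.prob C \<le> line.prob B"
      by (simp add: mult_right_le_one_le)
  next
    fix n :: nat and B :: "nat \<Rightarrow> _" assume B: "disjoint_family B" "range B \<subseteq> sets P"
    have [measurable]: "B i \<in> sets P" "C \<in> sets P" for i using B C by auto
    have "(\<lambda>i. line.prob (B i \<inter> translate (int n) -` C)) sums line.prob (\<Union>i. B i \<inter> translate (int n) -` C)"
      using B by (intro line.finite_measure_UNION) (auto simp: disjoint_family_on_def)
    then show "(\<lambda>i. line.prob (B i \<inter> translate (int n) -` C)) sums line.prob (\<Union> (range B) \<inter> translate (int n) -` C)"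
      by simp
    show "(\<lambda>i. line.prob (B i) * line.prob C) sums (line.prob (\<Union> (range B)) * line.prob C)"
      using B by (intro sums_mult2 line.finite_measure_UNION) auto
  qed (use A C one in \<open>simp_all add: prob_UNIV pv\<close>)
qed

text \<open>Mixing applied to an invariant event of probability \<open>p\<close> gives
  \<open>p = p * p\<close>.\<close>

lemma ergodic:
  assumes Q: "Measurable.pred P Q" and inv: "\<And>\<omega>. Q (translate 1 \<omega>) \<longleftrightarrow> Q \<omega>"
    and pos: "line.prob {\<omega>. Q \<omega>} > 0"
  shows "AE \<omega> in P. Q \<omega>"
proof -
  let ?A = "{\<omega>. Q \<omega>}"
  have A: "?A \<in> sets P" using Q by (simp add: pred_def)
  have "Q (translate (int n) \<omega>) \<longleftrightarrow> Q \<omega>" for n \<omega>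
  proof (induction n)
    case (Suc n)
    have "translate (int (Suc n)) \<omega> = translate 1 (translate (int n) \<omega>)" by (simp add: add.commute)
    then show ?case using inv Suc by metis
  qed simp
  then have "?A \<inter> translate (int n) -` ?A = ?A" for n by auto
  with mixing[OF A A] have "line.prob ?A = line.prob ?A * line.prob ?A"
    by (simp add: LIMSEQ_const_iff)
  with pos have "line.prob ?A = 1" by simp
  then show ?thesis using line.prob_eq_1[OF A] by simp
qed

lemma infinitely_often_Suc_iff:
  "(\<forall>x::nat. \<exists>y\<ge>x. R (Suc y)) \<longleftrightarrow> (\<forall>x::nat. \<exists>y\<ge>x. R y)"
  by (metis Suc_le_D Suc_le_mono le_Suc_eq)

text \<open>Infinitely many occurrences in a given direction form a shift invariant event whose
  probability is at least that of \<open>Q\<close>, so ergodicity applies. It is used for quiet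
  sites, frozen edges and limiting opinions.\<close>

lemma AE_infinitely_often_translate:
  assumes Q[measurable]: "Measurable.pred P Q" and pos: "line.prob {\<omega>. Q \<omega>} > 0"
  shows "AE \<omega> in P. \<forall>x. (\<exists>z\<ge>x. Q (translate z \<omega>)) \<and> (\<exists>z\<le>x. Q (translate z \<omega>))"
proof -
  have *: "AE \<omega> in P. \<forall>x::nat. \<exists>y\<ge>x. Q (translate (s * int y) \<omega>)" (is "AE \<omega> in P. ?R \<omega>") if s: "s = 1 \<or> s = -1" for s :: int
  proof (rule ergodic)
    have [measurable]: "Measurable.pred P (\<lambda>\<omega>. Q (translate z \<omega>))" for z
      by measurable
    show "Measurable.pred P ?R" by measurable
    show "?R (translate 1 \<omega>) \<longleftrightarrow> ?R \<omega>" for \<omega>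
      using s
    proof
      assume [simp]: "s = 1"
      show ?thesis
        using infinitely_often_Suc_iff[of "\<lambda>y. Q (translate (int y) \<omega>)"] by (simp add: add.commute)
    next
      assume [simp]: "s = -1"
      show ?thesis
        using infinitely_often_Suc_iff[of "\<lambda>y. Q (translate (1 - int y) \<omega>)"] by (simp add: algebra_simps)
    qed
    \<comment> \<open>Decreasing events with intersection \<open>?R\<close>; each contains a
      translate of \<open>Q\<close>, which bounds the probability of the intersection from
      below.\<close>
    let ?B = "\<lambda>n::nat. {\<omega>. \<exists>y\<ge>n. Q (translate (s * int y) \<omega>)}"
    have B[measurable]: "?B n \<in> sets P" for n
    proof -
      have "Measurable.pred P (\<lambda>\<omega>. \<exists>y\<ge>n. Q (translate (s * int y) \<omega>))" by measurable
      then show ?thesis by (simp add: pred_def)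
    qed
    have "line.prob {\<omega>. Q \<omega>} \<le> line.prob (?B n)" for n
      using line.finite_measure_mono[of "{\<omega>. Q (translate (s * int n) \<omega>)}" "?B n"] B
      by (auto simp: prob_translate)
    moreover have "(\<lambda>n. line.prob (?B n)) \<longlonglongrightarrow> line.prob (\<Inter>n. ?B n)"
      using B by (intro line.finite_Lim_measure_decseq) (auto simp: decseq_def intro: order_trans)
    ultimately have "line.prob {\<omega>. Q \<omega>} \<le> line.prob (\<Inter>n. ?B n)"
      by (intro LIMSEQ_le_const) auto
    also have "(\<Inter>n. ?B n) = {\<omega>. ?R \<omega>}" by auto
    finally show "line.prob {\<omega>. ?R \<omega>} > 0" using pos by simp
  qed
  have "AE \<omega> in P. \<forall>x::nat. \<exists>y\<ge>x. Q (translate (int y) \<omega>)" "AE \<omega> in P. \<forall>x::nat. \<exists>y\<ge>x. Q (translate (- int y) \<omega>)"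
    using *[of 1] *[of "-1"] by simp_all
  then show ?thesis
  proof eventually_elim
    case (elim \<omega>)
    show ?case
    proof (intro allI conjI)
      fix x :: int
      from elim(1) obtain y where "y \<ge> nat \<bar>x\<bar>" "Q (translate (int y) \<omega>)" by blast
      then show "\<exists>z\<ge>x. Q (translate z \<omega>)" by (intro exI[of _ "int y"]) auto
      from elim(2) obtain y where "y \<ge> nat \<bar>x\<bar>" "Q (translate (- int y) \<omega>)" by blast
      then show "\<exists>z\<le>x. Q (translate z \<omega>)" by (intro exI[of _ "- int y"]) auto
    qed
  qed
qed

text \<open>\<open>T\<close> is a measure preserving time shift of one site, and \<open>J x\<close>
  is independent of what follows the shift. Trials at successive times are then independent with a
  common positive probability of success, so success recurs almost surely. It yields infinitely many
  sweeps.\<close>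

lemma AE_infinitely_often_iterate:
  fixes T :: "'a \<Rightarrow> 'a" and J :: "int \<Rightarrow> 'a \<Rightarrow> bool"
  assumes T[measurable]: "T \<in> M \<rightarrow>\<^sub>M M" and dT: "distr M M T = M" and I: "finite I"
    and J[measurable]: "\<And>x. Measurable.pred M (J x)"
    and pos: "\<And>x. x \<in> I \<Longrightarrow> prob {s. J x s} > 0"
    and indep: "\<And>x A. x \<in> I \<Longrightarrow> A \<in> sets M \<Longrightarrow> prob {s. J x s \<and> T s \<in> A} = prob {s. J x s} * prob A"
  shows "AE \<omega> in P. \<forall>t0. \<exists>t\<ge>t0. \<forall>x\<in>I. J x ((T ^^ t) (\<omega> x))"
proof -
  define TT where "TT = (\<lambda>(\<omega>::int \<Rightarrow> 'a) x. T (\<omega> x))"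
  define H where "H = (\<lambda>\<omega>. \<forall>x\<in>I. J x (\<omega> x))"
  have TT[measurable]: "TT \<in> P \<rightarrow>\<^sub>M P"
    unfolding TT_def by (rule measurable_PiM_single') auto
  have dTT: "distr P P TT = P"
    unfolding TT_def by (rule distr_map) (auto simp: dT)
  have H[measurable]: "Measurable.pred P H"
    unfolding H_def using I by measurable
  have Hs[measurable]: "{\<omega>. H \<omega>} \<in> sets P" using H by (simp add: pred_def)
  have Js[measurable]: "{s. J x s} \<in> sets M" for x using J[of x] by (simp add: pred_def)
  have TTv: "TT -` A \<in> sets P" if "A \<in> sets P" for A
    using measurable_sets[OF TT that] by simp
  have Tv: "T -` A \<in> sets M" "prob (T -` A) = prob A" if "A \<in> sets M" for A
    using measurable_sets[OF T that] measure_distr[OF T that] by (simp_all add: dT)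
  have M1: "prob UNIV = 1" using prob_space by simp
  \<comment> \<open>Joint law of \<open>H\<close> now and of a cylinder after the shift; it
    factorises site by site.\<close>
  have main: "line.prob ({\<omega>. H \<omega>} \<inter> TT -` line.emb UNIV K (Pi\<^sub>E K A)) = (\<Prod>x\<in>I. prob {s. J x s}) * (\<Prod>x\<in>K. prob (A x))"
    if K: "finite K" and A: "\<And>x. x \<in> K \<Longrightarrow> A x \<in> sets M" for K A
  proof -
    let ?B = "\<lambda>x. {s. (x \<in> I \<longrightarrow> J x s) \<and> (x \<in> K \<longrightarrow> T s \<in> A x)}"
    have B: "?B x \<in> sets M" for x
    proof -
      have "?B x = (if x \<in> I then {s. J x s} else space M) \<inter> (if x \<in> K then T -` A x else space M)" by auto
      then show ?thesis using A Tv Js by (auto simp del: space_M)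
    qed
    have "{\<omega>. H \<omega>} \<inter> TT -` line.emb UNIV K (Pi\<^sub>E K A) = line.emb UNIV (I \<union> K) (Pi\<^sub>E (I \<union> K) ?B)"
      by (auto simp: prod_emb_def H_def TT_def PiE_iff restrict_PiE_iff)
    also have "line.prob \<dots> = (\<Prod>x\<in>I \<union> K. prob (?B x))"
      using I K B by (intro line.measure_PiM_emb) auto
    also have "\<dots> = (\<Prod>x\<in>I \<union> K. (if x \<in> I then prob {s. J x s} else 1) * (if x \<in> K then prob (A x) else 1))"
    proof (rule prod.cong)
      fix x assume "x \<in> I \<union> K"
      then show "prob (?B x) = (if x \<in> I then prob {s. J x s} else 1) * (if x \<in> K then prob (A x) else 1)"
        using indep[of x "A x"] A[of x] Tv(2)[of "A x"] by (cases "x \<in> I"; cases "x \<in> K") (auto simp: vimage_def)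
    qed simp
    also have "\<dots> = (\<Prod>x\<in>I. prob {s. J x s}) * (\<Prod>x\<in>K. prob (A x))"
    proof -
      have "(\<Prod>x\<in>I \<union> K. if x \<in> I then prob {s. J x s} else 1) = (\<Prod>x\<in>I. prob {s. J x s})"
        using I K by (intro prod.mono_neutral_cong_right) auto
      moreover have "(\<Prod>x\<in>I \<union> K. if x \<in> K then prob (A x) else 1) = (\<Prod>x\<in>K. prob (A x))"
        using I K by (intro prod.mono_neutral_cong_right) auto
      ultimately show ?thesis by (simp add: prod.distrib)
    qed
    finally show ?thesis .
  qed
  let ?p = "\<Prod>x\<in>I. prob {s. J x s}"
  have p: "?p > 0" using pos by (intro prod_pos) auto
  have pH: "line.prob {\<omega>. H \<omega>} = ?p"
  proof -
    have "TT -` line.emb UNIV {} (Pi\<^sub>E {} (\<lambda>_. {})) = UNIV" by (auto simp: prod_emb_def restrict_def)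
    then show ?thesis using main[of "{}" "\<lambda>_. {}"] by simp
  qed
  have eH: "emeasure P {\<omega>. H \<omega>} = ennreal ?p"
    using pH by (simp add: line.emeasure_eq_measure)
  \<comment> \<open>Conditioning on \<open>H\<close> does not affect the law of the shifted
    configuration. Stated as an identity of measures, this extends the factorisation from cylinders
    to all events.\<close>
  have dH: "distr (uniform_measure P {\<omega>. H \<omega>}) P TT = P"
  proof (rule line.PiM_eq)
    fix K :: "int set" and A assume K: "finite K" and A: "\<And>x. x \<in> K \<Longrightarrow> A x \<in> sets M"
    let ?A = "line.emb UNIV K (Pi\<^sub>E K A)"
    have A': "?A \<in> sets P" using K A by (intro sets_PiM_I) auto
    have "emeasure (distr (uniform_measure P {\<omega>. H \<omega>}) P TT) ?A = emeasure (uniform_measure P {\<omega>. H \<omega>}) (TT -` ?A \<inter> space P)"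
      using A' by (subst emeasure_distr) auto
    also have "\<dots> = emeasure P ({\<omega>. H \<omega>} \<inter> TT -` ?A) / emeasure P {\<omega>. H \<omega>}"
      using TTv[OF A'] Hs by (simp add: emeasure_uniform_measure)
    also have "\<dots> = ennreal (?p * (\<Prod>x\<in>K. prob (A x))) / ennreal ?p"
      using main[OF K A] by (simp add: line.emeasure_eq_measure eH[unfolded line.emeasure_eq_measure])
    also have "\<dots> = ennreal (\<Prod>x\<in>K. prob (A x))"
      using p by (subst divide_ennreal) (auto intro!: mult_nonneg_nonneg prod_nonneg)
    also have "\<dots> = (\<Prod>x\<in>K. emeasure M (A x))"
      by (simp add: emeasure_eq_measure prod_ennreal)
    finally show "emeasure (distr (uniform_measure P {\<omega>. H \<omega>}) P TT) ?A = (\<Prod>x\<in>K. emeasure M (A x))" .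
  qed simp
  have ind: "line.prob ({\<omega>. H \<omega>} \<inter> TT -` A) = ?p * line.prob A" if A: "A \<in> sets P" for A
  proof -
    have "emeasure P A = emeasure (distr (uniform_measure P {\<omega>. H \<omega>}) P TT) A"
      using dH by simp
    also have "\<dots> = emeasure P ({\<omega>. H \<omega>} \<inter> TT -` A) / emeasure P {\<omega>. H \<omega>}"
      using TTv[OF A] Hs A by (subst emeasure_distr) (auto simp: emeasure_uniform_measure)
    finally have "ennreal (line.prob A) = ennreal (line.prob ({\<omega>. H \<omega>} \<inter> TT -` A) / ?p)"
      using p by (simp add: line.emeasure_eq_measure eH[unfolded line.emeasure_eq_measure] divide_ennreal)
    then have "line.prob A = line.prob ({\<omega>. H \<omega>} \<inter> TT -` A) / ?p"
      using p by (subst (asm) ennreal_inj) auto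
    then show ?thesis using p by (simp add: field_simps)
  qed
  have pTT: "line.prob (TT -` A) = line.prob A" if "A \<in> sets P" for A
    using measure_distr[OF TT that] dTT by simp
  \<comment> \<open>No success in the first \<open>k\<close> trials, an event of probability
    \<open>(1 - ?p) ^ k\<close>.\<close>
  let ?N = "\<lambda>k. {\<omega>. \<forall>t<k. \<not> H ((TT ^^ t) \<omega>)}"
  have [measurable]: "(TT ^^ t) \<in> P \<rightarrow>\<^sub>M P" for t
    by (rule measurable_compose_n) measurable
  have N[measurable]: "?N k \<in> sets P" for k
  proof -
    have "Measurable.pred P (\<lambda>\<omega>. \<forall>t<k. \<not> H ((TT ^^ t) \<omega>))" by measurable
    then show ?thesis by (simp add: pred_def)
  qed
  have Nk: "line.prob (?N k) = (1 - ?p) ^ k" for k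
  proof (induction k)
    case 0 then show ?case by (simp add: prob_UNIV)
  next
    case (Suc k)
    have "?N (Suc k) = TT -` ?N k - {\<omega>. H \<omega>} \<inter> TT -` ?N k"
      by (auto simp: All_less_Suc2 funpow_Suc_right simp del: funpow.simps(2))
    also have "line.prob \<dots> = line.prob (TT -` ?N k) - line.prob ({\<omega>. H \<omega>} \<inter> TT -` ?N k)"
      using TTv[OF N] Hs by (intro line.finite_measure_Diff) auto
    also have "\<dots> = (1 - ?p) * line.prob (?N k)"
      using ind[OF N] pTT[OF N] by (simp add: algebra_simps)
    finally show ?case using Suc by simp
  qed
  have p1: "?p \<le> 1" using pH by (metis line.prob_le_1)
  have "(\<lambda>k. (1 - ?p) ^ k) \<longlonglongrightarrow> 0"
    using p p1 by (intro LIMSEQ_realpow_zero) auto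
  moreover have "(\<lambda>k. line.prob (?N k)) \<longlonglongrightarrow> line.prob (\<Inter>k. ?N k)"
    using N by (intro line.finite_Lim_measure_decseq) (auto simp: decseq_def)
  ultimately have "line.prob (\<Inter>k. ?N k) = 0"
    using LIMSEQ_unique by (simp add: Nk)
  then have "(\<Inter>k. ?N k) \<in> null_sets P"
    using N by (auto simp: null_sets_def line.emeasure_eq_measure)
  then have ex: "AE \<omega> in P. \<exists>t. H ((TT ^^ t) \<omega>)"
    by (rule AE_I') auto
  have dn: "distr P P (TT ^^ t) = P" for t
  proof (induction t)
    case 0
    show ?case using distr_id[of P] by (simp add: id_def)
  next
    case (Suc t)
    have "distr P P (TT ^^ Suc t) = distr (distr P P (TT ^^ t)) P TT"
      by (subst distr_distr) auto
    then show ?case by (simp only: Suc dTT)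
  qed
  \<comment> \<open>Stationarity restarts the trials at any time \<open>t0\<close>.\<close>
  have "AE \<omega> in P. \<exists>t. H ((TT ^^ t) ((TT ^^ t0) \<omega>))" for t0
  proof (rule AE_distrD[of "TT ^^ t0" P P "\<lambda>\<omega>. \<exists>t. H ((TT ^^ t) \<omega>)"])
    show "TT ^^ t0 \<in> P \<rightarrow>\<^sub>M P" by measurable
    show "AE \<omega> in distr P P (TT ^^ t0). \<exists>t. H ((TT ^^ t) \<omega>)" using ex by (simp only: dn)
  qed
  then have "AE \<omega> in P. \<forall>t0. \<exists>t. H ((TT ^^ t) ((TT ^^ t0) \<omega>))"
    by (simp add: AE_all_countable)
  moreover have "(TT ^^ t) \<omega> = (\<lambda>x. (T ^^ t) (\<omega> x))" for t \<omega>
    by (induction t) (auto simp: TT_def)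
  ultimately show ?thesis
  proof (elim eventually_mono, intro allI)
    fix \<omega> and t0 :: nat
    assume tt: "\<And>t \<omega>. (TT ^^ t) \<omega> = (\<lambda>x. (T ^^ t) (\<omega> x))" and "\<forall>t0. \<exists>t. H ((TT ^^ t) ((TT ^^ t0) \<omega>))"
    then obtain t where "H (\<lambda>x. (T ^^ t) ((T ^^ t0) (\<omega> x)))" by (auto simp: tt)
    then show "\<exists>t\<ge>t0. \<forall>x\<in>I. J x ((T ^^ t) (\<omega> x))"
      by (intro exI[of _ "t + t0"]) (simp add: H_def funpow_add)
  qed
qed

end

section \<open>Renewal sequences with exponential gaps\<close>

lemma prob_space_exp_law: "prob_space exp_law"
  unfolding exp_law_def by (rule prob_space_exponential_density) simp

lemma sets_exp_law [simp, measurable_cong]: "sets exp_law = sets borel"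
  by (simp add: exp_law_def)

lemma space_exp_law [simp]: "space exp_law = UNIV"
  by (simp add: exp_law_def)

text \<open>Memorylessness in integral form: beyond \<open>t\<close> the density is
  \<open>exp (- t)\<close> times its shifted copy.\<close>

lemma nn_integral_exp_law_shift:
  assumes g[measurable]: "g \<in> borel_measurable borel" and t: "0 \<le> t"
  shows "(\<integral>\<^sup>+e. g (e - t) * indicator {t<..} e \<partial>exp_law) = exp (- t) * (\<integral>\<^sup>+e. g e \<partial>exp_law)"
proof -
  have "(\<integral>\<^sup>+e. g (e - t) * indicator {t<..} e \<partial>exp_law)
      = (\<integral>\<^sup>+e. ennreal (exponential_density 1 e) * (g (e - t) * indicator {t<..} e) \<partial>lborel)"
    unfolding exp_law_def by (subst nn_integral_density) auto
  also have "\<dots> = (\<integral>\<^sup>+u. ennreal (exponential_density 1 (t + u)) * (g u * indicator {t<..} (t + u)) \<partial>lborel)"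
    by (subst nn_integral_real_affine[where c=1 and t=t]) auto
  also have "\<dots> = (\<integral>\<^sup>+u. ennreal (exp (- t)) * (ennreal (exponential_density 1 u) * g u) \<partial>lborel)"
  proof (rule nn_integral_cong_AE)
    show "AE u in lborel. ennreal (exponential_density 1 (t + u)) * (g u * indicator {t<..} (t + u)) =
       ennreal (exp (- t)) * (ennreal (exponential_density 1 u) * g u)"
      using AE_lborel_singleton[of 0]
    proof eventually_elim
      case (elim u)
      show ?case
      proof (cases "u > 0")
        case True
        then have "ennreal (exponential_density 1 (t + u)) = ennreal (exp (- t)) * ennreal (exponential_density 1 u)"
          using t by (simp add: exponential_density_def ennreal_mult[symmetric] mult_exp_exp)
        then show ?thesis using True by (simp add: mult.assoc)
      next
        case False
        with elim have "u < 0" by simp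
        then show ?thesis by (simp add: exponential_density_def)
      qed
    qed
  qed
  also have "\<dots> = exp (- t) * (\<integral>\<^sup>+u. ennreal (exponential_density 1 u) * g u \<partial>lborel)"
    by (rule nn_integral_cmult) auto
  also have "(\<integral>\<^sup>+u. ennreal (exponential_density 1 u) * g u \<partial>lborel) = (\<integral>\<^sup>+e. g e \<partial>exp_law)"
    unfolding exp_law_def by (subst nn_integral_density) auto
  finally show ?thesis .
qed

lemma emeasure_exp_law_greaterThan:
  assumes "0 \<le> t" shows "emeasure exp_law {t<..} = exp (- t)"
  using nn_integral_exp_law_shift[of "\<lambda>_. 1" t] assms prob_space.emeasure_space_1[OF prob_space_exp_law]
  by simp

lemma AE_exp_law_pos: "AE e in exp_law. 0 < e"
proof -
  have "prob_space.prob exp_law {0<..} = 1"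
    using emeasure_exp_law_greaterThan[of 0] by (simp add: measure_def)
  then show ?thesis
    using prob_space.prob_eq_1[OF prob_space_exp_law, of "{0<..}"] by simp
qed

lemma AE_exp_law_neq: "AE e in exp_law. e \<noteq> c"
  unfolding exp_law_def by (subst AE_density) (use AE_lborel_singleton[of c] in \<open>auto elim: eventually_mono\<close>)

lemma emeasure_exp_law_Ioc_pos:
  assumes "0 \<le> a" "a < b" shows "0 < emeasure exp_law {a<..b}"
proof -
  have "emeasure exp_law {a<..b} = emeasure exp_law {a<..} - emeasure exp_law {b<..}"
    using assms by (subst emeasure_Diff[symmetric]) (auto simp: emeasure_exp_law_greaterThan intro!: arg_cong[where f="emeasure exp_law"])
  also have "\<dots> = ennreal (exp (- a) - exp (- b))"
    using assms by (simp add: emeasure_exp_law_greaterThan ennreal_minus)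
  finally show ?thesis using assms by simp
qed

text \<open>Laplace transform of the gap law at 1; it gives \<open>exp (- ringing s n)\<close> the
  mean \<open>(1/2) ^ Suc n\<close>.\<close>

lemma nn_integral_exp_law_exp: "(\<integral>\<^sup>+e. ennreal (exp (- e)) \<partial>exp_law) = ennreal (1/2)"
proof -
  have "(\<integral>\<^sup>+e. ennreal (exp (- e)) \<partial>exp_law) = (\<integral>\<^sup>+e. ennreal (exponential_density 1 e) * ennreal (exp (- e)) \<partial>lborel)"
    unfolding exp_law_def by (subst nn_integral_density) auto
  also have "\<dots> = (\<integral>\<^sup>+e. ennreal (1/2) * ennreal (exponential_density 2 e) \<partial>lborel)"
    by (intro nn_integral_cong, subst (1 2) ennreal_mult[symmetric]) (auto simp: exponential_density_def mult_exp_exp mult.commute)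
  also have "\<dots> = ennreal (1/2) * (\<integral>\<^sup>+e. ennreal (exponential_density 2 e) \<partial>lborel)"
    by (rule nn_integral_cmult) auto
  also have "(\<integral>\<^sup>+e. ennreal (exponential_density 2 e) \<partial>lborel) = 1"
    using prob_space.emeasure_space_1[OF prob_space_exponential_density[of 2]]
    by (simp add: emeasure_density)
  finally show ?thesis by simp
qed

section \<open>Clocks seen from a later time\<close>

definition ringing :: "(nat \<Rightarrow> real \<times> 'b) \<Rightarrow> nat \<Rightarrow> real" where
  "ringing s n = (\<Sum>k\<le>n. fst (s k))"

text \<open>The clock seen from a time \<open>t\<close> between ring \<open>n\<close> and its
  predecessor: past marks are dropped, and ring \<open>n\<close> keeps its label but only its
  residual waiting time.\<close>

definition advance :: "nat \<Rightarrow> real \<Rightarrow> (nat \<Rightarrow> real \<times> 'b) \<Rightarrow> nat \<Rightarrow> real \<times> 'b" where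
  "advance n t s = case_nat (ringing s n - t, snd (s n)) (\<lambda>i. s (n + Suc i))"

definition after_time :: "real \<Rightarrow> (nat \<Rightarrow> real \<times> 'b) \<Rightarrow> nat \<Rightarrow> real \<times> 'b" where
  "after_time t s = advance (LEAST n. t < ringing s n) t s"

lemma ringing_0 [simp]: "ringing s 0 = fst (s 0)"
  by (simp add: ringing_def)

lemma ringing_Suc: "ringing s (Suc n) = ringing s n + fst (s (Suc n))"
  by (simp add: ringing_def)

lemma ringing_case_nat: "ringing (case_nat x s) (Suc n) = fst x + ringing s n"
  unfolding ringing_def by (subst sum.atMost_Suc_shift) simp

lemma ringing_advance: "ringing (advance n t s) i = ringing s (n + i) - t"
  by (induction i) (auto simp: ringing_Suc advance_def)

lemma snd_advance: "snd (advance n t s i) = snd (s (n + i))"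
  by (cases i) (auto simp: advance_def)

lemma advance_Suc_case_nat: "advance (Suc n) t (case_nat x s) = advance n (t - fst x) s"
  by (auto simp: advance_def ringing_case_nat fun_eq_iff split: nat.splits)

text \<open>For reading an event about the shifted clock in original time: \<open>c\<close> marks
  have been used up, all of them rung by time \<open>t\<close>, and the remaining ring times are
  lowered by \<open>t\<close>.\<close>

lemma after_time_funpow:
  "\<exists>c. (\<forall>i. ringing ((after_time 1 ^^ t) s) i = ringing s (c + i) - real t \<and>
            snd ((after_time 1 ^^ t) s i) = snd (s (c + i))) \<and> (\<forall>n<c. ringing s n \<le> real t)"
proof (induction t)
  case 0
  show ?case by (intro exI[of _ 0]) simp
next
  case (Suc t)
  let ?s = "(after_time 1 ^^ t) s"
  from Suc obtain c where c: "\<And>i. ringing ?s i = ringing s (c + i) - real t"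
    "\<And>i. snd (?s i) = snd (s (c + i))" "\<And>n. n < c \<Longrightarrow> ringing s n \<le> real t" by blast
  define d where "d = (LEAST n. 1 < ringing ?s n)"
  have T: "(after_time 1 ^^ Suc t) s = advance d 1 ?s"
    by (simp add: after_time_def d_def)
  have "ringing s n \<le> real (Suc t)" if "n < c + d" for n
  proof (cases "n < c")
    case True then show ?thesis using c(3)[of n] by simp
  next
    case False
    then have "n - c < d" using that by simp
    then have "\<not> 1 < ringing ?s (n - c)" unfolding d_def by (rule not_less_Least)
    then show ?thesis using c(1)[of "n - c"] False by simp
  qed
  then show ?case unfolding T
    by (intro exI[of _ "c + d"]) (auto simp: ringing_advance snd_advance c add.assoc)
qed

text \<open>For \<open>b \<le> 1\<close> this is decided by the clock on the unit interval alone,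
  since the second ring comes after time 1; hence its independence of
  \<open>after_time 1 s\<close>.\<close>

definition rings_once :: "real \<Rightarrow> real \<Rightarrow> 'b set \<Rightarrow> (nat \<Rightarrow> real \<times> 'b) \<Rightarrow> bool" where
  "rings_once a b B s \<longleftrightarrow> a < ringing s 0 \<and> ringing s 0 \<le> b \<and> snd (s 0) \<in> B \<and> 1 < ringing s 1"

locale renewal = K: prob_space K for K :: "'b measure" +
  assumes space_K [simp]: "space K = UNIV"
begin

abbreviation "E \<equiv> exp_law \<Otimes>\<^sub>M K"

sublocale E: pair_prob_space exp_law K
  using prob_space_exp_law K.prob_space_axioms by (simp add: pair_prob_space_def pair_sigma_finite_def prob_space_imp_sigma_finite)

sublocale seq: sequence_space E
  by unfold_locales

abbreviation "S \<equiv> seq.S"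

lemma space_E [simp]: "space E = UNIV"
  by (simp add: space_pair_measure)

lemma space_S [simp]: "space S = UNIV"
  by (simp add: space_PiM space_pair_measure)

lemma measurable_ringing [measurable]: "(\<lambda>s. ringing s n) \<in> borel_measurable S"
  unfolding ringing_def by measurable

lemma measurable_case_nat_pair: "(\<lambda>(x, s). case_nat x s) \<in> E \<Otimes>\<^sub>M S \<rightarrow>\<^sub>M S"
  by (rule measurable_PiM_single') (auto simp: split_beta' split: nat.split)

lemma nn_integral_S:
  assumes [measurable]: "f \<in> borel_measurable S"
  shows "(\<integral>\<^sup>+s. f s \<partial>S) = (\<integral>\<^sup>+e. \<integral>\<^sup>+k. \<integral>\<^sup>+s. f (case_nat (e, k) s) \<partial>S \<partial>K \<partial>exp_law)"
proof -
  note [measurable] = measurable_case_nat_pair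
  have "(\<integral>\<^sup>+s. f s \<partial>S) = (\<integral>\<^sup>+s. f s \<partial>distr (E \<Otimes>\<^sub>M S) S (\<lambda>(x, s). case_nat x s))"
    by (simp add: seq.PiM_iter)
  also have "\<dots> = (\<integral>\<^sup>+(x, s). f (case_nat x s) \<partial>(E \<Otimes>\<^sub>M S))"
    by (subst nn_integral_distr) (auto simp: split_beta')
  also have "\<dots> = (\<integral>\<^sup>+x. \<integral>\<^sup>+s. f (case_nat x s) \<partial>S \<partial>E)"
    by (subst seq.nn_integral_fst[symmetric]) (auto simp: split_beta')
  also have "\<dots> = (\<integral>\<^sup>+e. \<integral>\<^sup>+k. \<integral>\<^sup>+s. f (case_nat (e, k) s) \<partial>S \<partial>K \<partial>exp_law)"
    by (subst K.nn_integral_fst[symmetric]) (auto simp: split_beta')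
  finally show ?thesis .
qed

lemma measurable_advance [measurable]:
  "(\<lambda>(t, s). advance n t s) \<in> borel \<Otimes>\<^sub>M S \<rightarrow>\<^sub>M S"
  unfolding advance_def by (rule measurable_PiM_single') (auto simp: split_beta' split: nat.split)

lemma measurable_after_time [measurable]: "after_time t \<in> S \<rightarrow>\<^sub>M S"
  unfolding after_time_def[abs_def]
  by (rule measurable_compose_countable[of "\<lambda>n s. advance n t s"]) measurable

text \<open>Splits the event \<open>after_time t s \<in> A\<close> by the number of rings up to
  \<open>t\<close>.\<close>

definition in_gap :: "nat \<Rightarrow> real \<Rightarrow> (nat \<Rightarrow> real \<times> 'b) set \<Rightarrow> (nat \<Rightarrow> real \<times> 'b) \<Rightarrow> bool" where
  "in_gap n t A s \<longleftrightarrow> (\<forall>k<n. ringing s k \<le> t) \<and> t < ringing s n \<and> advance n t s \<in> A"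

lemma measurable_in_gap [measurable]:
  assumes [measurable]: "A \<in> sets S"
  shows "Measurable.pred (borel \<Otimes>\<^sub>M S) (\<lambda>(t, s). in_gap n t A s)" "Measurable.pred S (in_gap n t A)"
proof -
  have [measurable]: "Measurable.pred S (\<lambda>s. s \<in> A)" by simp
  show "Measurable.pred (borel \<Otimes>\<^sub>M S) (\<lambda>(t, s). in_gap n t A s)"
    unfolding in_gap_def[abs_def] split_beta' by measurable
  show "Measurable.pred S (in_gap n t A)"
    unfolding in_gap_def[abs_def] by measurable
qed

lemma in_gap_Suc_case_nat:
  "in_gap (Suc n) t A (case_nat x s) \<longleftrightarrow> fst x \<le> t \<and> in_gap n (t - fst x) A s"
  unfolding in_gap_def by (auto simp: All_less_Suc2 ringing_case_nat advance_Suc_case_nat)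

lemma measurable_nn_integral_case_nat:
  assumes [measurable]: "f \<in> borel_measurable S"
  shows "(\<lambda>e. \<integral>\<^sup>+k. \<integral>\<^sup>+s. f (case_nat (e, k) s) \<partial>S \<partial>K) \<in> borel_measurable borel"
proof -
  have [measurable]: "(\<lambda>((e, k), s). case_nat (e, k) s) \<in> (borel \<Otimes>\<^sub>M K) \<Otimes>\<^sub>M S \<rightarrow>\<^sub>M S"
    by (rule measurable_PiM_single') (auto simp: split_beta' split: nat.split)
  have "(\<lambda>(e, k). \<integral>\<^sup>+s. f (case_nat (e, k) s) \<partial>S) \<in> borel_measurable (borel \<Otimes>\<^sub>M K)"
    unfolding split_beta' by (intro seq.borel_measurable_nn_integral) (auto simp: split_beta')
  then show ?thesis by (intro K.borel_measurable_nn_integral) (auto simp: split_beta')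
qed

lemma emeasure_in_gap_eq:
  assumes "A \<in> sets S"
  shows "emeasure S {s. in_gap n t A s} = (\<integral>\<^sup>+s. indicator {s. in_gap n t A s} s \<partial>S)"
  using measurable_in_gap(2)[OF assms, of n t] by (simp add: pred_def)

lemma emeasure_in_gap_0:
  assumes A[measurable]: "A \<in> sets S" and t: "0 \<le> t"
  shows "emeasure S {s. in_gap 0 t A s} = exp (- t) * emeasure S A"
proof -
  have m: "indicator {s. in_gap 0 t A s} \<in> borel_measurable S"
    using measurable_in_gap(2)[OF A, of 0 t] by (auto simp: pred_def)
  let ?g = "\<lambda>e. \<integral>\<^sup>+k. \<integral>\<^sup>+s. indicator A (case_nat (e, k) s) \<partial>S \<partial>K"
  have g: "?g \<in> borel_measurable borel" by (rule measurable_nn_integral_case_nat) simp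
  have "emeasure S {s. in_gap 0 t A s} = (\<integral>\<^sup>+e. \<integral>\<^sup>+k. \<integral>\<^sup>+s. indicator {s. in_gap 0 t A s} (case_nat (e, k) s) \<partial>S \<partial>K \<partial>exp_law)"
    unfolding emeasure_in_gap_eq[OF A] by (rule nn_integral_S[OF m])
  also have "\<dots> = (\<integral>\<^sup>+e. ?g (e - t) * indicator {t<..} e \<partial>exp_law)"
    by (intro nn_integral_cong) (auto simp: in_gap_def advance_def indicator_def)
  also have "\<dots> = exp (- t) * (\<integral>\<^sup>+e. ?g e \<partial>exp_law)"
    by (rule nn_integral_exp_law_shift[OF g t])
  also have "(\<integral>\<^sup>+e. ?g e \<partial>exp_law) = emeasure S A"
    by (subst nn_integral_S[symmetric]) auto
  finally show ?thesis .
qed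

text \<open>The residual clock is independent of the number of rings before \<open>t\<close>.
  Conditioning on the first gap \<open>e\<close> leaves the same event with one ring less at time
  \<open>t - e\<close>, until memorylessness settles the case of no ring.\<close>

lemma emeasure_in_gap:
  assumes A[measurable]: "A \<in> sets S"
  shows "0 \<le> t \<Longrightarrow> emeasure S {s. in_gap n t A s} = emeasure S {s. in_gap n t UNIV s} * emeasure S A"
proof (induction n arbitrary: t)
  case 0
  then show ?case
    using emeasure_in_gap_0[OF A] emeasure_in_gap_0[of UNIV] seq.P.emeasure_space_1 sets.top[of S] by simp
next
  case (Suc n)
  have *: "emeasure S {s. in_gap (Suc n) t B s} = (\<integral>\<^sup>+e. emeasure S {s. in_gap n (t - e) B s} * indicator {..t} e \<partial>exp_law)"
    if B: "B \<in> sets S" for B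
  proof -
    have m: "indicator {s. in_gap (Suc n) t B s} \<in> borel_measurable S"
      using measurable_in_gap(2)[OF B, of "Suc n" t] by (auto simp: pred_def)
    have "emeasure S {s. in_gap (Suc n) t B s} = (\<integral>\<^sup>+e. \<integral>\<^sup>+k. \<integral>\<^sup>+s. indicator {s. in_gap (Suc n) t B s} (case_nat (e, k) s) \<partial>S \<partial>K \<partial>exp_law)"
      unfolding emeasure_in_gap_eq[OF B] by (rule nn_integral_S[OF m])
    also have "\<dots> = (\<integral>\<^sup>+e. \<integral>\<^sup>+k. \<integral>\<^sup>+s. indicator {s. in_gap n (t - e) B s} s * indicator {..t} e \<partial>S \<partial>K \<partial>exp_law)"
      by (intro nn_integral_cong) (auto simp: in_gap_Suc_case_nat indicator_def)
    also have "\<dots> = (\<integral>\<^sup>+e. emeasure S {s. in_gap n (t - e) B s} * indicator {..t} e \<partial>exp_law)"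
    proof (intro nn_integral_cong)
      fix e :: real
      have "(\<integral>\<^sup>+s. indicator {s. in_gap n (t - e) B s} s * indicator {..t} e \<partial>S) = emeasure S {s. in_gap n (t - e) B s} * indicator {..t} e"
        using measurable_in_gap(2)[OF B, of n "t - e"] by (subst nn_integral_multc) (auto simp: pred_def)
      then show "(\<integral>\<^sup>+k. \<integral>\<^sup>+s. indicator {s. in_gap n (t - e) B s} s * indicator {..t} e \<partial>S \<partial>K) = emeasure S {s. in_gap n (t - e) B s} * indicator {..t} e"
        using K.emeasure_space_1 by simp
    qed
    finally show ?thesis .
  qed
  have U: "UNIV \<in> sets S" using sets.top[of S] by simp
  have "emeasure S {s. in_gap (Suc n) t A s} = (\<integral>\<^sup>+e. emeasure S {s. in_gap n (t - e) UNIV s} * indicator {..t} e * emeasure S A \<partial>exp_law)"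
    unfolding *[OF A] by (intro nn_integral_cong) (auto simp: indicator_def Suc.IH)
  also have "\<dots> = emeasure S {s. in_gap (Suc n) t UNIV s} * emeasure S A"
  proof -
    have "(\<lambda>e. emeasure S (Pair e -` {(e, s). in_gap n (t - e) UNIV s})) \<in> borel_measurable borel"
    proof (rule seq.measurable_emeasure_Pair)
      have "Measurable.pred (borel \<Otimes>\<^sub>M S) (\<lambda>(e, s). in_gap n (t - e) UNIV s)"
        using measurable_compose[OF _ measurable_in_gap(1)[OF U, of n], of "\<lambda>(e,s). (t - e, s)" "borel \<Otimes>\<^sub>M S"]
        by (simp add: split_beta')
      then show "{(e, s). in_gap n (t - e) UNIV s} \<in> sets (borel \<Otimes>\<^sub>M S)"
        by (simp add: pred_def space_pair_measure split_beta')
    qed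
    then have "(\<lambda>e. emeasure S {s. in_gap n (t - e) UNIV s}) \<in> borel_measurable borel"
      by (simp add: vimage_def)
    then show ?thesis
      unfolding *[OF U] by (intro nn_integral_multc) auto
  qed
  finally show ?case .
qed

text \<open>The means of \<open>exp (- ringing s n)\<close> are summable, so these terms tend to 0
  almost surely.\<close>

lemma AE_ringing_at_top: "AE s in S. filterlim (ringing s) at_top sequentially"
proof -
  have *: "(\<integral>\<^sup>+s. ennreal (exp (- ringing s n)) \<partial>S) = ennreal ((1/2) ^ Suc n)" for n
  proof (induction n)
    case 0
    have "(\<integral>\<^sup>+s. ennreal (exp (- ringing s 0)) \<partial>S) = (\<integral>\<^sup>+e. \<integral>\<^sup>+k. \<integral>\<^sup>+s. ennreal (exp (- e)) \<partial>S \<partial>K \<partial>exp_law)"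
      by (subst nn_integral_S) auto
    then show ?case
      using K.emeasure_space_1 seq.P.emeasure_space_1 nn_integral_exp_law_exp by simp
  next
    case (Suc n)
    have "(\<integral>\<^sup>+s. ennreal (exp (- ringing s (Suc n))) \<partial>S)
        = (\<integral>\<^sup>+e. \<integral>\<^sup>+k. \<integral>\<^sup>+s. ennreal (exp (- e)) * ennreal (exp (- ringing s n)) \<partial>S \<partial>K \<partial>exp_law)"
      by (subst nn_integral_S) (auto simp: ringing_case_nat ennreal_mult[symmetric] mult_exp_exp intro!: nn_integral_cong)
    also have "\<dots> = (\<integral>\<^sup>+e. ennreal (exp (- e)) * ennreal ((1/2) ^ Suc n) \<partial>exp_law)"
      using K.emeasure_space_1 Suc by (simp add: nn_integral_cmult)
    also have "\<dots> = ennreal ((1/2) ^ Suc (Suc n))"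
      by (subst nn_integral_multc, simp, subst nn_integral_exp_law_exp, subst ennreal_mult[symmetric]) auto
    finally show ?case .
  qed
  have "(\<integral>\<^sup>+s. (\<Sum>n. ennreal (exp (- ringing s n))) \<partial>S) = (\<Sum>n. ennreal ((1/2) ^ Suc n))"
    by (subst nn_integral_suminf) (auto simp: *)
  also have "\<dots> = ennreal (\<Sum>n. (1/2) ^ Suc n)"
    by (intro suminf_ennreal2) (auto intro!: summable_mult summable_geometric)
  finally have "(\<integral>\<^sup>+s. (\<Sum>n. ennreal (exp (- ringing s n))) \<partial>S) \<noteq> \<infinity>" by simp
  then have "AE s in S. (\<Sum>n. ennreal (exp (- ringing s n))) \<noteq> \<infinity>"
    by (intro nn_integral_noteq_infinite) auto
  then show ?thesis
  proof eventually_elim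
    case (elim s)
    then have "summable (\<lambda>n. exp (- ringing s n))"
      by (intro summable_suminf_not_top) auto
    then have "(\<lambda>n. exp (- ringing s n)) \<longlonglongrightarrow> 0" by (rule summable_LIMSEQ_zero)
    then have "\<forall>\<^sub>F n in sequentially. exp (- ringing s n) < exp (- Z)" for Z
      by (rule order_tendstoD) simp
    then show ?case by (simp add: filterlim_at_top_dense)
  qed
qed

text \<open>Summing \<open>emeasure_in_gap\<close> over the number of rings up to \<open>t\<close>
  gives \<open>emeasure S A\<close> times a total mass of 1.\<close>

lemma distr_after_time:
  assumes t: "0 \<le> t" shows "distr S S (after_time t) = S"
proof (rule measure_eqI)
  have ex: "AE s in S. \<exists>n. t < ringing s n"
    using AE_ringing_at_top
  proof eventually_elim
    case (elim s)
    then have "\<forall>\<^sub>F n in sequentially. t < ringing s n" by (simp add: filterlim_at_top_dense)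
    then show ?case by (intro eventually_happens'[of sequentially]) simp_all
  qed
  have sum: "emeasure S (after_time t -` A) = (\<Sum>n. emeasure S {s. in_gap n t A s})" if A[measurable]: "A \<in> sets S" for A
  proof -
    have B: "{s. in_gap n t A s} \<in> sets S" for n
      using measurable_in_gap(2)[OF A, of n t] by (simp add: pred_def)
    have L: "(LEAST n. t < ringing s n) = n" if "\<forall>k<n. ringing s k \<le> t" "t < ringing s n" for s :: "nat \<Rightarrow> real \<times> 'b" and n
    proof (rule Least_equality)
      fix y assume "t < ringing s y"
      then show "n \<le> y" using that(1) by (metis leD leI)
    qed fact
    have dj: "disjoint_family (\<lambda>n. {s. in_gap n t A s})"
      unfolding disjoint_family_on_def in_gap_def
    proof safe
      fix m n and s :: "nat \<Rightarrow> real \<times> 'b" assume "m \<noteq> n" "\<forall>k<m. ringing s k \<le> t" "t < ringing s m" "\<forall>k<n. ringing s k \<le> t" "t < ringing s n"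
      then show "s \<in> {}" using L[of m s] L[of n s] by simp
    qed
    have "emeasure S (after_time t -` A) = emeasure S (\<Union>n. {s. in_gap n t A s})"
    proof (rule emeasure_eq_AE)
      show "AE s in S. (s \<in> after_time t -` A) = (s \<in> (\<Union>n. {s. in_gap n t A s}))"
        using ex
      proof eventually_elim
        case (elim s)
        then obtain n where n: "\<forall>k<n. ringing s k \<le> t" "t < ringing s n"
          using exists_least_iff[of "\<lambda>n. t < ringing s n"] by (auto simp: not_less)
        have "in_gap m t A s \<Longrightarrow> m = n" for m
          using L[of m s] L[OF n] by (auto simp: in_gap_def)
        moreover have "in_gap n t A s \<longleftrightarrow> s \<in> after_time t -` A"
          using n L[OF n] by (auto simp: in_gap_def after_time_def)
        ultimately show ?case by auto
      qed
      show "after_time t -` A \<in> sets S" using measurable_sets[OF measurable_after_time A] by simp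
    qed (use B in auto)
    also have "\<dots> = (\<Sum>n. emeasure S {s. in_gap n t A s})"
      using B dj by (intro suminf_emeasure[symmetric]) auto
    finally show ?thesis .
  qed
  have U: "UNIV \<in> sets S" using sets.top[of S] by simp
  have "(\<Sum>n. emeasure S {s. in_gap n t UNIV s}) = 1"
    using sum[OF U] seq.P.emeasure_space_1 by simp
  moreover fix A assume "A \<in> sets (distr S S (after_time t))"
  then have A[measurable]: "A \<in> sets S" by simp
  have "emeasure (distr S S (after_time t)) A = (\<Sum>n. emeasure S {s. in_gap n t UNIV s} * emeasure S A)"
    using sum[OF A] emeasure_in_gap[OF A t] by (subst emeasure_distr) auto
  ultimately show "emeasure (distr S S (after_time t)) A = emeasure S A"
    by simp
qed simp

lemma measurable_rings_once [measurable]: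
  assumes [measurable]: "B \<in> sets K" shows "Measurable.pred S (rings_once a b B)"
  unfolding rings_once_def[abs_def] by measurable

text \<open>Integrate over the first ring \<open>e\<close>: the clock must then be silent for a
  further time \<open>1 - e\<close>, and by memorylessness what follows is fresh.\<close>

lemma rings_once_indep:
  assumes B[measurable]: "B \<in> sets K" and ab: "0 \<le> a" "a < b" "b \<le> 1" and BK: "K.prob B > 0"
  shows "seq.prob {s. rings_once a b B s} > 0"
    and "A \<in> sets S \<Longrightarrow> seq.prob {s. rings_once a b B s \<and> after_time 1 s \<in> A} = seq.prob {s. rings_once a b B s} * seq.prob A"
proof -
  \<comment> \<open>\<open>exp (- (1 - e))\<close> is the probability of no second ring up to time 1
    when the first ring is at \<open>e\<close>.\<close>
  define c where "c = (\<integral>\<^sup>+e. ennreal (exp (- (1 - e))) * indicator {a<..b} e * emeasure K B \<partial>exp_law)"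
  have *: "emeasure S {s. rings_once a b B s \<and> after_time 1 s \<in> A} = c * emeasure S A" if A[measurable]: "A \<in> sets S" for A
  proof -
    have At: "{s. after_time 1 s \<in> A} \<in> sets S" using measurable_sets[OF measurable_after_time A] by (simp add: vimage_def)
    have Bs: "{s. rings_once a b B s} \<in> sets S" using measurable_rings_once[OF B] by (simp add: pred_def)
    have s: "{s. rings_once a b B s \<and> after_time 1 s \<in> A} \<in> sets S"
      using sets.Int[OF Bs At] by (simp add: Int_def)
    have eq: "rings_once a b B (case_nat (e, k) s) \<and> after_time 1 (case_nat (e, k) s) \<in> A \<longleftrightarrow>
        e \<in> {a<..b} \<and> k \<in> B \<and> in_gap 0 (1 - e) A s" for e k s
    proof -
      have "after_time 1 (case_nat (e, k) s) = advance 0 (1 - e) s" if "e \<le> 1" "1 < e + ringing s 0"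
      proof -
        have "(LEAST n. 1 < ringing (case_nat (e, k) s) n) = 1"
        proof (rule Least_equality)
          show "1 < ringing (case_nat (e, k) s) 1" using that by (simp add: ringing_case_nat[of _ _ 0, simplified])
          show "1 \<le> y" if "1 < ringing (case_nat (e, k) s) y" for y
            using that \<open>e \<le> 1\<close> by (cases y) auto
        qed
        then show ?thesis by (simp add: after_time_def advance_Suc_case_nat[of 0, simplified])
      qed
      then show ?thesis
        using ab by (auto simp: rings_once_def in_gap_def ringing_case_nat[of _ _ 0, simplified])
    qed
    have "emeasure S {s. rings_once a b B s \<and> after_time 1 s \<in> A} = (\<integral>\<^sup>+s. indicator {s. rings_once a b B s \<and> after_time 1 s \<in> A} s \<partial>S)"
      using s by simp
    also have "\<dots> = (\<integral>\<^sup>+e. \<integral>\<^sup>+k. \<integral>\<^sup>+s. indicator {s. rings_once a b B s \<and> after_time 1 s \<in> A} (case_nat (e, k) s) \<partial>S \<partial>K \<partial>exp_law)"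
      using s by (intro nn_integral_S) simp
    also have "\<dots> = (\<integral>\<^sup>+e. \<integral>\<^sup>+k. \<integral>\<^sup>+s. indicator {s. in_gap 0 (1 - e) A s} s * (indicator B k * indicator {a<..b} e) \<partial>S \<partial>K \<partial>exp_law)"
      by (intro nn_integral_cong) (auto simp add: indicator_def eq simp del: greaterThanAtMost_iff)
    also have "\<dots> = (\<integral>\<^sup>+e. emeasure S {s. in_gap 0 (1 - e) A s} * indicator {a<..b} e * emeasure K B \<partial>exp_law)"
    proof (intro nn_integral_cong)
      fix e :: real
      have "(\<integral>\<^sup>+s. indicator {s. in_gap 0 (1 - e) A s} s * (indicator B k * indicator {a<..b} e) \<partial>S)
          = emeasure S {s. in_gap 0 (1 - e) A s} * indicator {a<..b} e * indicator B k" for k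
        using measurable_in_gap(2)[OF A, of 0 "1 - e"] by (subst nn_integral_multc) (auto simp: pred_def ac_simps)
      then show "(\<integral>\<^sup>+k. \<integral>\<^sup>+s. indicator {s. in_gap 0 (1 - e) A s} s * (indicator B k * indicator {a<..b} e) \<partial>S \<partial>K)
          = emeasure S {s. in_gap 0 (1 - e) A s} * indicator {a<..b} e * emeasure K B"
        by (simp add: nn_integral_cmult_indicator)
    qed
    also have "\<dots> = (\<integral>\<^sup>+e. ennreal (exp (- (1 - e))) * indicator {a<..b} e * emeasure K B * emeasure S A \<partial>exp_law)"
      using ab by (intro nn_integral_cong) (auto simp: emeasure_in_gap_0[OF A] indicator_def ac_simps)
    also have "\<dots> = c * emeasure S A"
      unfolding c_def by (subst nn_integral_multc) auto
    finally show ?thesis .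
  qed
  have U: "UNIV \<in> sets S" using sets.top[of S] by simp
  have c: "emeasure S {s. rings_once a b B s} = c"
    using *[OF U] seq.P.emeasure_space_1 by simp
  have "0 < ennreal (exp (- 1)) * emeasure exp_law {a<..b} * emeasure K B"
    using emeasure_exp_law_Ioc_pos[OF ab(1,2)] BK by (simp add: ennreal_zero_less_mult_iff K.emeasure_eq_measure)
  also have "\<dots> = (\<integral>\<^sup>+e. ennreal (exp (- 1)) * indicator {a<..b} e * emeasure K B \<partial>exp_law)"
    by (subst nn_integral_multc) (auto simp: nn_integral_cmult_indicator)
  also have "\<dots> \<le> c"
    unfolding c_def
  proof (intro nn_integral_mono)
    fix e :: real
    have "exp (- 1) \<le> exp (- (1 - e))" if "e \<in> {a<..b}" using that ab by simp
    then show "ennreal (exp (- 1)) * indicator {a<..b} e * emeasure K B \<le> ennreal (exp (- (1 - e))) * indicator {a<..b} e * emeasure K B"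
      by (cases "e \<in> {a<..b}") (auto intro!: mult_right_mono ennreal_leI simp del: exp_le_cancel_iff)
  qed
  finally have "0 < ennreal (seq.prob {s. rings_once a b B s})"
    unfolding c[symmetric] by (simp only: seq.P.emeasure_eq_measure)
  then show "seq.prob {s. rings_once a b B s} > 0"
    by simp
  assume A: "A \<in> sets S"
  have "ennreal (seq.prob {s. rings_once a b B s \<and> after_time 1 s \<in> A}) = ennreal (seq.prob {s. rings_once a b B s} * seq.prob A)"
    using *[OF A] c by (simp add: seq.P.emeasure_eq_measure ennreal_mult)
  then show "seq.prob {s. rings_once a b B s \<and> after_time 1 s \<in> A} = seq.prob {s. rings_once a b B s} * seq.prob A"
    by simp
qed

end

section \<open>Discretised dynamics\<close>

definition disagree :: "nat \<Rightarrow> nat set \<Rightarrow> nat set \<Rightarrow> nat set" where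
  "disagree F u v = {i. i < F \<and> (i \<in> u) \<noteq> (i \<in> v)}"

text \<open>Addition modulo 2 of opinions: adding a fixed \<open>v\<close> flips the issues in
  \<open>v\<close>.\<close>

definition symdiff :: "nat set \<Rightarrow> nat set \<Rightarrow> nat set" where
  "symdiff u v = (u - v) \<union> (v - u)"

lemma in_symdiff [simp]: "i \<in> symdiff u v \<longleftrightarrow> (i \<in> u) \<noteq> (i \<in> v)"
  by (auto simp: symdiff_def)

lemma symdiff_symdiff [simp]: "symdiff (symdiff u v) v = u"
  by (auto simp: symdiff_def)

lemma finite_disagree [simp]: "finite (disagree F u v)"
  by (simp add: disagree_def)

lemma disagree_subset: "disagree F u v \<subseteq> {..<F}"
  by (auto simp: disagree_def)

lemma hamming_eq: "hamming F u v = card (disagree F u v)"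
  by (simp add: hamming_def disagree_def)

lemma hamming_commute: "hamming F u v = hamming F v u"
  unfolding hamming_def by (rule arg_cong[where f=card]) auto

lemma hamming_self [simp]: "hamming F u u = 0"
  by (simp add: hamming_def)

lemma hamming_le: "hamming F u v \<le> F"
  unfolding hamming_eq using card_mono[OF _ disagree_subset[of F u v]] by simp

lemma disagree_symdiff: "disagree F (symdiff u w) (symdiff v w) = disagree F u v"
  by (auto simp: disagree_def)

lemma hamming_symdiff: "hamming F (symdiff u w) (symdiff v w) = hamming F u v"
  by (simp add: hamming_eq disagree_symdiff)

lemma disagree_flip:
  assumes "i < F"
  shows "disagree F (symdiff u {i}) v = (if i \<in> disagree F u v then disagree F u v - {i} else insert i (disagree F u v))"
  using assms by (auto simp: disagree_def)

lemma hamming_flip: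
  assumes "i < F"
  shows "i \<in> disagree F u v \<Longrightarrow> hamming F (symdiff u {i}) v + 1 = hamming F u v"
    and "i \<notin> disagree F u v \<Longrightarrow> hamming F (symdiff u {i}) v = hamming F u v + 1"
  using assms card_Suc_Diff1[of "disagree F u v" i] by (simp_all add: hamming_eq disagree_flip)

definition chosen :: "(nat \<Rightarrow> nat) \<Rightarrow> nat set \<Rightarrow> nat" where
  "chosen p S = (THE i. i \<in> S \<and> (\<forall>j\<in>S. p i \<le> p j))"

lemma chosen_in:
  assumes "inj_on p S" "finite S" "S \<noteq> {}" shows "chosen p S \<in> S"
proof -
  obtain i where i: "i \<in> S" "\<forall>j\<in>S. p i \<le> p j"
    using ex_min_if_finite[of "p ` S"] assms by (auto simp: not_less)
  have "chosen p S = i"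
    unfolding chosen_def
  proof (rule the_equality)
    fix j assume "j \<in> S \<and> (\<forall>l\<in>S. p j \<le> p l)"
    then show "j = i" using i assms(1) by (metis inj_onD le_antisym)
  qed (use i in blast)
  then show ?thesis using i by simp
qed

lemma deffuant_step_eq:
  "deffuant_step F \<theta> p u v =
    (if 1 \<le> hamming F u v \<and> hamming F u v \<le> \<theta> then
      (if chosen p (disagree F u v) \<in> v then insert (chosen p (disagree F u v)) u else u - {chosen p (disagree F u v)}) else u)"
  by (simp add: deffuant_step_def chosen_def disagree_def Let_def)

lemma deffuant_step_flip:
  assumes "p permutes {..<F}" "1 \<le> hamming F u v" "hamming F u v \<le> \<theta>"
  shows "chosen p (disagree F u v) \<in> disagree F u v"
    and "deffuant_step F \<theta> p u v = symdiff u {chosen p (disagree F u v)}"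
proof -
  have "inj_on p (disagree F u v)"
    using permutes_inj[OF assms(1)] by (rule inj_on_subset) simp
  then show *: "chosen p (disagree F u v) \<in> disagree F u v"
    using assms(2) by (intro chosen_in) (auto simp: hamming_eq)
  show "deffuant_step F \<theta> p u v = symdiff u {chosen p (disagree F u v)}"
    using * assms by (auto simp: deffuant_step_eq disagree_def)
qed

lemma deffuant_step_idle:
  "\<not> (1 \<le> hamming F u v \<and> hamming F u v \<le> \<theta>) \<Longrightarrow> deffuant_step F \<theta> p u v = u"
  unfolding deffuant_step_def by (rule if_not_P)

text \<open>The rule uses the two opinions only through their disagreement set, which a common flip
  \<open>w\<close> leaves unchanged.\<close>

lemma deffuant_step_symdiff:
  "deffuant_step F \<theta> p (symdiff u w) (symdiff v w) \<inter> {..<F} = symdiff (deffuant_step F \<theta> p u v) w \<inter> {..<F}" if "p permutes {..<F}"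
proof (cases "1 \<le> hamming F u v \<and> hamming F u v \<le> \<theta>")
  case True
  then have "deffuant_step F \<theta> p (symdiff u w) (symdiff v w) = symdiff (symdiff u w) {chosen p (disagree F u v)}"
    using deffuant_step_flip(2)[of p F "symdiff u w" "symdiff v w" \<theta>] that by (simp add: hamming_symdiff disagree_symdiff)
  also have "\<dots> = symdiff (deffuant_step F \<theta> p u v) w"
    using deffuant_step_flip(2)[of p F u v \<theta>] that True by auto
  finally show ?thesis by simp
next
  case False
  then show ?thesis by (simp add: deffuant_step_idle hamming_symdiff)
qed

section \<open>Rings sorted into time steps\<close>

definition rung :: "nat \<Rightarrow> (int \<Rightarrow> site) \<Rightarrow> nat \<Rightarrow> int \<Rightarrow> nat \<Rightarrow> bool" where
  "rung m \<omega> k x n \<longleftrightarrow> real k / 2 ^ m < arrival \<omega> x n \<and> arrival \<omega> x n \<le> real (Suc k) / 2 ^ m"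

definition rings :: "nat \<Rightarrow> (int \<Rightarrow> site) \<Rightarrow> nat \<Rightarrow> int \<Rightarrow> bool" where
  "rings m \<omega> k x \<longleftrightarrow> (\<exists>n. rung m \<omega> k x n)"

text \<open>If several rings of a site fall into one step, only the first is used; in a bounded
  region of space and time this almost surely stops happening as \<open>m\<close> grows.\<close>

definition ring_index :: "nat \<Rightarrow> (int \<Rightarrow> site) \<Rightarrow> nat \<Rightarrow> int \<Rightarrow> nat" where
  "ring_index m \<omega> k x = (LEAST n. rung m \<omega> k x n)"

text \<open>A quiet site copies itself, which makes its update idle without a case distinction in
  the recursion.\<close>

definition source :: "nat \<Rightarrow> (int \<Rightarrow> site) \<Rightarrow> nat \<Rightarrow> int \<Rightarrow> int" where
  "source m \<omega> k x = (if rings m \<omega> k x then nbr \<omega> x (ring_index m \<omega> k x) else x)"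

lemma source_quiet [simp]: "\<not> rings m \<omega> k x \<Longrightarrow> source m \<omega> k x = x"
  by (simp add: source_def)

lemma rung_ring_index: "rings m \<omega> k x \<Longrightarrow> rung m \<omega> k x (ring_index m \<omega> k x)"
  unfolding rings_def ring_index_def by (rule LeastI_ex)

definition valid_marks :: "nat \<Rightarrow> (int \<Rightarrow> site) \<Rightarrow> bool" where
  "valid_marks F \<omega> \<longleftrightarrow> (\<forall>x n. 0 < fst (mark_of \<omega> x n) \<and> fst (snd (mark_of \<omega> x n)) \<in> {-1, 1} \<and>
     perm_of \<omega> x n permutes {..<F}) \<and> (\<forall>x. init_op \<omega> x \<subseteq> {..<F})"

locale deffuant =
  fixes F \<theta> :: nat
  assumes F_pos: "1 \<le> F" and \<theta>_pos: "1 \<le> \<theta>"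
begin

text \<open>Time is cut into steps of length \<open>2 ^ - m\<close>, and all sites that ring during a step are updated
  simultaneously. This finite-range recursion is measurable and commutes exactly with the symmetries of
  the model; a path of the model agrees with it on any bounded region once \<open>m\<close> is large.\<close>

primrec opin :: "nat \<Rightarrow> (int \<Rightarrow> site) \<Rightarrow> nat \<Rightarrow> int \<Rightarrow> nat set" where
  "opin m \<omega> 0 x = init_op \<omega> x \<inter> {..<F}"
| "opin m \<omega> (Suc k) x = deffuant_step F \<theta> (perm_of \<omega> x (ring_index m \<omega> k x))
     (opin m \<omega> k x) (opin m \<omega> k (source m \<omega> k x)) \<inter> {..<F}"

text \<open>Edges are named by their left end: \<open>e\<close> is the edge between the sites
  \<open>e\<close> and \<open>e + 1\<close>.\<close>

definition gap :: "nat \<Rightarrow> (int \<Rightarrow> site) \<Rightarrow> nat \<Rightarrow> int \<Rightarrow> nat" where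
  "gap m \<omega> k e = hamming F (opin m \<omega> k e) (opin m \<omega> k (e + 1))"

text \<open>One end of the edge copies its outer neighbour, so that a disagreement arrives from the
  adjacent edge. \<open>Q\<close> selects the changes of interest: \<open>collision\<close> or
  \<open>gain\<close>.\<close>

definition receives :: "(nat \<Rightarrow> nat \<Rightarrow> bool) \<Rightarrow> nat \<Rightarrow> (int \<Rightarrow> site) \<Rightarrow> nat \<Rightarrow> int \<Rightarrow> bool" where
  "receives Q m \<omega> k e \<longleftrightarrow> Q (gap m \<omega> k e) (gap m \<omega> (Suc k) e) \<and>
    (opin m \<omega> (Suc k) e \<noteq> opin m \<omega> k e \<and> source m \<omega> k e = e - 1 \<or>
     opin m \<omega> (Suc k) (e + 1) \<noteq> opin m \<omega> k (e + 1) \<and> source m \<omega> k (e + 1) = e + 2)"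

text \<open>Under this condition the simultaneous update amounts to at most one update in the block,
  strictly inside it, so nothing crosses the ends.\<close>

definition isolated :: "nat \<Rightarrow> (int \<Rightarrow> site) \<Rightarrow> int \<Rightarrow> int \<Rightarrow> nat \<Rightarrow> bool" where
  "isolated m \<omega> L R k \<longleftrightarrow> \<not> rings m \<omega> k L \<and> \<not> rings m \<omega> k R \<and>
    (\<forall>x\<in>{L..R}. \<forall>y\<in>{L..R}. rings m \<omega> k x \<longrightarrow> rings m \<omega> k y \<longrightarrow> x = y)"

lemma opin_subset: "opin m \<omega> k x \<subseteq> {..<F}"
  by (cases k) auto

lemma gap_le: "gap m \<omega> k e \<le> F"
  unfolding gap_def by (rule hamming_le)

lemma opin_quiet: "\<not> rings m \<omega> k x \<Longrightarrow> opin m \<omega> (Suc k) x = opin m \<omega> k x"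
  using opin_subset[of m \<omega> k x] by (auto simp: deffuant_step_idle)

lemma source_valid:
  assumes "valid_marks F \<omega>" "rings m \<omega> k x"
  shows "source m \<omega> k x = x + 1 \<or> source m \<omega> k x = x - 1"
  using assms by (auto simp: source_def nbr_def valid_marks_def)

text \<open>A change of opinion at \<open>x\<close> moves one disagreement from the edge \<open>em\<close> towards the copied neighbour
  to the opposite edge \<open>rc\<close>.\<close>

lemma opin_change:
  assumes v: "valid_marks F \<omega>" and ch: "opin m \<omega> (Suc k) x \<noteq> opin m \<omega> k x"
    and l: "opin m \<omega> (Suc k) (x - 1) = opin m \<omega> k (x - 1)" and r: "opin m \<omega> (Suc k) (x + 1) = opin m \<omega> k (x + 1)"
  obtains i em rc where "i < F" "opin m \<omega> (Suc k) x = symdiff (opin m \<omega> k x) {i}"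
    "source m \<omega> k x = x + 1 \<and> em = x \<and> rc = x - 1 \<or> source m \<omega> k x = x - 1 \<and> em = x - 1 \<and> rc = x"
    "1 \<le> gap m \<omega> k em" "gap m \<omega> k em \<le> \<theta>" "gap m \<omega> (Suc k) em + 1 = gap m \<omega> k em"
    "gap m \<omega> (Suc k) rc = gap m \<omega> k rc + 1 \<or> gap m \<omega> (Suc k) rc + 1 = gap m \<omega> k rc"
    "gap m \<omega> (Suc k) rc = gap m \<omega> k rc + 1 \<longleftrightarrow> i \<notin> disagree F (opin m \<omega> k rc) (opin m \<omega> k (rc + 1))"
proof -
  let ?y = "source m \<omega> k x" and ?p = "perm_of \<omega> x (ring_index m \<omega> k x)"
  let ?u = "opin m \<omega> k x" and ?v = "opin m \<omega> k ?y"
  have rg: "rings m \<omega> k x" using ch opin_quiet by blast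
  have p: "?p permutes {..<F}" using v by (simp add: valid_marks_def)
  have H: "1 \<le> hamming F ?u ?v" "hamming F ?u ?v \<le> \<theta>"
    using ch deffuant_step_idle[of F ?u ?v \<theta> ?p] opin_subset[of m \<omega> k x] by (auto simp: Int_absorb2)
  let ?i = "chosen ?p (disagree F ?u ?v)"
  have i: "?i \<in> disagree F ?u ?v" by (rule deffuant_step_flip(1)[OF p H])
  then have iF: "?i < F" using disagree_subset by blast
  have new: "opin m \<omega> (Suc k) x = symdiff ?u {?i}"
    using deffuant_step_flip(2)[OF p H] opin_subset[of m \<omega> k x] iF by auto
  note fl = hamming_flip[OF iF, of ?u]
  have sy: "disagree F a b = disagree F b a" for a b by (auto simp: disagree_def)
  from source_valid[OF v rg] show ?thesis
  proof
    assume y: "?y = x + 1"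
    show ?thesis
    proof (rule that[of ?i x "x - 1"])
      show "gap m \<omega> (Suc k) x + 1 = gap m \<omega> k x"
        using fl(1)[of ?v] i y r new by (simp add: gap_def del: opin.simps)
      show "gap m \<omega> (Suc k) (x - 1) = gap m \<omega> k (x - 1) + 1 \<or> gap m \<omega> (Suc k) (x - 1) + 1 = gap m \<omega> k (x - 1)"
        "gap m \<omega> (Suc k) (x - 1) = gap m \<omega> k (x - 1) + 1 \<longleftrightarrow> ?i \<notin> disagree F (opin m \<omega> k (x - 1)) (opin m \<omega> k (x - 1 + 1))"
        using fl[of "opin m \<omega> k (x - 1)"] l new
        by (auto simp: gap_def hamming_commute[of F "opin m \<omega> _ (x - 1)"] sy[of "opin m \<omega> _ (x - 1)"] simp del: opin.simps)
    qed (use iF new y H in \<open>simp_all add: gap_def del: opin.simps\<close>)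
  next
    assume y: "?y = x - 1"
    show ?thesis
    proof (rule that[of ?i "x - 1" x])
      show "gap m \<omega> (Suc k) (x - 1) + 1 = gap m \<omega> k (x - 1)"
        using fl(1)[of ?v] i y l new by (simp add: gap_def hamming_commute[of F "opin m \<omega> _ (x - 1)"] del: opin.simps)
      show "gap m \<omega> (Suc k) x = gap m \<omega> k x + 1 \<or> gap m \<omega> (Suc k) x + 1 = gap m \<omega> k x"
        "gap m \<omega> (Suc k) x = gap m \<omega> k x + 1 \<longleftrightarrow> ?i \<notin> disagree F (opin m \<omega> k x) (opin m \<omega> k (x + 1))"
        using fl[of "opin m \<omega> k (x + 1)"] r new by (auto simp: gap_def simp del: opin.simps)
    qed (use iF new y H in \<open>simp_all add: gap_def hamming_commute[of F "opin m \<omega> _ (x - 1)"] del: opin.simps\<close>)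
  qed
qed

lemma isolated_cases:
  assumes v: "valid_marks F \<omega>" and iso: "isolated m \<omega> L R k"
  obtains (idle) "\<And>y. y \<in> {L..R} \<Longrightarrow> opin m \<omega> (Suc k) y = opin m \<omega> k y"
  | (change) x where "L < x" "x < R" "rings m \<omega> k x" "opin m \<omega> (Suc k) x \<noteq> opin m \<omega> k x"
      "\<And>y. y \<in> {L..R} \<Longrightarrow> y \<noteq> x \<Longrightarrow> opin m \<omega> (Suc k) y = opin m \<omega> k y"
      "\<And>y. y \<in> {L..R} \<Longrightarrow> y \<noteq> x \<Longrightarrow> \<not> rings m \<omega> k y"
proof (cases "\<forall>y\<in>{L..R}. opin m \<omega> (Suc k) y = opin m \<omega> k y")
  case True then show ?thesis using idle by blast
next
  case False
  then obtain x where x: "x \<in> {L..R}" "opin m \<omega> (Suc k) x \<noteq> opin m \<omega> k x" by blast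
  then have rx: "rings m \<omega> k x" using opin_quiet by blast
  have q: "\<not> rings m \<omega> k y" if "y \<in> {L..R}" "y \<noteq> x" for y
    using iso rx x(1) that unfolding isolated_def by blast
  have "x \<noteq> L" "x \<noteq> R" using iso rx unfolding isolated_def by auto
  then show ?thesis
    using x rx q opin_quiet by (intro change[of x]) (auto simp del: opin.simps)
qed

text \<open>Only the emitting edge, with gap \<open>a\<close>, and the receiving edge, with gap
  \<open>b\<close>, change, so a bound for such a pair bounds the whole sum. It is used with
  \<open>- min j \<theta>\<close> and \<open>c = 1\<close>, and with \<open>phi\<close> and
  \<open>c = 2\<close>.\<close>

lemma potential_step:
  fixes pot :: "nat \<Rightarrow> real"
  assumes pot: "\<And>a b b'. 1 \<le> a \<Longrightarrow> a \<le> \<theta> \<Longrightarrow> b' = b + 1 \<or> b' + 1 = b \<Longrightarrow>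
      pot a + pot b + (if Q b b' then c else 0) \<le> pot (a - 1) + pot b'"
    and v: "valid_marks F \<omega>" and iso: "isolated m \<omega> L R k"
  shows "(\<Sum>e\<in>{L..<R}. pot (gap m \<omega> k e)) + c * card {e\<in>{L..<R}. receives Q m \<omega> k e}
    \<le> (\<Sum>e\<in>{L..<R}. pot (gap m \<omega> (Suc k) e))"
  using v iso
proof (cases rule: isolated_cases)
  case idle
  have "gap m \<omega> (Suc k) e = gap m \<omega> k e" if "e \<in> {L..<R}" for e
    using that idle[of e] idle[of "e + 1"] by (simp add: gap_def del: opin.simps)
  then have "(\<Sum>e\<in>{L..<R}. pot (gap m \<omega> (Suc k) e)) = (\<Sum>e\<in>{L..<R}. pot (gap m \<omega> k e))"
    by (intro sum.cong) auto
  moreover have "\<not> receives Q m \<omega> k e" if "e \<in> {L..<R}" for e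
    using that idle[of e] idle[of "e + 1"] by (simp add: receives_def del: opin.simps)
  then have "card {e\<in>{L..<R}. receives Q m \<omega> k e} = 0"
    by (metis (no_types, lifting) Collect_empty_eq card.empty)
  ultimately show ?thesis by simp
next
  case (change x)
  have l: "opin m \<omega> (Suc k) (x - 1) = opin m \<omega> k (x - 1)" and r: "opin m \<omega> (Suc k) (x + 1) = opin m \<omega> k (x + 1)"
    using change(1,2) by (auto intro!: change(5) simp del: opin.simps)
  obtain em rc where er: "source m \<omega> k x = x + 1 \<and> em = x \<and> rc = x - 1 \<or> source m \<omega> k x = x - 1 \<and> em = x - 1 \<and> rc = x"
    "1 \<le> gap m \<omega> k em" "gap m \<omega> k em \<le> \<theta>" "gap m \<omega> (Suc k) em + 1 = gap m \<omega> k em"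
    "gap m \<omega> (Suc k) rc = gap m \<omega> k rc + 1 \<or> gap m \<omega> (Suc k) rc + 1 = gap m \<omega> k rc"
    by (rule opin_change[OF v change(4) l r]) blast
  have in_LR: "em \<in> {L..<R}" "rc \<in> {L..<R}" "em \<noteq> rc" "{em, rc} = {x - 1, x}"
    using er(1) change(1,2) by auto
  have other: "gap m \<omega> (Suc k) e = gap m \<omega> k e" if "e \<in> {L..<R} - {em, rc}" for e
    using that change(5)[of e] change(5)[of "e + 1"] in_LR(4) by (auto simp: gap_def simp del: opin.simps)
  have split: "(\<Sum>e\<in>{L..<R}. f e) = f em + f rc + (\<Sum>e\<in>{L..<R} - {em, rc}. f e)" for f :: "int \<Rightarrow> real"
    using in_LR(1,2,3) sum.subset_diff[of "{em, rc}" "{L..<R}" f] by simp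
  have "receives Q m \<omega> k e \<longleftrightarrow> e = rc \<and> Q (gap m \<omega> k rc) (gap m \<omega> (Suc k) rc)" if e: "e \<in> {L..<R}" for e
  proof -
    have "opin m \<omega> (Suc k) y \<noteq> opin m \<omega> k y \<longleftrightarrow> y = x" if "y \<in> {L..R}" for y
      using change(4,5) that by blast
    then have "opin m \<omega> (Suc k) e \<noteq> opin m \<omega> k e \<longleftrightarrow> e = x" "opin m \<omega> (Suc k) (e + 1) \<noteq> opin m \<omega> k (e + 1) \<longleftrightarrow> e + 1 = x"
      using e by auto
    then show ?thesis using er(1) unfolding receives_def by (auto simp del: opin.simps)
  qed
  then have "{e\<in>{L..<R}. receives Q m \<omega> k e} = (if Q (gap m \<omega> k rc) (gap m \<omega> (Suc k) rc) then {rc} else {})"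
    using in_LR(2) by auto
  then have "c * card {e\<in>{L..<R}. receives Q m \<omega> k e} = (if Q (gap m \<omega> k rc) (gap m \<omega> (Suc k) rc) then c else 0)"
    by simp
  moreover have "pot (gap m \<omega> k em) + pot (gap m \<omega> k rc) + (if Q (gap m \<omega> k rc) (gap m \<omega> (Suc k) rc) then c else 0)
      \<le> pot (gap m \<omega> k em - 1) + pot (gap m \<omega> (Suc k) rc)"
    using er(2,3,5) by (intro pot) auto
  moreover have "pot (gap m \<omega> k em - 1) = pot (gap m \<omega> (Suc k) em)" using er(4) by (metis add_diff_cancel_right')
  moreover have "(\<Sum>e\<in>{L..<R} - {em, rc}. pot (gap m \<omega> (Suc k) e)) = (\<Sum>e\<in>{L..<R} - {em, rc}. pot (gap m \<omega> k e))"
    using other by (intro sum.cong) auto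
  ultimately show ?thesis
    unfolding split[of "\<lambda>e. pot (gap m \<omega> k e)"] split[of "\<lambda>e. pot (gap m \<omega> (Suc k) e)"] by linarith
qed

lemma atLeastLessThanSuc_eq: "(i::nat) \<le> j \<Longrightarrow> {i..<Suc j} = insert j {i..<j}"
  by (simp add: atLeastLessThanSuc)

text \<open>Each receiving edge is counted once, however often it receives, because in
  \<open>drift\<close> the count has to become the probability of an event.\<close>

lemma potential_window:
  fixes pot :: "nat \<Rightarrow> real"
  assumes pot: "\<And>a b b'. 1 \<le> a \<Longrightarrow> a \<le> \<theta> \<Longrightarrow> b' = b + 1 \<or> b' + 1 = b \<Longrightarrow>
      pot a + pot b + (if Q b b' then c else 0) \<le> pot (a - 1) + pot b'"
    and c: "0 \<le> c" and v: "valid_marks F \<omega>" and iso: "\<And>k. i \<le> k \<Longrightarrow> k < j \<Longrightarrow> isolated m \<omega> L R k" and "i \<le> j"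
  shows "(\<Sum>e\<in>{L..<R}. pot (gap m \<omega> i e)) + c * card {e\<in>{L..<R}. \<exists>k\<in>{i..<j}. receives Q m \<omega> k e}
    \<le> (\<Sum>e\<in>{L..<R}. pot (gap m \<omega> j e))"
  using \<open>i \<le> j\<close> iso
proof (induction j rule: dec_induct)
  case base
  then show ?case by simp
next
  case (step j)
  let ?A = "{e\<in>{L..<R}. \<exists>k\<in>{i..<j}. receives Q m \<omega> k e}" and ?B = "{e\<in>{L..<R}. receives Q m \<omega> j e}"
  have "{e\<in>{L..<R}. \<exists>k\<in>{i..<Suc j}. receives Q m \<omega> k e} = ?A \<union> ?B"
    unfolding atLeastLessThanSuc_eq[OF step(1)] by blast
  then have "card {e\<in>{L..<R}. \<exists>k\<in>{i..<Suc j}. receives Q m \<omega> k e} \<le> card ?A + card ?B"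
    by (simp only: card_Un_le)
  then have "real (card {e\<in>{L..<R}. \<exists>k\<in>{i..<Suc j}. receives Q m \<omega> k e}) \<le> real (card ?A) + real (card ?B)"
    by linarith
  from mult_left_mono[OF this c]
  have "c * card {e\<in>{L..<R}. \<exists>k\<in>{i..<Suc j}. receives Q m \<omega> k e} \<le> c * card ?A + c * card ?B"
    by (simp only: distrib_left)
  moreover have "isolated m \<omega> L R j" by (rule step.prems) (use step(1) in auto)
  from potential_step[where pot=pot and Q=Q and c=c, OF _ v this] pot
  have "(\<Sum>e\<in>{L..<R}. pot (gap m \<omega> j e)) + c * card ?B \<le> (\<Sum>e\<in>{L..<R}. pot (gap m \<omega> (Suc j) e))" by blast
  moreover have "(\<Sum>e\<in>{L..<R}. pot (gap m \<omega> i e)) + c * card ?A \<le> (\<Sum>e\<in>{L..<R}. pot (gap m \<omega> j e))"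
    by (rule step.IH) (rule step.prems, simp_all)
  ultimately show ?case by linarith
qed

end

section \<open>Symmetries\<close>

lemma arrival_eq_ringing: "arrival \<omega> x n = ringing (snd (\<omega> x)) n"
  by (simp add: arrival_def ringing_def mark_of_def)

definition recolor :: "(int \<Rightarrow> nat set) \<Rightarrow> (int \<Rightarrow> site) \<Rightarrow> int \<Rightarrow> site" where
  "recolor f \<omega> = (\<lambda>x. (symdiff (fst (\<omega> x)) (f x), snd (\<omega> x)))"

lemma arrival_translate: "arrival (translate z \<omega>) x n = arrival \<omega> (x + z) n"
  by (simp add: arrival_def mark_of_def translate_apply)

lemma nbr_translate: "nbr (translate z \<omega>) x n = nbr \<omega> (x + z) n - z"
  by (simp add: nbr_def mark_of_def translate_apply)

lemma rung_translate: "rung m (translate z \<omega>) k x n = rung m \<omega> k (x + z) n"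
  by (simp add: rung_def arrival_translate)

lemma source_translate: "source m (translate z \<omega>) k x = source m \<omega> k (x + z) - z"
  by (simp add: source_def rings_def ring_index_def rung_translate nbr_translate)

lemma arrival_recolor: "arrival (recolor f \<omega>) x n = arrival \<omega> x n"
  by (simp add: arrival_def mark_of_def recolor_def)

lemma rung_recolor: "rung m (recolor f \<omega>) k x n = rung m \<omega> k x n"
  by (simp add: rung_def arrival_recolor)

lemma source_recolor: "source m (recolor f \<omega>) k x = source m \<omega> k x"
  by (simp add: source_def rings_def ring_index_def rung_recolor nbr_def mark_of_def) (simp add: recolor_def)

lemma perm_of_recolor: "perm_of (recolor f \<omega>) x n = perm_of \<omega> x n"
  by (simp add: perm_of_def mark_of_def recolor_def)

lemma symdiff_Int: "symdiff u w \<inter> A = symdiff (u \<inter> A) (w \<inter> A)"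
  by (auto simp: symdiff_def)

context deffuant
begin

lemma opin_translate: "opin m (translate z \<omega>) k x = opin m \<omega> k (x + z)"
proof (induction k arbitrary: x)
  case 0
  show ?case by (simp add: init_op_def translate_apply)
next
  case (Suc k)
  show ?case
    by (simp add: Suc source_translate)
       (simp add: perm_of_def mark_of_def translate_apply ring_index_def rung_translate)
qed

lemma gap_translate: "gap m (translate z \<omega>) k e = gap m \<omega> k (e + z)"
  by (simp add: gap_def opin_translate ac_simps)

lemma receives_translate: "receives Q m (translate z \<omega>) k e = receives Q m \<omega> k (e + z)"
proof -
  have "source m \<omega> k (e + z) - z = e - 1 \<longleftrightarrow> source m \<omega> k (e + z) = e + z - 1"
    "source m \<omega> k (e + 1 + z) - z = e + 2 \<longleftrightarrow> source m \<omega> k (e + z + 1) = e + z + 2"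
    by (auto simp: ac_simps)
  then show ?thesis
    unfolding receives_def gap_translate source_translate opin_translate
    by (simp add: ac_simps)
qed

text \<open>An update commutes with the flips \<open>f\<close> for one of two reasons: both sites
  involved carry the same flip, or the original pair and the flipped pair are both too far apart to
  interact.\<close>

lemma opin_Suc_recolor:
  assumes perm: "\<And>x n. perm_of \<omega> x n permutes {..<F}" and f: "\<And>x. f x \<subseteq> {..<F}"
    and IH: "\<And>y. y \<in> {x, source m \<omega> k x} \<Longrightarrow> opin m (recolor f \<omega>) k y = symdiff (opin m \<omega> k y) (f y)"
    and ok: "f (source m \<omega> k x) = f x \<or> \<theta> < hamming F (opin m \<omega> k x) (opin m \<omega> k (source m \<omega> k x)) \<and>
      \<theta> < hamming F (symdiff (opin m \<omega> k x) (f x)) (symdiff (opin m \<omega> k (source m \<omega> k x)) (f (source m \<omega> k x)))"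
  shows "opin m (recolor f \<omega>) (Suc k) x = symdiff (opin m \<omega> (Suc k) x) (f x)"
proof -
  let ?p = "perm_of \<omega> x (ring_index m \<omega> k x)"
  have fx: "f x \<inter> {..<F} = f x" using f by blast
  have "opin m (recolor f \<omega>) (Suc k) x =
      deffuant_step F \<theta> ?p (symdiff (opin m \<omega> k x) (f x)) (symdiff (opin m \<omega> k (source m \<omega> k x)) (f (source m \<omega> k x))) \<inter> {..<F}"
    by (simp add: IH source_recolor perm_of_recolor ring_index_def rung_recolor)
  also have "\<dots> = symdiff (deffuant_step F \<theta> ?p (opin m \<omega> k x) (opin m \<omega> k (source m \<omega> k x))) (f x) \<inter> {..<F}"
    using ok
  proof
    assume "f (source m \<omega> k x) = f x"
    then show ?thesis using deffuant_step_symdiff[OF perm] by simp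
  next
    assume "\<theta> < hamming F (opin m \<omega> k x) (opin m \<omega> k (source m \<omega> k x)) \<and>
      \<theta> < hamming F (symdiff (opin m \<omega> k x) (f x)) (symdiff (opin m \<omega> k (source m \<omega> k x)) (f (source m \<omega> k x)))"
    then show ?thesis by (simp add: deffuant_step_idle)
  qed
  also have "\<dots> = symdiff (opin m \<omega> (Suc k) x) (f x)"
    by (simp add: symdiff_Int fx)
  finally show ?thesis .
qed

lemma opin_0_recolor: "f x \<subseteq> {..<F} \<Longrightarrow> opin m (recolor f \<omega>) 0 x = symdiff (opin m \<omega> 0 x) (f x)"
  by (auto simp: init_op_def recolor_def)

lemma opin_recolor_const:
  assumes perm: "\<And>x n. perm_of \<omega> x n permutes {..<F}" and D: "D \<subseteq> {..<F}"
  shows "opin m (recolor (\<lambda>_. D) \<omega>) k x = symdiff (opin m \<omega> k x) D"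
proof (induction k arbitrary: x)
  case 0
  show ?case using D by (rule opin_0_recolor)
next
  case (Suc k)
  show ?case by (rule opin_Suc_recolor[OF perm]) (use D Suc in auto)
qed

section \<open>The first hit of the edge at 0\<close>

definition hit :: "nat \<Rightarrow> (int \<Rightarrow> site) \<Rightarrow> nat \<Rightarrow> bool" where
  "hit m \<omega> k \<longleftrightarrow> opin m \<omega> (Suc k) 0 \<noteq> opin m \<omega> k 0 \<or> opin m \<omega> (Suc k) 1 \<noteq> opin m \<omega> k 1"

text \<open>Flipping \<open>D\<close> at all sites to the right of the edge at 0 changes the
  disagreement set of that edge and of no other.\<close>

definition right_of_0 :: "nat set \<Rightarrow> int \<Rightarrow> nat set" where
  "right_of_0 D x = (if 1 \<le> x then D else {})"

text \<open>The issue flipped at the first hit up to time \<open>t\<close>, with \<open>F\<close>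
  standing for no hit. When updates are isolated, the set under the inner \<open>LEAST\<close> is a
  singleton.\<close>

definition hit_level :: "nat \<Rightarrow> nat \<Rightarrow> (int \<Rightarrow> site) \<Rightarrow> nat" where
  "hit_level m t \<omega> = (if \<exists>k<t * 2 ^ m. hit m \<omega> k
     then let k = LEAST k. hit m \<omega> k in
       LEAST i. i \<in> symdiff (opin m \<omega> (Suc k) 0) (opin m \<omega> k 0) \<union> symdiff (opin m \<omega> (Suc k) 1) (opin m \<omega> k 1)
     else F)"

text \<open>Until the edge at \<open>0\<close> is hit for the first time, a frozen disagreement there only separates its two
  sides, so the evolution does not depend on which issues it consists of.\<close>

lemma opin_recolor_before_hit:
  assumes v: "valid_marks F \<omega>" and D: "D \<subseteq> {..<F}"
    and fr: "\<theta> < gap m \<omega> 0 0" "\<theta> < gap m (recolor (right_of_0 D) \<omega>) 0 0"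
    and no: "\<And>j. j < k \<Longrightarrow> \<not> hit m \<omega> j"
  shows "opin m (recolor (right_of_0 D) \<omega>) k x = symdiff (opin m \<omega> k x) (right_of_0 D x)"
    and "opin m (recolor (right_of_0 D) \<omega>) (Suc k) x = symdiff (opin m \<omega> (Suc k) x) (right_of_0 D x)"
proof -
  have perm: "perm_of \<omega> x n permutes {..<F}" for x n using v by (simp add: valid_marks_def)
  have f: "right_of_0 D x \<subseteq> {..<F}" for x using D by (simp add: right_of_0_def)
  have stay: "(\<And>i. i < j \<Longrightarrow> \<not> hit m \<omega> i) \<Longrightarrow> opin m \<omega> j 0 = opin m \<omega> 0 0 \<and> opin m \<omega> j 1 = opin m \<omega> 0 1" for j
  proof (induction j)
    case (Suc j)
    then show ?case using Suc.prems[of j] unfolding hit_def by (simp del: opin.simps)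
  qed simp
  have step: "opin m (recolor (right_of_0 D) \<omega>) (Suc j) x = symdiff (opin m \<omega> (Suc j) x) (right_of_0 D x)"
    if eq: "\<And>x. opin m (recolor (right_of_0 D) \<omega>) j x = symdiff (opin m \<omega> j x) (right_of_0 D x)"
      and no: "\<And>i. i < j \<Longrightarrow> \<not> hit m \<omega> i" for j x
  proof (rule opin_Suc_recolor[where f="right_of_0 D", OF perm f])
    let ?y = "source m \<omega> j x"
    have y: "?y = x \<or> ?y = x + 1 \<or> ?y = x - 1"
      using source_valid[OF v] by (cases "rings m \<omega> j x") auto
    have o: "opin m \<omega> j 0 = opin m \<omega> 0 0" "opin m \<omega> j 1 = opin m \<omega> 0 1"
      using stay[of j] no by blast+
    have "gap m (recolor (right_of_0 D) \<omega>) 0 0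
        = hamming F (symdiff (opin m \<omega> 0 0) (right_of_0 D 0)) (symdiff (opin m \<omega> 0 1) (right_of_0 D 1))"
      by (simp only: gap_def opin_0_recolor[where f="right_of_0 D", OF f] add_0)
    then have g: "\<theta> < hamming F (opin m \<omega> j 0) (opin m \<omega> j 1)"
      "\<theta> < hamming F (symdiff (opin m \<omega> j 0) (right_of_0 D 0)) (symdiff (opin m \<omega> j 1) (right_of_0 D 1))"
      using fr unfolding o by (simp_all only: gap_def add_0)
    show "right_of_0 D ?y = right_of_0 D x \<or> \<theta> < hamming F (opin m \<omega> j x) (opin m \<omega> j ?y) \<and>
      \<theta> < hamming F (symdiff (opin m \<omega> j x) (right_of_0 D x)) (symdiff (opin m \<omega> j ?y) (right_of_0 D ?y))"
    \<comment> \<open>Only the pair across the edge at 0 carries different flips, and that pair is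
      frozen with and without them.\<close>
    proof (cases "x = 0 \<and> ?y = 1 \<or> x = 1 \<and> ?y = 0")
      case True
      then show ?thesis using g by (auto simp: hamming_commute)
    next
      case False
      then have "1 \<le> ?y \<longleftrightarrow> 1 \<le> x" using y by (smt (verit))
      then show ?thesis by (simp add: right_of_0_def)
    qed
  qed (rule eq)
  have "j \<le> k \<Longrightarrow> opin m (recolor (right_of_0 D) \<omega>) j x = symdiff (opin m \<omega> j x) (right_of_0 D x)" for j x
  proof (induction j arbitrary: x)
    case 0
    show ?case using f by (rule opin_0_recolor)
  next
    case (Suc j)
    show ?case by (rule step) (use Suc no in auto)
  qed
  then show 1: "opin m (recolor (right_of_0 D) \<omega>) k x = symdiff (opin m \<omega> k x) (right_of_0 D x)" for x by simp
  show "opin m (recolor (right_of_0 D) \<omega>) (Suc k) x = symdiff (opin m \<omega> (Suc k) x) (right_of_0 D x)"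
    by (rule step[OF 1 no]) assumption
qed

lemma symdiff_cancel: "symdiff (symdiff u w) (symdiff v w) = symdiff u v"
  by (auto simp: symdiff_def)

lemma symdiff_right_inj: "symdiff u w = symdiff v w \<longleftrightarrow> u = v"
  by (metis symdiff_symdiff)

text \<open>The two evolutions differ exactly by the flip up to and including the first hit. Hence
  the first hit occurs at the same step, and the flip cancels in the symmetric difference that
  yields the issue.\<close>

lemma hit_level_recolor:
  assumes v: "valid_marks F \<omega>" and D: "D \<subseteq> {..<F}"
    and fr: "\<theta> < gap m \<omega> 0 0" "\<theta> < gap m (recolor (right_of_0 D) \<omega>) 0 0"
  shows "hit_level m t (recolor (right_of_0 D) \<omega>) = hit_level m t \<omega>"
proof -
  let ?r = "recolor (right_of_0 D) \<omega>"
  note eq = opin_recolor_before_hit[OF v D fr]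
  have hk: "hit m ?r k \<longleftrightarrow> hit m \<omega> k" if "\<And>j. j < k \<Longrightarrow> \<not> hit m \<omega> j" for k
  proof -
    have "opin m ?r k x = symdiff (opin m \<omega> k x) (right_of_0 D x)"
      "opin m ?r (Suc k) x = symdiff (opin m \<omega> (Suc k) x) (right_of_0 D x)" for x
      using eq[of k x] that by blast+
    then show ?thesis unfolding hit_def by (simp only: symdiff_right_inj)
  qed
  show ?thesis
  proof (cases "\<exists>k. hit m \<omega> k")
    case False
    then have "\<not> hit m ?r k" for k using hk by blast
    with False show ?thesis by (simp add: hit_level_def)
  next
    case True
    define K where "K = (LEAST k. hit m \<omega> k)"
    have K: "hit m \<omega> K" "\<And>j. j < K \<Longrightarrow> \<not> hit m \<omega> j"
      using LeastI_ex[OF True] not_less_Least unfolding K_def by blast+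
    have K': "hit m ?r K" "\<And>j. j < K \<Longrightarrow> \<not> hit m ?r j"
      using K hk by (blast, metis hk order.strict_trans)
    have L: "(LEAST k. hit m \<omega> k) = K" "(LEAST k. hit m ?r k) = K"
      using K K' by (auto intro!: Least_equality leI)
    have ex: "(\<exists>k<N. hit m \<omega> k) \<longleftrightarrow> K < N" "(\<exists>k<N. hit m ?r k) \<longleftrightarrow> K < N" for N
      using K K' by (blast intro: le_less_trans leI)+
    have "opin m ?r K x = symdiff (opin m \<omega> K x) (right_of_0 D x)"
      "opin m ?r (Suc K) x = symdiff (opin m \<omega> (Suc K) x) (right_of_0 D x)" for x
      using eq[of K x] K(2) by blast+
    then show ?thesis
      unfolding hit_level_def L ex Let_def by (simp only: symdiff_cancel)
  qed
qed

end

section \<open>Agreement with the paths of the model\<close>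

text \<open>The last condition supplies, for each time horizon, sites on both sides of any point
  that have not rung yet; they confine the dynamics to finite blocks.\<close>

definition good :: "nat \<Rightarrow> (int \<Rightarrow> site) \<Rightarrow> bool" where
  "good F \<omega> \<longleftrightarrow> valid_marks F \<omega> \<and> (\<forall>x. filterlim (arrival \<omega> x) at_top sequentially) \<and>
     (\<forall>x y n l. x \<noteq> y \<longrightarrow> arrival \<omega> x n \<noteq> arrival \<omega> y l) \<and>
     (\<forall>(T::nat) z. (\<exists>L<z. T < arrival \<omega> L 0) \<and> (\<exists>R>z. T < arrival \<omega> R 0))"

lemma arrival_Suc: "arrival \<omega> x (Suc n) = arrival \<omega> x n + fst (mark_of \<omega> x (Suc n))"
  by (simp add: arrival_def)

lemma strict_mono_arrival: "valid_marks F \<omega> \<Longrightarrow> strict_mono (arrival \<omega> x)"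
  by (intro strict_mono_Suc_iff[THEN iffD2]) (auto simp: arrival_Suc valid_marks_def)

lemma arrival_pos: "valid_marks F \<omega> \<Longrightarrow> 0 < arrival \<omega> x n"
  by (auto simp: arrival_def valid_marks_def intro!: sum_pos)

definition separated :: "nat \<Rightarrow> (int \<Rightarrow> site) \<Rightarrow> int \<Rightarrow> int \<Rightarrow> nat \<Rightarrow> bool" where
  "separated m \<omega> L R T \<longleftrightarrow> T < arrival \<omega> L 0 \<and> T < arrival \<omega> R 0 \<and>
    (\<forall>k<T * 2 ^ m. \<forall>x\<in>{L..R}. \<forall>y\<in>{L..R}. \<forall>n l. rung m \<omega> k x n \<longrightarrow> rung m \<omega> k y l \<longrightarrow> x = y \<and> n = l)"

lemma step_time_le:
  fixes k T m :: nat
  assumes "k < T * 2 ^ m" shows "real (Suc k) / 2 ^ m \<le> real T"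
proof -
  have "real (Suc k) \<le> real (T * 2 ^ m)" using assms by (intro of_nat_mono) simp
  then show ?thesis by (simp add: divide_le_eq)
qed

text \<open>Finitely many rings occur in the block up to time \<open>T\<close>, at distinct times;
  steps shorter than their least distance separate them.\<close>

lemma eventually_separated:
  assumes g: "good F \<omega>" and LR: "real T < arrival \<omega> L 0" "real T < arrival \<omega> R 0"
  shows "\<forall>\<^sub>F m in sequentially. separated m \<omega> L R T"
proof -
  have v: "valid_marks F \<omega>" using g by (simp add: good_def)
  define A where "A = (SIGMA x:{L..R}. {n. arrival \<omega> x n \<le> T})"
  have "finite {n. arrival \<omega> x n \<le> T}" for x
  proof -
    have "\<forall>\<^sub>F n in sequentially. real T < arrival \<omega> x n"
      using g by (simp add: good_def filterlim_at_top_dense)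
    then show ?thesis
      by (auto simp: eventually_sequentially not_le[symmetric] intro: finite_subset[of _ "{..<_}"])
         (metis (mono_tags, lifting) finite_nat_set_iff_bounded leI mem_Collect_eq)
  qed
  then have fA: "finite A" unfolding A_def by (intro finite_SigmaI) auto
  define D where "D = {\<bar>arrival \<omega> x n - arrival \<omega> y l\<bar> | x n y l. (x, n) \<in> A \<and> (y, l) \<in> A \<and> (x, n) \<noteq> (y, l)}"
  have "D \<subseteq> (\<lambda>((x, n), (y, l)). \<bar>arrival \<omega> x n - arrival \<omega> y l\<bar>) ` (A \<times> A)"
    unfolding D_def by force
  then have fD: "finite D" using fA by (meson finite_SigmaI finite_imageI finite_subset)
  have neq: "arrival \<omega> x n \<noteq> arrival \<omega> y l" if "(x, n) \<noteq> (y, l)" for x n y l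
  proof (cases "x = y")
    case True
    with that strict_mono_eq[OF strict_mono_arrival[OF v, of x], of n l] show ?thesis by auto
  next
    case False
    with g show ?thesis by (simp add: good_def)
  qed
  have pD: "0 < d" if "d \<in> D" for d
    using that neq unfolding D_def by fastforce
  obtain \<delta> where \<delta>: "0 < \<delta>" "\<And>d. d \<in> D \<Longrightarrow> \<delta> \<le> d"
  proof (cases "D = {}")
    case True then show ?thesis using that[of 1] by simp
  next
    case False
    then show ?thesis using that[of "Min D"] pD[OF Min_in[OF fD False]] fD by simp
  qed
  have "(\<lambda>m. (1/2 :: real) ^ m) \<longlonglongrightarrow> 0" by (rule LIMSEQ_realpow_zero) auto
  then have "\<forall>\<^sub>F m in sequentially. (1/2 :: real) ^ m < \<delta>" using \<delta>(1) by (rule order_tendstoD)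
  then show ?thesis
  proof eventually_elim
    case (elim m)
    have "x = y \<and> n = l" if k: "k < T * 2 ^ m" and xy: "x \<in> {L..R}" "y \<in> {L..R}"
      and r: "rung m \<omega> k x n" "rung m \<omega> k y l" for k x y n l
    proof (rule ccontr)
      assume "\<not> (x = y \<and> n = l)"
      moreover have "(x, n) \<in> A" "(y, l) \<in> A"
        using r xy step_time_le[OF k] by (auto simp: A_def rung_def)
      ultimately have "\<delta> \<le> \<bar>arrival \<omega> x n - arrival \<omega> y l\<bar>"
        by (intro \<delta>(2)) (auto simp: D_def)
      moreover have "real (Suc k) / 2 ^ m = real k / 2 ^ m + (1/2) ^ m"
        by (simp add: add_divide_distrib power_one_over)
      ultimately show False using r elim unfolding rung_def by linarith
    qed
    then show ?case using LR unfolding separated_def by blast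
  qed
qed

context deffuant
begin

lemma rung_index: "separated m \<omega> L R T \<Longrightarrow> k < T * 2 ^ m \<Longrightarrow> x \<in> {L..R} \<Longrightarrow> rung m \<omega> k x n \<Longrightarrow> ring_index m \<omega> k x = n"
  using rung_ring_index[of m \<omega> k x] unfolding separated_def rings_def by blast

lemma separated_quiet_ends:
  assumes v: "valid_marks F \<omega>" and s: "separated m \<omega> L R T" and k: "k < T * 2 ^ m"
  shows "\<not> rings m \<omega> k L" "\<not> rings m \<omega> k R"
proof -
  have "\<not> rung m \<omega> k x n" if "T < arrival \<omega> x 0" for x n
    using that step_time_le[OF k] monoD[OF strict_mono_mono[OF strict_mono_arrival[OF v, of x]], of 0 n]
    unfolding rung_def by auto
  then show "\<not> rings m \<omega> k L" "\<not> rings m \<omega> k R"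
    using s unfolding rings_def separated_def by auto
qed

lemma separated_isolated:
  assumes v: "valid_marks F \<omega>" and s: "separated m \<omega> L R T" and k: "k < T * 2 ^ m"
  shows "isolated m \<omega> L R k"
  using separated_quiet_ends[OF assms] s k unfolding isolated_def separated_def rings_def by blast

lemma path_const:
  assumes p: "is_deffuant_path F \<theta> \<omega> \<eta>" and g: "good F \<omega>" and ab: "0 \<le> a" "a \<le> s" "s \<le> b"
    and q: "\<And>n. \<not> (a < arrival \<omega> x n \<and> arrival \<omega> x n \<le> b)"
  shows "\<eta> s x = \<eta> a x"
proof (cases "a < arrival \<omega> x 0")
  case True
  then have "b < arrival \<omega> x 0" using q[of 0] by auto
  then show ?thesis using p True ab unfolding is_deffuant_path_def by simp
next
  case False
  have "\<forall>\<^sub>F n in sequentially. a < arrival \<omega> x n"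
    using g by (simp add: good_def filterlim_at_top_dense)
  then obtain N where "a < arrival \<omega> x N" by (auto simp: eventually_sequentially)
  then have N: "\<not> arrival \<omega> x N \<le> a" by simp
  \<comment> \<open>The last ring up to time \<open>a\<close>; it exists because the ring times are
    unbounded.\<close>
  obtain n where n: "arrival \<omega> x n \<le> a" "a < arrival \<omega> x (Suc n)"
  proof (rule ccontr)
    assume "\<not> thesis"
    then have "arrival \<omega> x n \<le> a \<Longrightarrow> arrival \<omega> x (Suc n) \<le> a" for n using that not_less by blast
    then have "arrival \<omega> x n \<le> a" for n using False by (induction n) (auto simp: not_less)
    then show False using N by simp
  qed
  then have "s < arrival \<omega> x (Suc n)" using q[of "Suc n"] ab by auto
  then have "\<eta> s x = \<eta> (arrival \<omega> x n) x" "\<eta> a x = \<eta> (arrival \<omega> x n) x"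
    using p n ab unfolding is_deffuant_path_def by (metis order_trans)+
  then show ?thesis by simp
qed

lemma path_before:
  assumes p: "is_deffuant_path F \<theta> \<omega> \<eta>" and v: "valid_marks F \<omega>" and a: "0 \<le> a" "a < arrival \<omega> x n"
    and q: "\<And>l. l < n \<Longrightarrow> arrival \<omega> x l \<le> a"
  shows "\<eta> a x = (if n = 0 then init_op \<omega> x else \<eta> (arrival \<omega> x (n - 1)) x)"
proof (cases n)
  case 0
  then show ?thesis using p a unfolding is_deffuant_path_def by simp
next
  case (Suc n')
  then have "arrival \<omega> x n' \<le> a" using q by simp
  then show ?thesis using p a Suc unfolding is_deffuant_path_def by simp
qed

text \<open>Within a step at most one site of the block rings. The neighbour that it copies is
  constant on that step, so the left limit asked for by \<open>is_deffuant_path\<close> exists and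
  is the opinion that the recursion uses.\<close>

lemma path_step:
  assumes p: "is_deffuant_path F \<theta> \<omega> \<eta>" and g: "good F \<omega>" and s: "separated m \<omega> L R T" and k: "k < T * 2 ^ m"
    and agree: "\<forall>x\<in>{L..R}. \<eta> (real k / 2 ^ m) x = opin m \<omega> k x"
  shows "x \<in> {L..R} \<Longrightarrow> \<not> rings m \<omega> k x \<Longrightarrow> real k / 2 ^ m \<le> r \<Longrightarrow> r \<le> real (Suc k) / 2 ^ m \<Longrightarrow> \<eta> r x = opin m \<omega> k x"
    and "x \<in> {L..R} \<Longrightarrow> rung m \<omega> k x n \<Longrightarrow> real k / 2 ^ m \<le> r \<Longrightarrow> r < arrival \<omega> x n \<Longrightarrow> \<eta> r x = opin m \<omega> k x"
    and "x \<in> {L..R} \<Longrightarrow> rung m \<omega> k x n \<Longrightarrow> arrival \<omega> x n \<le> r \<Longrightarrow> r \<le> real (Suc k) / 2 ^ m \<Longrightarrow> \<eta> r x = opin m \<omega> (Suc k) x"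
proof -
  have v: "valid_marks F \<omega>" using g by (simp add: good_def)
  let ?a = "real k / 2 ^ m"
  have a0: "0 \<le> ?a" by simp
  show quiet: "\<eta> r x = opin m \<omega> k x"
    if "x \<in> {L..R}" "\<not> rings m \<omega> k x" "?a \<le> r" "r \<le> real (Suc k) / 2 ^ m" for x r
    using path_const[OF p g a0 that(3,4), of x] that(2) bspec[OF agree that(1)] unfolding rings_def rung_def by metis
  have uniq: "\<not> (?a < arrival \<omega> x l \<and> arrival \<omega> x l \<le> real (Suc k) / 2 ^ m)" if "x \<in> {L..R}" "rung m \<omega> k x n" "l \<noteq> n" for x l n
    using s k that unfolding separated_def rung_def by blast
  show before: "\<eta> r x = opin m \<omega> k x"
    if x: "x \<in> {L..R}" "rung m \<omega> k x n" "?a \<le> r" "r < arrival \<omega> x n" for x r n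
  proof -
    have "\<not> (?a < arrival \<omega> x l \<and> arrival \<omega> x l \<le> r)" for l
      using uniq[OF x(1,2), of l] x(2,4) unfolding rung_def by (cases "l = n") auto
    from path_const[OF p g a0 x(3) order_refl this] show ?thesis using bspec[OF agree x(1)] by simp
  qed
  assume x: "x \<in> {L..R}" "rung m \<omega> k x n" and r: "arrival \<omega> x n \<le> r" "r \<le> real (Suc k) / 2 ^ m"
  let ?y = "nbr \<omega> x n"
  have rx: "rings m \<omega> k x" using x(2) unfolding rings_def by blast
  have idx: "ring_index m \<omega> k x = n" using rung_index[OF s k x] .
  have src: "source m \<omega> k x = ?y" using rx idx by (simp add: source_def)
  have "x \<noteq> L" "x \<noteq> R" using separated_quiet_ends[OF v s k] rx by auto
  then have y: "?y \<in> {L..R}" "?y \<noteq> x" using x(1) source_valid[OF v rx] src by auto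
  have ny: "\<not> rings m \<omega> k ?y"
    using separated_isolated[OF v s k] rx x(1) y unfolding isolated_def by blast
  have lt: "?a < arrival \<omega> x n" "arrival \<omega> x n \<le> real (Suc k) / 2 ^ m" using x(2) unfolding rung_def by auto
  have "\<forall>\<^sub>F s in at_left (arrival \<omega> x n). s \<in> {?a<..<arrival \<omega> x n}"
    using lt(1) by (rule eventually_at_left_real)
  then have ev: "\<forall>\<^sub>F s in at_left (arrival \<omega> x n). \<eta> s ?y = opin m \<omega> k ?y"
    by eventually_elim (use quiet[OF y(1) ny] lt(2) in auto)
  have upd: "\<eta> (arrival \<omega> x n) x = deffuant_step F \<theta> (perm_of \<omega> x n)
          (if n = 0 then init_op \<omega> x else \<eta> (arrival \<omega> x (n - 1)) x) (opin m \<omega> k ?y)"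
    using p ev unfolding is_deffuant_path_def by blast
  have le: "arrival \<omega> x l \<le> ?a" if "l < n" for l
    using uniq[OF x, of l] that lt strict_mono_less[OF strict_mono_arrival[OF v, of x], of l n] by auto
  have "(if n = 0 then init_op \<omega> x else \<eta> (arrival \<omega> x (n - 1)) x) = opin m \<omega> k x"
    using path_before[OF p v a0 lt(1) le] bspec[OF agree x(1)] by simp
  with upd have "\<eta> (arrival \<omega> x n) x = deffuant_step F \<theta> (perm_of \<omega> x n) (opin m \<omega> k x) (opin m \<omega> k ?y)"
    by simp
  also have "\<dots> = opin m \<omega> (Suc k) x"
  proof -
    have "deffuant_step F \<theta> (perm_of \<omega> x n) (opin m \<omega> k x) (opin m \<omega> k ?y) \<subseteq> {..<F}"
    proof (cases "1 \<le> hamming F (opin m \<omega> k x) (opin m \<omega> k ?y) \<and> hamming F (opin m \<omega> k x) (opin m \<omega> k ?y) \<le> \<theta>")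
      case True
      have "perm_of \<omega> x n permutes {..<F}" using v by (simp add: valid_marks_def)
      from deffuant_step_flip[OF this] True
      show ?thesis using opin_subset[of m \<omega> k x] by (auto simp: disagree_def)
    next
      case False
      then show ?thesis using opin_subset by (simp add: deffuant_step_idle)
    qed
    then show ?thesis using src idx by auto
  qed
  finally have *: "\<eta> (arrival \<omega> x n) x = opin m \<omega> (Suc k) x" .
  have "\<not> (arrival \<omega> x n < arrival \<omega> x l \<and> arrival \<omega> x l \<le> real (Suc k) / 2 ^ m)" for l
    using uniq[OF x, of l] lt by (cases "l = n") auto
  from path_const[OF p g _ r this] arrival_pos[OF v, of x n]
  show "\<eta> r x = opin m \<omega> (Suc k) x" using * by simp
qed

lemma path_agree:
  assumes p: "is_deffuant_path F \<theta> \<omega> \<eta>" and g: "good F \<omega>" and s: "separated m \<omega> L R T"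
  shows "k \<le> T * 2 ^ m \<Longrightarrow> x \<in> {L..R} \<Longrightarrow> \<eta> (real k / 2 ^ m) x = opin m \<omega> k x"
proof (induction k arbitrary: x)
  case 0
  have v: "valid_marks F \<omega>" using g by (simp add: good_def)
  have "\<eta> 0 x = init_op \<omega> x" using p arrival_pos[OF v, of x 0] unfolding is_deffuant_path_def by simp
  moreover have "init_op \<omega> x \<subseteq> {..<F}" using v by (simp add: valid_marks_def)
  ultimately show ?case by auto
next
  case (Suc k)
  have k: "k < T * 2 ^ m" using Suc.prems by simp
  have IH: "\<forall>x\<in>{L..R}. \<eta> (real k / 2 ^ m) x = opin m \<omega> k x" using Suc by simp
  note st = path_step[OF p g s k IH]
  show ?case
  proof (cases "rings m \<omega> k x")
    case True
    then obtain n where "rung m \<omega> k x n" unfolding rings_def by blast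
    then show ?thesis using st(3)[of x n] Suc.prems unfolding rung_def by simp
  next
    case False
    have "real k / 2 ^ m \<le> real (Suc k) / 2 ^ m" by (intro divide_right_mono) auto
    then have "\<eta> (real (Suc k) / 2 ^ m) x = opin m \<omega> k x"
      using st(1)[of x "real (Suc k) / 2 ^ m"] Suc.prems(2) False by blast
    then show ?thesis using opin_quiet[OF False] by simp
  qed
qed

text \<open>The event that the edge \<open>e\<close> receives a disagreement during \<open>(s, t]\<close>, read off from the path itself;
  it shows that the discretised events stabilise as \<open>m\<close> grows.\<close>

definition path_receives ::
  "(nat \<Rightarrow> nat \<Rightarrow> bool) \<Rightarrow> (int \<Rightarrow> site) \<Rightarrow> (real \<Rightarrow> int \<Rightarrow> nat set) \<Rightarrow> nat \<Rightarrow> nat \<Rightarrow> int \<Rightarrow> bool" where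
  "path_receives Q \<omega> \<eta> s t e \<longleftrightarrow> (\<exists>x n u w. s < arrival \<omega> x n \<and> arrival \<omega> x n \<le> t \<and>
     (x = e \<and> nbr \<omega> x n = e - 1 \<and> \<eta> (arrival \<omega> x n) e \<noteq> u \<or> x = e + 1 \<and> nbr \<omega> x n = e + 2 \<and> \<eta> (arrival \<omega> x n) (e + 1) \<noteq> w) \<and>
     (\<forall>\<^sub>F r in at_left (arrival \<omega> x n). \<eta> r e = u \<and> \<eta> r (e + 1) = w) \<and>
     Q (hamming F u w) (hamming F (\<eta> (arrival \<omega> x n) e) (\<eta> (arrival \<omega> x n) (e + 1))))"

definition window_receives :: "(nat \<Rightarrow> nat \<Rightarrow> bool) \<Rightarrow> nat \<Rightarrow> (int \<Rightarrow> site) \<Rightarrow> nat \<Rightarrow> nat \<Rightarrow> int \<Rightarrow> bool" where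
  "window_receives Q m \<omega> s t e \<longleftrightarrow> (\<exists>k\<in>{s * 2 ^ m..<t * 2 ^ m}. receives Q m \<omega> k e)"

lemma path_at_ring:
  assumes p: "is_deffuant_path F \<theta> \<omega> \<eta>" and g: "good F \<omega>" and s: "separated m \<omega> L R T" and k: "k < T * 2 ^ m"
    and x: "x \<in> {L..R}" "rung m \<omega> k x n" and y: "y \<in> {L..R}"
  shows "\<forall>\<^sub>F r in at_left (arrival \<omega> x n). \<eta> r y = opin m \<omega> k y"
    and "\<eta> (arrival \<omega> x n) y = opin m \<omega> (Suc k) y"
proof -
  have v: "valid_marks F \<omega>" using g by (simp add: good_def)
  have ag: "\<forall>x\<in>{L..R}. \<eta> (real k / 2 ^ m) x = opin m \<omega> k x"
    using path_agree[OF p g s] k by simp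
  note st = path_step[OF p g s k ag]
  have lt: "real k / 2 ^ m < arrival \<omega> x n" "arrival \<omega> x n \<le> real (Suc k) / 2 ^ m"
    using x(2) unfolding rung_def by auto
  have "\<eta> r y = opin m \<omega> k y" if "real k / 2 ^ m \<le> r" "r < arrival \<omega> x n" for r
  proof (cases "y = x")
    case True then show ?thesis using st(2)[OF x that] by simp
  next
    case False
    then have "\<not> rings m \<omega> k y"
      using separated_isolated[OF v s k] x y unfolding isolated_def rings_def by blast
    then show ?thesis using st(1)[OF y] that lt(2) by simp
  qed
  note bef = this
  have "\<forall>\<^sub>F r in at_left (arrival \<omega> x n). r \<in> {real k / 2 ^ m<..<arrival \<omega> x n}"
    using lt(1) by (rule eventually_at_left_real)
  then show "\<forall>\<^sub>F r in at_left (arrival \<omega> x n). \<eta> r y = opin m \<omega> k y"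
    by (rule eventually_mono) (rule bef, simp_all)
  show "\<eta> (arrival \<omega> x n) y = opin m \<omega> (Suc k) y"
  proof (cases "y = x")
    case True then show ?thesis using st(3)[OF x order_refl lt(2)] by simp
  next
    case False
    then have nr: "\<not> rings m \<omega> k y"
      using separated_isolated[OF v s k] x y unfolding isolated_def rings_def by blast
    then have "\<eta> (arrival \<omega> x n) y = opin m \<omega> k y" using st(1)[OF y] lt by simp
    then show ?thesis using opin_quiet[OF nr] by simp
  qed
qed

text \<open>Steps are open on the left and closed on the right, so \<open>Suc k\<close> is the
  ceiling of \<open>a * 2 ^ m\<close>.\<close>

lemma obtain_step:
  assumes "real s < a" "a \<le> real t"
  obtains k where "s * 2 ^ m \<le> k" "k < t * 2 ^ m" "real k / 2 ^ m < a" "a \<le> real (Suc k) / 2 ^ m"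
proof -
  have a: "0 < a * 2 ^ m" using assms(1) by (intro mult_pos_pos) (auto intro: le_less_trans[OF of_nat_0_le_iff])
  define c where "c = nat \<lceil>a * 2 ^ m\<rceil>"
  have c: "0 < c" "real c = of_int \<lceil>a * 2 ^ m\<rceil>" using a by (auto simp: c_def)
  have up: "a * 2 ^ m \<le> real c" using c by simp
  have lo: "real c < a * 2 ^ m + 1" unfolding c(2) by linarith
  have k: "Suc (c - 1) = c" "real (c - 1) = real c - 1" using c by auto
  have 3: "real (c - 1) / 2 ^ m < a" unfolding k using lo by (simp add: divide_less_eq)
  have 4: "a \<le> real (Suc (c - 1)) / 2 ^ m" unfolding k using up by (simp add: le_divide_eq)
  have "real (s * 2 ^ m) < a * 2 ^ m" using assms(1) by simp
  then have "s * 2 ^ m < c" using up by (metis less_le_trans of_nat_less_iff)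
  then have 1: "s * 2 ^ m \<le> c - 1" by simp
  have "a * 2 ^ m \<le> real (t * 2 ^ m)" using assms(2) by simp
  then have "c \<le> t * 2 ^ m" by (simp add: c_def ceiling_le_iff nat_le_iff)
  then have 2: "c - 1 < t * 2 ^ m" using c(1) by simp
  show ?thesis by (rule that[OF 1 2 3 4])
qed

lemma window_receives_iff_path:
  assumes p: "is_deffuant_path F \<theta> \<omega> \<eta>" and g: "good F \<omega>" and s: "separated m \<omega> L R T"
    and e: "L \<le> e" "e < R" and t: "t \<le> T"
  shows "window_receives Q m \<omega> s' t e \<longleftrightarrow> path_receives Q \<omega> \<eta> s' t e"
proof
  have eLR: "e \<in> {L..R}" "e + 1 \<in> {L..R}" using e by auto
  have tT: "t * 2 ^ m \<le> T * 2 ^ m" using t by simp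
  {
    assume "window_receives Q m \<omega> s' t e"
    then obtain k where k: "s' * 2 ^ m \<le> k" "k < t * 2 ^ m" "receives Q m \<omega> k e"
      unfolding window_receives_def by auto
    obtain x where x: "x = e \<and> source m \<omega> k x = e - 1 \<or> x = e + 1 \<and> source m \<omega> k x = e + 2"
      "opin m \<omega> (Suc k) x \<noteq> opin m \<omega> k x" using k(3) unfolding receives_def by blast
    have kT: "k < T * 2 ^ m" using k(2) tT by (rule less_le_trans)
    have xLR: "x \<in> {L..R}" using x(1) eLR by auto
    have rx: "rings m \<omega> k x" using x(2) opin_quiet by blast
    define n where "n = ring_index m \<omega> k x"
    have rn: "rung m \<omega> k x n" unfolding n_def by (rule rung_ring_index[OF rx])
    have src: "source m \<omega> k x = nbr \<omega> x n" using rx by (simp add: source_def n_def)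
    have "real s' \<le> real k / 2 ^ m"
      using of_nat_mono[OF k(1), where 'a=real] by (simp add: le_divide_eq)
    moreover have "real (Suc k) / 2 ^ m \<le> t" using k(2) by (rule step_time_le)
    ultimately have ar: "real s' < arrival \<omega> x n" "arrival \<omega> x n \<le> t"
      using rn unfolding rung_def by auto
    note P = path_at_ring[OF p g s kT xLR rn]
    show "path_receives Q \<omega> \<eta> s' t e"
      unfolding path_receives_def
      by (rule exI[of _ x], rule exI[of _ n], rule exI[of _ "opin m \<omega> k e"], rule exI[of _ "opin m \<omega> k (e + 1)"])
         (use ar x src P(1)[OF eLR(1)] P(1)[OF eLR(2)] k(3) in \<open>auto simp: P(2)[OF eLR(1)] P(2)[OF eLR(2)] receives_def gap_def
           simp del: opin.simps intro: eventually_conj\<close>)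
  }
  {
    assume "path_receives Q \<omega> \<eta> s' t e"
    then obtain x n u w where x: "real s' < arrival \<omega> x n" "arrival \<omega> x n \<le> t"
      "x = e \<and> nbr \<omega> x n = e - 1 \<and> \<eta> (arrival \<omega> x n) e \<noteq> u \<or> x = e + 1 \<and> nbr \<omega> x n = e + 2 \<and> \<eta> (arrival \<omega> x n) (e + 1) \<noteq> w"
      "\<forall>\<^sub>F r in at_left (arrival \<omega> x n). \<eta> r e = u \<and> \<eta> r (e + 1) = w"
      "Q (hamming F u w) (hamming F (\<eta> (arrival \<omega> x n) e) (\<eta> (arrival \<omega> x n) (e + 1)))"
      unfolding path_receives_def by blast
    obtain k where k: "s' * 2 ^ m \<le> k" "k < t * 2 ^ m" "real k / 2 ^ m < arrival \<omega> x n" "arrival \<omega> x n \<le> real (Suc k) / 2 ^ m"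
      using obtain_step[OF x(1,2)] .
    have rn: "rung m \<omega> k x n" using k unfolding rung_def by simp
    have kT: "k < T * 2 ^ m" using k(2) tT by (rule less_le_trans)
    have xLR: "x \<in> {L..R}" using x(3) eLR by auto
    have src: "source m \<omega> k x = nbr \<omega> x n"
      using rn rung_index[OF s kT xLR rn] by (auto simp: source_def rings_def)
    note P = path_at_ring[OF p g s kT xLR rn]
    have "\<forall>\<^sub>F r in at_left (arrival \<omega> x n). u = opin m \<omega> k e \<and> w = opin m \<omega> k (e + 1)"
      using x(4) P(1)[OF eLR(1)] P(1)[OF eLR(2)] by eventually_elim auto
    then have uw: "u = opin m \<omega> k e" "w = opin m \<omega> k (e + 1)" by simp_all
    have "receives Q m \<omega> k e"
      using x(3,5) src unfolding receives_def gap_def P(2)[OF eLR(1)] P(2)[OF eLR(2)] uw by metis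
    then show "window_receives Q m \<omega> s' t e" using k unfolding window_receives_def by auto
  }
qed

lemma good_block:
  assumes "good F \<omega>"
  obtains L R where "L < a" "b < R" "\<forall>\<^sub>F m in sequentially. separated m \<omega> L R T"
proof -
  obtain L R where "L < a" "real T < arrival \<omega> L 0" "b < R" "real T < arrival \<omega> R 0"
    using assms unfolding good_def by meson
  then show ?thesis using that eventually_separated[OF assms] by blast
qed

lemma eventually_window_receives_iff:
  assumes p: "is_deffuant_path F \<theta> \<omega> \<eta>" and g: "good F \<omega>"
  shows "\<forall>\<^sub>F m in sequentially. window_receives Q m \<omega> s t e \<longleftrightarrow> path_receives Q \<omega> \<eta> s t e"
proof -
  obtain L R where LR: "L < e" "e < R" "\<forall>\<^sub>F m in sequentially. separated m \<omega> L R t"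
    using good_block[OF g] .
  from LR(3) show ?thesis
    by eventually_elim (use window_receives_iff_path[OF p g] LR in auto)
qed

lemma eventually_opin_eq_path:
  assumes p: "is_deffuant_path F \<theta> \<omega> \<eta>" and g: "good F \<omega>"
  shows "\<forall>\<^sub>F m in sequentially. opin m \<omega> (t * 2 ^ m) x = \<eta> (real t) x"
proof -
  obtain L R where LR: "L < x" "x < R" "\<forall>\<^sub>F m in sequentially. separated m \<omega> L R t"
    using good_block[OF g] .
  from LR(3) show ?thesis
  proof eventually_elim
    case (elim m)
    show ?case using path_agree[OF p g elim, of "t * 2 ^ m" x] LR by simp
  qed
qed

text \<open>Carries constancy at grid times over to all real times between them; the final fixation
  statement needs it.\<close>

lemma path_const_of_opin_const:
  assumes p: "is_deffuant_path F \<theta> \<omega> \<eta>" and g: "good F \<omega>" and s: "separated m \<omega> L R T"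
    and x: "x \<in> {L..R}" and c: "\<And>k. s' * 2 ^ m \<le> k \<Longrightarrow> k \<le> T * 2 ^ m \<Longrightarrow> opin m \<omega> k x = u"
    and r: "real s' < r" "r \<le> real T"
  shows "\<eta> r x = u"
proof -
  obtain k where k: "s' * 2 ^ m \<le> k" "k < T * 2 ^ m" "real k / 2 ^ m < r" "r \<le> real (Suc k) / 2 ^ m"
    using obtain_step[OF r] .
  have ag: "\<forall>x\<in>{L..R}. \<eta> (real k / 2 ^ m) x = opin m \<omega> k x"
    using path_agree[OF p g s] k by simp
  note st = path_step[OF p g s k(2) ag]
  have u: "opin m \<omega> k x = u" "opin m \<omega> (Suc k) x = u" using c[of k] c[of "Suc k"] k by auto
  show ?thesis
  proof (cases "rings m \<omega> k x")
    case True
    then obtain n where "rung m \<omega> k x n" unfolding rings_def by blast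
    then show ?thesis using st(2,3)[OF x, of n r] k u by (cases "r < arrival \<omega> x n") auto
  next
    case False
    then show ?thesis using st(1)[OF x False] k u by simp
  qed
qed

end

section \<open>Measurability\<close>

lemma distr_pair_snd:
  assumes "prob_space M" "prob_space N" shows "distr (M \<Otimes>\<^sub>M N) N snd = N"
proof (rule measure_eqI)
  interpret M: prob_space M by fact
  interpret N: prob_space N by fact
  fix A assume "A \<in> sets (distr (M \<Otimes>\<^sub>M N) N snd)"
  then have A: "A \<in> sets N" by simp
  have "snd -` A \<inter> space (M \<Otimes>\<^sub>M N) = space M \<times> A"
    using sets.sets_into_space[OF A] by (auto simp: space_pair_measure)
  then show "emeasure (distr (M \<Otimes>\<^sub>M N) N snd) A = emeasure N A"
    using A by (simp add: emeasure_distr N.emeasure_pair_measure_Times M.emeasure_space_1)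
qed simp

abbreviation label_law :: "nat \<Rightarrow> (int \<times> (nat \<Rightarrow> nat)) measure" where
  "label_law F \<equiv> nbr_law \<Otimes>\<^sub>M perm_law F"

lemma prob_space_label_law: "prob_space (label_law F)"
  unfolding nbr_law_def perm_law_def by (intro prob_space_pair prob_space_measure_pmf)

lemma label_direction:
  assumes "d \<in> {-1, 1}"
  shows "{d} \<times> UNIV \<in> sets (label_law F)" "measure (label_law F) ({d} \<times> UNIV) > 0"
proof -
  show "{d} \<times> UNIV \<in> sets (label_law F)"
    unfolding nbr_law_def perm_law_def by (intro pair_measureI) auto
  interpret N: prob_space "perm_law F" unfolding perm_law_def by (rule prob_space_measure_pmf)
  have "emeasure (label_law F) ({d} \<times> UNIV) = emeasure nbr_law {d} * emeasure (perm_law F) UNIV"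
    by (rule N.emeasure_pair_measure_Times) (auto simp: nbr_law_def perm_law_def)
  also have "emeasure (perm_law F) UNIV = 1" using N.emeasure_space_1 by (simp add: perm_law_def)
  also have "emeasure nbr_law {d} = ennreal (1/2)"
    using assms unfolding nbr_law_def by (auto simp: emeasure_pmf_single)
  finally have "emeasure (label_law F) ({d} \<times> UNIV) = ennreal (1/2)" by simp
  then show "measure (label_law F) ({d} \<times> UNIV) > 0"
    by (simp add: measure_eq_emeasure_eq_ennreal[of "1/2"])
qed

interpretation label: renewal "label_law F" for F
  by (intro renewal.intro prob_space_label_law renewal_axioms.intro) (simp add: nbr_law_def perm_law_def space_pair_measure)

lemma mark_seq_law: "(\<Pi>\<^sub>M n\<in>(UNIV::nat set). mark_law F) = label.S F"
  by (simp add: mark_law_def)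

lemma site_law_eq: "site_law F = init_law F \<Otimes>\<^sub>M label.S F"
  by (simp add: site_law_def mark_seq_law)

lemma prob_space_init_law: "prob_space (init_law F)"
  unfolding init_law_def by (rule prob_space_measure_pmf)

lemma prob_space_site_law: "prob_space (site_law F)"
  unfolding site_law_eq by (intro prob_space_pair prob_space_init_law) (rule label.seq.P.prob_space_axioms)

interpretation site: iid_line "site_law F" for F
  by (intro iid_line.intro prob_space_site_law iid_line_axioms.intro)
     (simp add: site_law_eq space_pair_measure init_law_def)

lemma deffuant_space_eq: "deffuant_space F = site.P F"
  by (simp add: deffuant_space_def)

lemma measurable_init_op [measurable]: "(\<lambda>\<omega>. init_op \<omega> x) \<in> site.P F \<rightarrow>\<^sub>M init_law F"
  unfolding init_op_def site_law_eq by measurable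

lemma measurable_marks: "(\<lambda>\<omega>. snd (\<omega> x)) \<in> site.P F \<rightarrow>\<^sub>M label.S F"
  unfolding site_law_eq by measurable

lemma measurable_arrival [measurable]: "(\<lambda>\<omega>. arrival \<omega> x n) \<in> borel_measurable (site.P F)"
  unfolding arrival_eq_ringing by (rule measurable_compose[OF measurable_marks label.measurable_ringing])

lemma measurable_mark_of: "(\<lambda>\<omega>. mark_of \<omega> x n) \<in> site.P F \<rightarrow>\<^sub>M exp_law \<Otimes>\<^sub>M label_law F"
  unfolding mark_of_def by (rule measurable_compose[OF measurable_marks]) measurable

lemma measurable_nbr [measurable]: "(\<lambda>\<omega>. nbr \<omega> x n) \<in> site.P F \<rightarrow>\<^sub>M count_space UNIV"
proof -
  have "(\<lambda>\<omega>. fst (snd (mark_of \<omega> x n))) \<in> site.P F \<rightarrow>\<^sub>M nbr_law"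
    by (rule measurable_compose[OF measurable_mark_of]) measurable
  then have "(\<lambda>\<omega>. fst (snd (mark_of \<omega> x n))) \<in> site.P F \<rightarrow>\<^sub>M count_space UNIV"
    by (simp add: nbr_law_def)
  then show ?thesis unfolding nbr_def by measurable
qed

lemma measurable_perm_of: "(\<lambda>\<omega>. perm_of \<omega> x n) \<in> site.P F \<rightarrow>\<^sub>M count_space UNIV"
proof -
  have "(\<lambda>\<omega>. snd (snd (mark_of \<omega> x n))) \<in> site.P F \<rightarrow>\<^sub>M perm_law F"
    by (rule measurable_compose[OF measurable_mark_of]) measurable
  then show ?thesis by (simp add: perm_law_def perm_of_def)
qed

lemma measurable_rung [measurable]: "Measurable.pred (site.P F) (\<lambda>\<omega>. rung m \<omega> k x n)"
  unfolding rung_def by measurable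

lemma measurable_source [measurable]: "(\<lambda>\<omega>. source m \<omega> k x) \<in> site.P F \<rightarrow>\<^sub>M count_space UNIV"
proof -
  have [measurable]: "(\<lambda>\<omega>. ring_index m \<omega> k x) \<in> site.P F \<rightarrow>\<^sub>M count_space UNIV"
    unfolding ring_index_def by measurable
  have [measurable]: "(\<lambda>\<omega>. nbr \<omega> x (ring_index m \<omega> k x)) \<in> site.P F \<rightarrow>\<^sub>M count_space UNIV"
    by (rule measurable_compose_countable[of "\<lambda>n \<omega>. nbr \<omega> x n"]) measurable
  show ?thesis unfolding source_def rings_def by measurable
qed

lemma measurable_ring_perm: "(\<lambda>\<omega>. perm_of \<omega> x (ring_index m \<omega> k x)) \<in> site.P F \<rightarrow>\<^sub>M count_space UNIV"
proof -
  have [measurable]: "(\<lambda>\<omega>. ring_index m \<omega> k x) \<in> site.P F \<rightarrow>\<^sub>M count_space UNIV"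
    unfolding ring_index_def by measurable
  show ?thesis
    by (rule measurable_compose_countable[of "\<lambda>n \<omega>. perm_of \<omega> x n", OF measurable_perm_of]) measurable
qed

context deffuant
begin

text \<open>The random source and the two opinions take countably many values and can be fixed one
  after the other; the random permutation lives on a discrete sigma-algebra.\<close>

lemma measurable_opin [measurable]: "(\<lambda>\<omega>. opin m \<omega> k x) \<in> site.P F \<rightarrow>\<^sub>M count_space (Pow {..<F})"
proof (induction k arbitrary: x)
  case 0
  have "(\<lambda>u. u \<inter> {..<F}) \<in> init_law F \<rightarrow>\<^sub>M count_space (Pow {..<F})"
    by (auto simp: init_law_def)
  then show ?case unfolding opin.simps by (rule measurable_compose[OF measurable_init_op])
next
  case (Suc k)
  have c: "countable (Pow {..<F})" by (intro countable_finite) simp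
  have s: "(\<lambda>\<omega>. deffuant_step F \<theta> (perm_of \<omega> x (ring_index m \<omega> k x)) u w \<inter> {..<F}) \<in> site.P F \<rightarrow>\<^sub>M count_space (Pow {..<F})" for u w
    by (rule measurable_compose[OF measurable_ring_perm]) auto
  have src: "(\<lambda>\<omega>. opin m \<omega> k (source m \<omega> k x)) \<in> site.P F \<rightarrow>\<^sub>M count_space (Pow {..<F})"
    by (rule measurable_compose_countable[of "\<lambda>y \<omega>. opin m \<omega> k y"]) (rule Suc, measurable)
  have "(\<lambda>\<omega>. deffuant_step F \<theta> (perm_of \<omega> x (ring_index m \<omega> k x)) u (opin m \<omega> k (source m \<omega> k x)) \<inter> {..<F})
      \<in> site.P F \<rightarrow>\<^sub>M count_space (Pow {..<F})" for u
    by (rule measurable_compose_countable'[of "Pow {..<F}" "\<lambda>w \<omega>. deffuant_step F \<theta> (perm_of \<omega> x (ring_index m \<omega> k x)) u w \<inter> {..<F}", OF s src c])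
  from measurable_compose_countable'[of "Pow {..<F}" "\<lambda>u \<omega>. deffuant_step F \<theta> (perm_of \<omega> x (ring_index m \<omega> k x)) u (opin m \<omega> k (source m \<omega> k x)) \<inter> {..<F}", OF this Suc c]
  show ?case by simp
qed

lemma measurable_opin2:
  assumes "\<And>u w. f u w \<in> space N"
  shows "(\<lambda>\<omega>. f (opin m \<omega> k x) (opin m' \<omega> k' x')) \<in> site.P F \<rightarrow>\<^sub>M N"
proof -
  have c: "countable (Pow {..<F})" by (intro countable_finite) simp
  have "(\<lambda>\<omega>. f u (opin m' \<omega> k' x')) \<in> site.P F \<rightarrow>\<^sub>M N" for u
    by (rule measurable_compose[OF measurable_opin]) (use assms in auto)
  from measurable_compose_countable'[of "Pow {..<F}" "\<lambda>u \<omega>. f u (opin m' \<omega> k' x')", OF this measurable_opin c]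
  show ?thesis .
qed

lemma measurable_gap [measurable]: "(\<lambda>\<omega>. gap m \<omega> k e) \<in> site.P F \<rightarrow>\<^sub>M count_space UNIV"
  unfolding gap_def by (rule measurable_opin2) simp

lemma measurable_opin_eq [measurable]:
  "Measurable.pred (site.P F) (\<lambda>\<omega>. opin m \<omega> k x = opin m' \<omega> k' x')"
  "Measurable.pred (site.P F) (\<lambda>\<omega>. opin m \<omega> k x = u)"
  "Measurable.pred (site.P F) (\<lambda>\<omega>. i \<in> opin m \<omega> k x)"
  using measurable_opin2[of "\<lambda>u w. u = w" "count_space UNIV"] measurable_opin2[of "\<lambda>w _. w = u" "count_space UNIV"]
    measurable_opin2[of "\<lambda>w _. i \<in> w" "count_space UNIV"] by auto

lemma measurable_receives [measurable]: "Measurable.pred (site.P F) (\<lambda>\<omega>. receives Q m \<omega> k e)"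
  unfolding receives_def by measurable

lemma measurable_window_receives [measurable]: "Measurable.pred (site.P F) (\<lambda>\<omega>. window_receives Q m \<omega> s t e)"
  unfolding window_receives_def by measurable

lemma measurable_hit_level [measurable]: "(\<lambda>\<omega>. hit_level m t \<omega>) \<in> site.P F \<rightarrow>\<^sub>M count_space UNIV"
proof -
  have [measurable]: "Measurable.pred (site.P F) (\<lambda>\<omega>. hit m \<omega> k)" for k
    unfolding hit_def by measurable
  have [measurable]: "(\<lambda>\<omega>. LEAST i. i \<in> symdiff (opin m \<omega> (Suc k) 0) (opin m \<omega> k 0) \<union> symdiff (opin m \<omega> (Suc k) 1) (opin m \<omega> k 1))
     \<in> site.P F \<rightarrow>\<^sub>M count_space UNIV" for k
    unfolding Un_iff in_symdiff by measurable
  have [measurable]: "(\<lambda>\<omega>. LEAST k. hit m \<omega> k) \<in> site.P F \<rightarrow>\<^sub>M count_space UNIV" by measurable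
  have [measurable]: "(\<lambda>\<omega>. let k = LEAST k. hit m \<omega> k in
       LEAST i. i \<in> symdiff (opin m \<omega> (Suc k) 0) (opin m \<omega> k 0) \<union> symdiff (opin m \<omega> (Suc k) 1) (opin m \<omega> k 1)) \<in> site.P F \<rightarrow>\<^sub>M count_space UNIV"
    unfolding Let_def
    by (rule measurable_compose_countable[of "\<lambda>k \<omega>. LEAST i. i \<in> symdiff (opin m \<omega> (Suc k) 0) (opin m \<omega> k 0) \<union> symdiff (opin m \<omega> (Suc k) 1) (opin m \<omega> k 1)"]) measurable
  show ?thesis unfolding hit_level_def by measurable
qed

end

lemma pred_eventually_sequentially [measurable]:
  "(\<And>n. Measurable.pred M (\<lambda>x. Q n x)) \<Longrightarrow> Measurable.pred M (\<lambda>x. \<forall>\<^sub>F n in sequentially. Q n x)"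
  unfolding eventually_sequentially by measurable

lemma measurable_recolor: "recolor f \<in> site.P F \<rightarrow>\<^sub>M site.P F"
proof -
  have mx: "(\<lambda>u. symdiff u B) \<in> init_law F \<rightarrow>\<^sub>M init_law F" for B by (simp add: init_law_def)
  have "(\<lambda>z. (symdiff (fst z) B, snd z)) \<in> site_law F \<rightarrow>\<^sub>M site_law F" for B
    unfolding site_law_eq by (rule measurable_Pair[OF measurable_compose[OF measurable_fst mx] measurable_snd])
  then show ?thesis
    unfolding recolor_def by (intro measurable_PiM_single') (auto intro: measurable_compose[rotated])
qed

text \<open>Adding a fixed set of issues permutes the opinions and so preserves the uniform law, at
  each site separately.\<close>

lemma distr_recolor:
  assumes f: "\<And>x. f x \<subseteq> {..<F}"
  shows "distr (site.P F) (site.P F) (recolor f) = site.P F"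
proof -
  have *: "distr (site_law F) (site_law F) (\<lambda>(u, s). (symdiff u D, s)) = site_law F"
    and m: "(\<lambda>(u, s). (symdiff u D, s)) \<in> site_law F \<rightarrow>\<^sub>M site_law F" if D: "D \<subseteq> {..<F}" for D
  proof -
    have mx: "(\<lambda>u. symdiff u D) \<in> init_law F \<rightarrow>\<^sub>M init_law F" by (simp add: init_law_def)
    show "(\<lambda>(u, s). (symdiff u D, s)) \<in> site_law F \<rightarrow>\<^sub>M site_law F"
      unfolding site_law_eq split_beta' by (rule measurable_Pair[OF measurable_compose[OF measurable_fst mx] measurable_snd])
    have "bij_betw (\<lambda>u. symdiff u D) (Pow {..<F}) (Pow {..<F})"
      by (rule bij_betw_byWitness[where f'="\<lambda>u. symdiff u D"]) (use D in \<open>auto simp: symdiff_def\<close>)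
    then have "map_pmf (\<lambda>u. symdiff u D) (pmf_of_set (Pow {..<F})) = pmf_of_set (Pow {..<F})"
      by (intro map_pmf_of_set_bij_betw) auto
    then have di: "distr (init_law F) (init_law F) (\<lambda>u. symdiff u D) = init_law F"
      unfolding init_law_def by (metis distr_cong map_pmf_rep_eq sets_measure_pmf_count_space)
    have "distr (label.S F) (label.S F) (\<lambda>s. s) = label.S F" by (rule distr_id)
    with di have "init_law F \<Otimes>\<^sub>M label.S F = distr (init_law F) (init_law F) (\<lambda>u. symdiff u D) \<Otimes>\<^sub>M distr (label.S F) (label.S F) (\<lambda>s. s)"
      by simp
    also have "\<dots> = distr (init_law F \<Otimes>\<^sub>M label.S F) (init_law F \<Otimes>\<^sub>M label.S F) (\<lambda>(u, s). (symdiff u D, s))"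
      using mx by (intro pair_measure_distr) (auto simp: distr_id intro!: prob_space_imp_sigma_finite label.seq.P.prob_space_axioms)
    finally show "distr (site_law F) (site_law F) (\<lambda>(u, s). (symdiff u D, s)) = site_law F"
      by (simp add: site_law_eq)
  qed
  have "recolor f = (\<lambda>\<omega> x. (case \<omega> x of (u, s) \<Rightarrow> (symdiff u (f x), s)))"
    by (auto simp: recolor_def fun_eq_iff split_beta')
  then show ?thesis
    using site.distr_map[of "\<lambda>x (u, s). (symdiff u (f x), s)" F, OF m[OF f] *[OF f]] by simp
qed

lemma AE_marks: "AE s in label.S F. Q s \<Longrightarrow> AE \<omega> in site.P F. Q (snd (\<omega> x))"
proof -
  assume Q: "AE s in label.S F. Q s"
  have "AE z in init_law F \<Otimes>\<^sub>M label.S F. Q (snd z)"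
    by (rule AE_distrD[OF measurable_snd])
      (simp only: Q distr_pair_snd[OF prob_space_init_law label.seq.P.prob_space_axioms])
  then show ?thesis unfolding site_law_eq[symmetric] by (intro site.line.AE_component) auto
qed

section \<open>Almost sure properties of the marks\<close>

text \<open>Ring times have no atoms: once the first gap is fixed, the induction hypothesis applies
  to the remainder at the level \<open>c - fst x\<close>.\<close>

lemma AE_ringing_neq: "AE s in label.S F. ringing s n \<noteq> c"
proof (induction n arbitrary: c)
  case 0
  have "AE p in exp_law \<Otimes>\<^sub>M label_law F. fst p \<noteq> c"
  proof (rule AE_distrD[OF measurable_fst])
    show "AE e in distr (exp_law \<Otimes>\<^sub>M label_law F) exp_law fst. e \<noteq> c"
      using AE_exp_law_neq by (simp only: prob_space.distr_pair_fst[OF prob_space_label_law])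
  qed
  then show ?case unfolding ringing_0 by (intro label.seq.AE_component) auto
next
  case (Suc n)
  interpret pair_sigma_finite "label.E F" "label.S F"
    by (intro pair_sigma_finite.intro prob_space_imp_sigma_finite label.E.P.prob_space_axioms label.seq.P.prob_space_axioms)
  have [measurable]: "(\<lambda>(x, s). case_nat x s) \<in> label.E F \<Otimes>\<^sub>M label.S F \<rightarrow>\<^sub>M label.S F"
    by (rule label.measurable_case_nat_pair)
  have "AE z in label.E F \<Otimes>\<^sub>M label.S F. (\<lambda>(x, s). fst x + ringing s n \<noteq> c) z"
  proof (rule AE_pair_measure)
    show "AE x in label.E F. AE s in label.S F. (\<lambda>(x, s). fst x + ringing s n \<noteq> c) (x, s)"
    proof (rule AE_I2)
      fix x show "AE s in label.S F. (\<lambda>(x, s). fst x + ringing s n \<noteq> c) (x, s)"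
        using Suc[of "c - fst x"] by eventually_elim auto
    qed
  qed measurable
  then have "AE z in label.E F \<Otimes>\<^sub>M label.S F. ringing ((\<lambda>(x, s). case_nat x s) z) (Suc n) \<noteq> c"
    by eventually_elim (auto simp: ringing_case_nat)
  then have "AE s in distr (label.E F \<Otimes>\<^sub>M label.S F) (label.S F) (\<lambda>(x, s). case_nat x s). ringing s (Suc n) \<noteq> c"
    by (subst AE_distr_iff[OF label.measurable_case_nat_pair]) measurable
  then show ?case by (simp only: label.seq.PiM_iter)
qed

text \<open>Split off the coordinate \<open>x\<close>: once its ring time is fixed, the ring time of
  \<open>y\<close> avoids that value almost surely.\<close>

lemma AE_arrival_neq:
  assumes "x \<noteq> y"
  shows "AE \<omega> in site.P F. arrival \<omega> x n \<noteq> arrival \<omega> y l"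
proof -
  let ?R = "\<Pi>\<^sub>M i\<in>UNIV - {x}. site_law F"
  have pR: "prob_space ?R" by (intro prob_space_PiM prob_space_site_law)
  interpret pair_sigma_finite "site_law F" ?R
    by (intro pair_sigma_finite.intro prob_space_imp_sigma_finite prob_space_site_law pR)
  have ins: "insert x (UNIV - {x}) = UNIV" by auto
  have d: "distr (site_law F \<Otimes>\<^sub>M ?R) (site.P F) (\<lambda>(a, X). X(x := a)) = site.P F"
    using distr_pair_PiM_eq_PiM[of "UNIV - {x}" "\<lambda>_. site_law F" x] prob_space_site_law unfolding ins by blast
  have m: "(\<lambda>(a, X). X(x := a)) \<in> site_law F \<Otimes>\<^sub>M ?R \<rightarrow>\<^sub>M site.P F"
  proof (rule measurable_PiM_single')
    fix i show "(\<lambda>z. (case z of (a, X) \<Rightarrow> X(x := a)) i) \<in> site_law F \<Otimes>\<^sub>M ?R \<rightarrow>\<^sub>M site_law F"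
      by (cases "i = x") (auto simp: split_beta')
  qed simp
  have site: "AE a in site_law F. ringing (snd a) n \<noteq> c" for n c
    unfolding site_law_eq
    by (rule AE_distrD[OF measurable_snd])
       (simp only: AE_ringing_neq distr_pair_snd[OF prob_space_init_law label.seq.P.prob_space_axioms])
  have "AE z in site_law F \<Otimes>\<^sub>M ?R. arrival ((\<lambda>(a, X). X(x := a)) z) x n \<noteq> arrival ((\<lambda>(a, X). X(x := a)) z) y l"
  proof (rule AE_pair_measure)
    have [measurable]: "(\<lambda>z. (\<lambda>(a, X). X(x := a)) z) \<in> site_law F \<Otimes>\<^sub>M ?R \<rightarrow>\<^sub>M site.P F" using m by simp
    note [measurable] = measurable_compose[OF m measurable_arrival]
    show "{z \<in> space (site_law F \<Otimes>\<^sub>M ?R). arrival ((\<lambda>(a, X). X(x := a)) z) x n \<noteq> arrival ((\<lambda>(a, X). X(x := a)) z) y l}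
       \<in> sets (site_law F \<Otimes>\<^sub>M ?R)" by measurable
    show "AE a in site_law F. AE X in ?R. arrival ((\<lambda>(a, X). X(x := a)) (a, X)) x n \<noteq> arrival ((\<lambda>(a, X). X(x := a)) (a, X)) y l"
    proof (rule AE_I2)
      fix a :: site
      have "AE X in ?R. ringing (snd (X y)) l \<noteq> ringing (snd a) n"
        using assms by (intro AE_PiM_component prob_space_site_law site) auto
      then show "AE X in ?R. arrival ((\<lambda>(a, X). X(x := a)) (a, X)) x n \<noteq> arrival ((\<lambda>(a, X). X(x := a)) (a, X)) y l"
        by (rule eventually_mono) (use assms in \<open>auto simp: arrival_eq_ringing\<close>)
    qed
  qed
  then have "AE \<omega> in distr (site_law F \<Otimes>\<^sub>M ?R) (site.P F) (\<lambda>(a, X). X(x := a)). arrival \<omega> x n \<noteq> arrival \<omega> y l"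
    using borel_measurable_neq[OF measurable_arrival[of x n F] measurable_arrival[of y l F]]
    by (subst AE_distr_iff[OF m]) simp_all
  then show ?thesis by (simp only: d)
qed

lemma prob_arrival_0_greater:
  assumes "0 \<le> t" shows "site.line.prob F {\<omega>. t < arrival \<omega> x 0} > 0"
proof -
  have U: "UNIV \<in> sets (label.S F)" using sets.top[of "label.S F"] by simp
  have "label.seq.prob F {s. t < ringing s 0} > 0"
    using label.emeasure_in_gap_0[OF U assms] label.seq.P.emeasure_space_1
    by (simp add: label.in_gap_def label.seq.P.emeasure_eq_measure)
  also have "label.seq.prob F {s. t < ringing s 0} = measure (site_law F) {a. t < ringing (snd a) 0}"
  proof -
    have "{s. t < ringing s 0} \<in> sets (label.S F)"
      using label.measurable_ringing[of 0 F] by (simp add: borel_measurable_iff_greater)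
    then have "measure (distr (init_law F \<Otimes>\<^sub>M label.S F) (label.S F) snd) {s. t < ringing s 0} = measure (site_law F) (snd -` {s. t < ringing s 0} \<inter> space (site_law F))"
      unfolding site_law_eq by (intro measure_distr) auto
    then show ?thesis
      unfolding distr_pair_snd[OF prob_space_init_law label.seq.P.prob_space_axioms] by (simp add: vimage_def)
  qed
  also have "\<dots> = site.line.prob F {\<omega>. t < arrival \<omega> x 0}"
  proof -
    have "(\<lambda>a. ringing (snd a) 0) \<in> borel_measurable (site_law F)"
      unfolding site_law_eq by measurable
    then have "{a. t < ringing (snd a) 0} \<in> sets (site_law F)"
      by (simp add: borel_measurable_iff_greater)
    then have "measure (distr (site.P F) (site_law F) (\<lambda>\<omega>. \<omega> x)) {a. t < ringing (snd a) 0} = site.line.prob F ((\<lambda>\<omega>. \<omega> x) -` {a. t < ringing (snd a) 0} \<inter> space (site.P F))"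
      by (intro measure_distr) auto
    then show ?thesis
      unfolding site.line.PiM_component[OF UNIV_I] by (simp add: vimage_def arrival_eq_ringing)
  qed
  finally show ?thesis .
qed

text \<open>A given site is quiet up to \<open>T\<close> with positive probability, and ergodicity
  spreads such sites in both directions.\<close>

lemma AE_quiet_sites:
  "AE \<omega> in site.P F. \<forall>(T::nat) z. (\<exists>L<z. T < arrival \<omega> L 0) \<and> (\<exists>R>z. T < arrival \<omega> R 0)"
proof (subst AE_all_countable, intro allI)
  fix T :: nat
  have "AE \<omega> in site.P F. \<forall>x. (\<exists>z\<ge>x. T < arrival (translate z \<omega>) 0 0) \<and> (\<exists>z\<le>x. T < arrival (translate z \<omega>) 0 0)"
  proof (rule site.AE_infinitely_often_translate)
    show "Measurable.pred (site.P F) (\<lambda>\<omega>. T < arrival \<omega> 0 0)" by measurable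
  qed (rule prob_arrival_0_greater, simp)
  then show "AE \<omega> in site.P F. \<forall>z. (\<exists>L<z. T < arrival \<omega> L 0) \<and> (\<exists>R>z. T < arrival \<omega> R 0)"
  proof eventually_elim
    case (elim \<omega>)
    show ?case
    proof (intro allI conjI)
      fix z :: int
      show "\<exists>L<z. T < arrival \<omega> L 0" using elim[rule_format, of "z - 1"] by (auto simp: arrival_translate)
      show "\<exists>R>z. T < arrival \<omega> R 0" using elim[rule_format, of "z + 1"] by (force simp: arrival_translate)
    qed
  qed
qed

lemma AE_valid_marks: "AE \<omega> in site.P F. valid_marks F \<omega>"
proof -
  have mark: "AE p in exp_law \<Otimes>\<^sub>M label_law F. 0 < fst p \<and> fst (snd p) \<in> {-1, 1} \<and> snd (snd p) permutes {..<F}"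
  proof -
    have 1: "AE p in exp_law \<Otimes>\<^sub>M label_law F. 0 < fst p"
      by (rule AE_distrD[OF measurable_fst])
         (simp only: prob_space.distr_pair_fst[OF prob_space_label_law] AE_exp_law_pos)
    have "AE q in label_law F. fst q \<in> {-1, 1}"
    proof (rule AE_distrD[OF measurable_fst])
      have "AE d in nbr_law. d \<in> {-1, 1}" unfolding nbr_law_def by (simp add: AE_measure_pmf_iff)
      then show "AE d in distr (label_law F) nbr_law fst. d \<in> {-1, 1}"
        by (simp only: prob_space.distr_pair_fst prob_space_measure_pmf perm_law_def)
    qed
    moreover have "AE q in label_law F. snd q permutes {..<F}"
    proof (rule AE_distrD[OF measurable_snd])
      have "finite {p. p permutes {..<F}}" "{p. p permutes {..<F}} \<noteq> {}"
        using permutes_id by (blast intro: finite_permutations)+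
      then have "AE p in perm_law F. p permutes {..<F}"
        unfolding perm_law_def by (subst AE_measure_pmf_iff, subst set_pmf_of_set) auto
      then show "AE p in distr (label_law F) (perm_law F) snd. p permutes {..<F}"
        by (simp only: distr_pair_snd prob_space_measure_pmf perm_law_def nbr_law_def)
    qed
    ultimately have "AE q in label_law F. fst q \<in> {-1, 1} \<and> snd q permutes {..<F}" by eventually_elim simp
    then have "AE p in exp_law \<Otimes>\<^sub>M label_law F. fst (snd p) \<in> {-1, 1} \<and> snd (snd p) permutes {..<F}"
      by (intro AE_distrD[OF measurable_snd]) (simp only: distr_pair_snd[OF prob_space_exp_law prob_space_label_law])
    with 1 show ?thesis by eventually_elim simp
  qed
  have "AE \<omega> in site.P F. 0 < fst (snd (\<omega> x) n) \<and> fst (snd (snd (\<omega> x) n)) \<in> {-1, 1} \<and> snd (snd (snd (\<omega> x) n)) permutes {..<F}" for x n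
    by (rule AE_marks, rule label.seq.AE_component[OF UNIV_I mark])
  moreover have "AE \<omega> in site.P F. init_op \<omega> x \<subseteq> {..<F}" for x
  proof -
    have "AE u in init_law F. u \<subseteq> {..<F}"
      unfolding init_law_def by (subst AE_measure_pmf_iff, subst set_pmf_of_set) auto
    then have "AE z in site_law F. fst z \<subseteq> {..<F}"
      unfolding site_law_eq
      by (intro AE_distrD[OF measurable_fst]) (simp only: prob_space.distr_pair_fst[OF label.seq.P.prob_space_axioms])
    then show ?thesis unfolding init_op_def by (rule site.line.AE_component[OF UNIV_I])
  qed
  ultimately show ?thesis
    unfolding valid_marks_def mark_of_def perm_of_def by (simp only: AE_conj_iff AE_all_countable simp_thms)
qed

lemma AE_good: "AE \<omega> in site.P F. good F \<omega>"
proof -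
  have "AE \<omega> in site.P F. filterlim (arrival \<omega> x) at_top sequentially" for x
    using AE_marks[OF label.AE_ringing_at_top] by eventually_elim (simp add: arrival_eq_ringing[abs_def])
  moreover have "AE \<omega> in site.P F. x \<noteq> y \<longrightarrow> arrival \<omega> x n \<noteq> arrival \<omega> y l" for x y n l
    by (cases "x = y") (simp_all add: AE_arrival_neq)
  ultimately show ?thesis
    unfolding good_def using AE_valid_marks AE_quiet_sites by (simp only: AE_conj_iff AE_all_countable simp_thms)
qed

section \<open>Potentials\<close>

text \<open>If the sums of a stationary observable over blocks between quiet sites are nonnegative, then so is its mean:
  cut a long interval at its first and last quiet sites; the two remainders are negligible.\<close>

lemma (in iid_line) expectation_nonneg_of_blocks:
  fixes f :: "(int \<Rightarrow> 'a) \<Rightarrow> real"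
  assumes f[measurable]: "f \<in> borel_measurable P" and B: "\<And>\<omega>. \<bar>f \<omega>\<bar> \<le> B"
    and q[measurable]: "Measurable.pred P q"
    and ex: "AE \<omega> in P. \<forall>z. (\<exists>L<z. q (translate L \<omega>)) \<and> (\<exists>R>z. q (translate R \<omega>))"
    and blk: "AE \<omega> in P. \<forall>L R. L < R \<longrightarrow> q (translate L \<omega>) \<longrightarrow> q (translate R \<omega>) \<longrightarrow> 0 \<le> (\<Sum>e\<in>{L..<R}. f (translate e \<omega>))"
  shows "0 \<le> line.expectation f"
proof -
  \<comment> \<open>Distances from the origin to the first quiet site on its right and on its left,
    the origin included.\<close>
  define a where "a = (\<lambda>\<omega>. LEAST n::nat. q (translate (int n) \<omega>))"
  define b where "b = (\<lambda>\<omega>. LEAST n::nat. q (translate (- int n) \<omega>))"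
  have [measurable]: "Measurable.pred P (\<lambda>\<omega>. q (translate z \<omega>))" for z by measurable
  have [measurable]: "a \<in> P \<rightarrow>\<^sub>M count_space UNIV" "b \<in> P \<rightarrow>\<^sub>M count_space UNIV"
    unfolding a_def b_def by measurable
  have fint: "integrable P f"
    using B by (intro line.integrable_const_bound[where B=B]) auto
  have B0: "0 \<le> B" using B[of undefined] by linarith
  have tr: "line.expectation (\<lambda>\<omega>. g (translate z \<omega>)) = line.expectation g" if "g \<in> borel_measurable P" for g :: "_ \<Rightarrow> real" and z
    using integral_distr[OF measurable_translate that, of z] by (simp add: distr_translate)
  \<comment> \<open>On \<open>[0, N)\<close> the part between the first and the last quiet site is
    nonnegative, and the rest costs at most \<open>B\<close> per edge. Truncating the distances at
    \<open>N\<close> makes them integrable without a moment bound.\<close>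
  have key: "- (B * line.expectation (\<lambda>\<omega>. min (real N) (a \<omega>))) - B * line.expectation (\<lambda>\<omega>. min (real N) (b \<omega>)) \<le> N * line.expectation f" for N :: nat
  proof -
    have "N * line.expectation f = (\<Sum>e\<in>{0..<int N}. line.expectation (\<lambda>\<omega>. f (translate e \<omega>)))"
      by (simp add: tr)
    also have "\<dots> = line.expectation (\<lambda>\<omega>. \<Sum>e\<in>{0..<int N}. f (translate e \<omega>))"
    proof (rule Bochner_Integration.integral_sum[symmetric])
      fix e show "integrable P (\<lambda>\<omega>. f (translate e \<omega>))"
        using B by (intro line.integrable_const_bound[where B=B]) auto
    qed
    also have "\<dots> \<ge> line.expectation (\<lambda>\<omega>. - (B * min (real N) (a \<omega>)) - B * min (real N) (b (translate N \<omega>)))"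
    proof (rule integral_mono_AE)
      show "integrable P (\<lambda>\<omega>. - (B * min (real N) (a \<omega>)) - B * min (real N) (b (translate N \<omega>)))"
        by (intro Bochner_Integration.integrable_diff integrable_minus integrable_mult_right line.integrable_const_bound[where B=N]) auto
      show "integrable P (\<lambda>\<omega>. \<Sum>e\<in>{0..<int N}. f (translate e \<omega>))"
      proof (rule Bochner_Integration.integrable_sum)
        fix e show "integrable P (\<lambda>\<omega>. f (translate e \<omega>))"
          using B by (intro line.integrable_const_bound[where B=B]) auto
      qed
      show "AE \<omega> in P. - (B * min (real N) (a \<omega>)) - B * min (real N) (b (translate N \<omega>)) \<le> (\<Sum>e\<in>{0..<int N}. f (translate e \<omega>))"
        using ex blk
      proof eventually_elim
        case (elim \<omega>)
        let ?S = "\<lambda>A. \<Sum>e\<in>A. f (translate e \<omega>)"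
        have lo: "- (B * real (card A)) \<le> ?S A" for A
        proof -
          have "\<bar>?S A\<bar> \<le> (\<Sum>e\<in>A. \<bar>f (translate e \<omega>)\<bar>)" by (rule sum_abs)
          also have "\<dots> \<le> real (card A) * B" by (rule sum_bounded_above) (rule B)
          finally show ?thesis by (simp add: mult.commute)
        qed
        obtain R where "R > 0" "q (translate R \<omega>)" using elim(1) by blast
        then have "\<exists>n::nat. q (translate (int n) \<omega>)" by (intro exI[of _ "nat R"]) simp
        from LeastI_ex[OF this] have qa: "q (translate (int (a \<omega>)) \<omega>)" by (simp add: a_def)
        obtain L where "L < int N" "q (translate L \<omega>)" using elim(1) by blast
        then have "\<exists>n::nat. q (translate (- int n) (translate N \<omega>))" by (intro exI[of _ "nat (N - L)"]) simp
        from LeastI_ex[OF this] have "q (translate (- int (b (translate N \<omega>))) (translate N \<omega>))" by (simp add: b_def)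
        then have qb: "q (translate (int N - int (b (translate N \<omega>))) \<omega>)" by simp
        let ?a = "a \<omega>" and ?b = "b (translate N \<omega>)"
        show ?case
        proof (cases "int ?a \<le> int N - int ?b")
          case True
          have "?S {0..<int N} = ?S {0..<int ?a} + ?S {int ?a..<int N - int ?b} + ?S {int N - int ?b..<int N}"
          proof -
            have "?S {x..<y} + ?S {y..<z} = ?S {x..<z}" if "x \<le> y" "y \<le> z" for x y z
              using that by (subst sum.union_disjoint[symmetric]) (auto simp: ivl_disj_un_two)
            from this[of 0 "int N - int ?b" "int N"] this[of 0 "int ?a" "int N - int ?b"] True
            show ?thesis by simp
          qed
          moreover have "0 \<le> ?S {int ?a..<int N - int ?b}"
            using elim(2) qa qb True by (cases "int ?a = int N - int ?b") auto
          moreover have "min (real N) ?a = ?a" "min (real N) ?b = ?b" using True by auto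
          ultimately show ?thesis using lo[of "{0..<int ?a}"] lo[of "{int N - int ?b..<int N}"] by simp
        next
          case False
          \<comment> \<open>No full block fits; then the two truncated distances add up to at least
            \<open>N\<close>, and the trivial bound is enough.\<close>
          then have "real N \<le> min (real N) ?a + min (real N) ?b" by auto
          from mult_left_mono[OF this B0] lo[of "{0..<int N}"] show ?thesis by (simp add: algebra_simps)
        qed
      qed
    qed
    also have "line.expectation (\<lambda>\<omega>. - (B * min (real N) (a \<omega>)) - B * min (real N) (b (translate N \<omega>)))
        = - (B * line.expectation (\<lambda>\<omega>. min (real N) (a \<omega>))) - B * line.expectation (\<lambda>\<omega>. min (real N) (b (translate N \<omega>)))"
      by (subst Bochner_Integration.integral_diff)
         (auto intro!: integrable_mult_right line.integrable_const_bound[where B=N])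
    also have "line.expectation (\<lambda>\<omega>. min (real N) (b (translate N \<omega>))) = line.expectation (\<lambda>\<omega>. min (real N) (b \<omega>))"
      by (rule tr) measurable
    finally show ?thesis by simp
  qed
  \<comment> \<open>Truncation at \<open>N\<close> makes the mean of any finite-valued variable
    \<open>o(N)\<close>, by dominated convergence.\<close>
  have lim: "(\<lambda>N. line.expectation (\<lambda>\<omega>. min (real N) (g \<omega>)) / real N) \<longlonglongrightarrow> 0"
    if [measurable]: "g \<in> P \<rightarrow>\<^sub>M count_space UNIV" for g :: "_ \<Rightarrow> nat"
  proof -
    have "(\<lambda>N. line.expectation (\<lambda>\<omega>. min (real N) (g \<omega>) / real N)) \<longlonglongrightarrow> line.expectation (\<lambda>_. 0)"
    proof (rule integral_dominated_convergence[where w="\<lambda>_. 1"])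
      show "AE \<omega> in P. (\<lambda>N. min (real N) (g \<omega>) / real N) \<longlonglongrightarrow> 0"
      proof (rule AE_I2)
        fix \<omega>
        have "(\<lambda>N. real (g \<omega>) / real N) \<longlonglongrightarrow> 0" by (rule lim_const_over_n)
        then show "(\<lambda>N. min (real N) (g \<omega>) / real N) \<longlonglongrightarrow> 0"
          by (rule tendsto_sandwich[OF _ _ tendsto_const, rotated 2]) (auto intro!: always_eventually divide_right_mono)
      qed
    qed (auto simp: divide_le_eq)
    then show ?thesis by simp
  qed
  have "(\<lambda>N. - (B * (line.expectation (\<lambda>\<omega>. min (real N) (a \<omega>)) / real N)) - B * (line.expectation (\<lambda>\<omega>. min (real N) (b \<omega>)) / real N)) \<longlonglongrightarrow> - (B * 0) - B * 0"
    by (intro tendsto_intros lim) measurable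
  moreover have "\<forall>\<^sub>F N in sequentially. - (B * (line.expectation (\<lambda>\<omega>. min (real N) (a \<omega>)) / real N)) - B * (line.expectation (\<lambda>\<omega>. min (real N) (b \<omega>)) / real N) \<le> line.expectation f"
    using eventually_gt_at_top[of 0]
  proof eventually_elim
    case (elim N)
    have "(- (B * line.expectation (\<lambda>\<omega>. min (real N) (a \<omega>))) - B * line.expectation (\<lambda>\<omega>. min (real N) (b \<omega>))) / N \<le> line.expectation f"
      using key[of N] elim by (simp add: divide_le_eq mult.commute)
    then show ?case by (simp add: diff_divide_distrib)
  qed
  ultimately show ?thesis by (intro tendsto_upperbound[of _ 0]) auto
qed

section \<open>Limits of the discretised quantities\<close>

locale deffuant_process = deffuant +
  fixes \<eta> :: "(int \<Rightarrow> site) \<Rightarrow> real \<Rightarrow> int \<Rightarrow> nat set"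
  assumes AE_path: "AE \<omega> in site.P F. is_deffuant_path F \<theta> \<omega> (\<eta> \<omega>)"
begin

abbreviation "prob \<equiv> site.line.prob F"
abbreviation "expectation \<equiv> site.line.expectation F"

definition regular :: "(int \<Rightarrow> site) \<Rightarrow> bool" where
  "regular \<omega> \<longleftrightarrow> good F \<omega> \<and> is_deffuant_path F \<theta> \<omega> (\<eta> \<omega>)"

lemma AE_regular: "AE \<omega> in site.P F. regular \<omega>"
  using AE_good AE_path unfolding regular_def by eventually_elim simp

text \<open>A stand-in for the gap of the path at time \<open>t\<close> that is measurable and
  compatible with translations on the whole space, which is not known of \<open>\<eta>\<close>.
  \<open>LEAST\<close> extracts the eventual value, and \<open>min F\<close> keeps the result
  bounded where there is none.\<close>

definition lgap :: "nat \<Rightarrow> (int \<Rightarrow> site) \<Rightarrow> int \<Rightarrow> nat" where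
  "lgap t \<omega> e = min F (LEAST j. \<forall>\<^sub>F m in sequentially. gap m \<omega> (t * 2 ^ m) e = j)"

definition lreceives :: "(nat \<Rightarrow> nat \<Rightarrow> bool) \<Rightarrow> (int \<Rightarrow> site) \<Rightarrow> nat \<Rightarrow> nat \<Rightarrow> int \<Rightarrow> bool" where
  "lreceives Q \<omega> s t e \<longleftrightarrow> (\<forall>\<^sub>F m in sequentially. window_receives Q m \<omega> s t e)"

lemma measurable_lgap [measurable]: "(\<lambda>\<omega>. lgap t \<omega> e) \<in> site.P F \<rightarrow>\<^sub>M count_space UNIV"
  unfolding lgap_def by measurable

lemma measurable_lreceives [measurable]: "Measurable.pred (site.P F) (\<lambda>\<omega>. lreceives Q \<omega> s t e)"
  unfolding lreceives_def by measurable

lemma lgap_le: "lgap t \<omega> e \<le> F"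
  by (simp add: lgap_def)

lemma lgap_translate: "lgap t (translate z \<omega>) e = lgap t \<omega> (e + z)"
  by (simp add: lgap_def gap_translate)

lemma lreceives_translate: "lreceives Q (translate z \<omega>) s t e = lreceives Q \<omega> s t (e + z)"
  by (simp add: lreceives_def window_receives_def receives_translate)

lemma eventually_gap_eq_lgap:
  assumes "regular \<omega>" shows "\<forall>\<^sub>F m in sequentially. gap m \<omega> (t * 2 ^ m) e = lgap t \<omega> e"
proof -
  let ?h = "hamming F (\<eta> \<omega> t e) (\<eta> \<omega> t (e + 1))"
  have ev: "\<forall>\<^sub>F m in sequentially. gap m \<omega> (t * 2 ^ m) e = ?h"
    using eventually_opin_eq_path[of \<omega> "\<eta> \<omega>" t e] eventually_opin_eq_path[of \<omega> "\<eta> \<omega>" t "e + 1"] assms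
    unfolding regular_def gap_def by (auto elim: eventually_elim2)
  have "(LEAST j. \<forall>\<^sub>F m in sequentially. gap m \<omega> (t * 2 ^ m) e = j) = ?h"
  proof (rule Least_equality)
    fix j assume "\<forall>\<^sub>F m in sequentially. gap m \<omega> (t * 2 ^ m) e = j"
    with ev have "\<forall>\<^sub>F m::nat in sequentially. ?h = j" by eventually_elim simp
    then show "?h \<le> j" by simp
  qed (rule ev)
  then show ?thesis using ev by (simp add: lgap_def hamming_le)
qed

lemma lreceives_iff_path: "regular \<omega> \<Longrightarrow> lreceives Q \<omega> s t e \<longleftrightarrow> path_receives Q \<omega> (\<eta> \<omega>) s t e"
proof -
  assume "regular \<omega>"
  then have "\<forall>\<^sub>F m in sequentially. window_receives Q m \<omega> s t e \<longleftrightarrow> path_receives Q \<omega> (\<eta> \<omega>) s t e"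
    unfolding regular_def by (intro eventually_window_receives_iff) auto
  then have "lreceives Q \<omega> s t e \<longleftrightarrow> (\<forall>\<^sub>F m::nat in sequentially. path_receives Q \<omega> (\<eta> \<omega>) s t e)"
    unfolding lreceives_def by (rule eventually_cong) (auto intro: eventually_cong)
  then show ?thesis by simp
qed

text \<open>On each block between quiet sites the change of the potential minus \<open>c\<close>
  times the number of selected edges is nonnegative by \<open>potential_window\<close>;
  \<open>expectation_nonneg_of_blocks\<close> turns this into an inequality of means.\<close>

lemma drift:
  fixes pot :: "nat \<Rightarrow> real"
  assumes pot: "\<And>a b b'. 1 \<le> a \<Longrightarrow> a \<le> \<theta> \<Longrightarrow> b' = b + 1 \<or> b' + 1 = b \<Longrightarrow>
      pot a + pot b + (if Q b b' then c else 0) \<le> pot (a - 1) + pot b'"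
    and c: "0 \<le> c" and st: "s \<le> t"
  shows "expectation (\<lambda>\<omega>. pot (lgap s \<omega> 0)) + c * prob {\<omega>. lreceives Q \<omega> s t 0} \<le> expectation (\<lambda>\<omega>. pot (lgap t \<omega> 0))"
proof -
  define f where "f = (\<lambda>\<omega>. pot (lgap t \<omega> 0) - pot (lgap s \<omega> 0) - c * indicator {\<omega>. lreceives Q \<omega> s t 0} \<omega>)"
  have [measurable]: "{\<omega>. lreceives Q \<omega> s t 0} \<in> sets (site.P F)"
    using measurable_lreceives[of Q s t 0] by (simp add: pred_def)
  have [measurable]: "f \<in> borel_measurable (site.P F)"
    unfolding f_def by measurable
  define M where "M = Max ((\<lambda>j. \<bar>pot j\<bar>) ` {..F})"
  have M: "\<bar>pot (lgap u \<omega> e)\<bar> \<le> M" for u \<omega> e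
    unfolding M_def using lgap_le by (intro Max_ge) auto
  have int: "integrable (site.P F) (\<lambda>\<omega>. pot (lgap u \<omega> 0))" for u
    using M by (intro site.line.integrable_const_bound[where B=M]) auto
  have "0 \<le> expectation f"
  proof (rule site.expectation_nonneg_of_blocks[where q="\<lambda>\<omega>. real t < arrival \<omega> 0 0" and B="2 * M + c"])
    show "\<bar>f \<omega>\<bar> \<le> 2 * M + c" for \<omega>
      using M[of t \<omega> 0] M[of s \<omega> 0] c unfolding f_def by (auto simp: indicator_def abs_if split: if_splits)
    show "AE \<omega> in site.P F. \<forall>z. (\<exists>L<z. real t < arrival (translate L \<omega>) 0 0) \<and> (\<exists>R>z. real t < arrival (translate R \<omega>) 0 0)"
      using AE_quiet_sites by eventually_elim (auto simp: arrival_translate)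
    show "AE \<omega> in site.P F. \<forall>L R. L < R \<longrightarrow> real t < arrival (translate L \<omega>) 0 0 \<longrightarrow> real t < arrival (translate R \<omega>) 0 0 \<longrightarrow>
        0 \<le> (\<Sum>e\<in>{L..<R}. f (translate e \<omega>))"
      using AE_regular
    proof (eventually_elim, intro allI impI)
      fix \<omega> and L R :: int
      assume r: "regular \<omega>" and "L < R" and "real t < arrival (translate L \<omega>) 0 0" "real t < arrival (translate R \<omega>) 0 0"
      then have LR: "real t < arrival \<omega> L 0" "real t < arrival \<omega> R 0" by (simp_all add: arrival_translate)
      have g: "good F \<omega>" using r by (simp add: regular_def)
      then have v: "valid_marks F \<omega>" by (simp add: good_def)
      have "\<forall>\<^sub>F m in sequentially. separated m \<omega> L R t" using g LR by (rule eventually_separated)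
      moreover have "\<forall>\<^sub>F m in sequentially. \<forall>e\<in>{L..<R}. gap m \<omega> (t * 2 ^ m) e = lgap t \<omega> e \<and> gap m \<omega> (s * 2 ^ m) e = lgap s \<omega> e \<and>
          (lreceives Q \<omega> s t e \<longrightarrow> window_receives Q m \<omega> s t e)"
        using eventually_gap_eq_lgap[OF r]
        by (intro eventually_ball_finite ballI eventually_conj) (auto simp: lreceives_def)
      ultimately have "\<forall>\<^sub>F m in sequentially. separated m \<omega> L R t \<and> (\<forall>e\<in>{L..<R}. gap m \<omega> (t * 2 ^ m) e = lgap t \<omega> e \<and> gap m \<omega> (s * 2 ^ m) e = lgap s \<omega> e \<and>
          (lreceives Q \<omega> s t e \<longrightarrow> window_receives Q m \<omega> s t e))"
        by (rule eventually_conj)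
      \<comment> \<open>One resolution \<open>m\<close> serves all the finitely many edges of the
        block.\<close>
      then obtain m where m: "separated m \<omega> L R t" and
        e: "\<And>e. e \<in> {L..<R} \<Longrightarrow> gap m \<omega> (t * 2 ^ m) e = lgap t \<omega> e \<and> gap m \<omega> (s * 2 ^ m) e = lgap s \<omega> e \<and>
          (lreceives Q \<omega> s t e \<longrightarrow> window_receives Q m \<omega> s t e)"
        using eventually_happens'[OF sequentially_bot] by blast
      have "(\<Sum>e\<in>{L..<R}. pot (gap m \<omega> (s * 2 ^ m) e)) + c * card {e\<in>{L..<R}. \<exists>k\<in>{s * 2 ^ m..<t * 2 ^ m}. receives Q m \<omega> k e}
          \<le> (\<Sum>e\<in>{L..<R}. pot (gap m \<omega> (t * 2 ^ m) e))"
        by (rule potential_window[where pot=pot and Q=Q and c=c, OF pot c v separated_isolated[OF v m]]) (use st in auto)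
      also have "(\<Sum>e\<in>{L..<R}. pot (gap m \<omega> (t * 2 ^ m) e)) = (\<Sum>e\<in>{L..<R}. pot (lgap t \<omega> e))"
        using e by (intro sum.cong) auto
      also have "(\<Sum>e\<in>{L..<R}. pot (gap m \<omega> (s * 2 ^ m) e)) = (\<Sum>e\<in>{L..<R}. pot (lgap s \<omega> e))"
        using e by (intro sum.cong) auto
      finally have 1: "(\<Sum>e\<in>{L..<R}. pot (lgap s \<omega> e)) + c * card {e\<in>{L..<R}. window_receives Q m \<omega> s t e} \<le> (\<Sum>e\<in>{L..<R}. pot (lgap t \<omega> e))"
        by (simp only: window_receives_def)
      have "card {e\<in>{L..<R}. lreceives Q \<omega> s t e} \<le> card {e\<in>{L..<R}. window_receives Q m \<omega> s t e}"
        using e by (intro card_mono finite_subset[of "{e\<in>{L..<R}. window_receives Q m \<omega> s t e}" "{L..<R}"]) auto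
      then have "c * card {e\<in>{L..<R}. lreceives Q \<omega> s t e} \<le> c * card {e\<in>{L..<R}. window_receives Q m \<omega> s t e}"
        using c by (intro mult_left_mono) auto
      moreover have "(\<Sum>e\<in>{L..<R}. indicator {\<omega>. lreceives Q \<omega> s t 0} (translate e \<omega>)) = real (card {e\<in>{L..<R}. lreceives Q \<omega> s t e})"
        by (simp add: indicator_def lreceives_translate sum.If_cases Int_def)
      ultimately show "0 \<le> (\<Sum>e\<in>{L..<R}. f (translate e \<omega>))"
        using 1 unfolding f_def by (simp add: sum_subtractf lgap_translate sum_distrib_left[symmetric])
    qed
  qed measurable
  also have "expectation f = expectation (\<lambda>\<omega>. pot (lgap t \<omega> 0)) - expectation (\<lambda>\<omega>. pot (lgap s \<omega> 0)) - c * prob {\<omega>. lreceives Q \<omega> s t 0}"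
  proof -
    have i3: "integrable (site.P F) (\<lambda>\<omega>. c * indicat_real {\<omega>. lreceives Q \<omega> s t 0} \<omega>)"
      by (intro integrable_mult_right site.line.integrable_const_bound[where B=1]) auto
    show ?thesis
      unfolding f_def Bochner_Integration.integral_diff[OF Bochner_Integration.integrable_diff[OF int int] i3]
        Bochner_Integration.integral_diff[OF int int] by simp
  qed
  finally show ?thesis by simp
qed

end

section \<open>Collisions and sweeps\<close>

context deffuant
begin

text \<open>For unit changes: a cancellation, or an arrival at an edge that already carries
  \<open>\<theta>\<close> or more disagreements.\<close>

definition collision :: "nat \<Rightarrow> nat \<Rightarrow> bool" where
  "collision b b' \<longleftrightarrow> \<not> (b' = b + 1 \<and> b < \<theta>)"

text \<open>Without a collision an arrival only raises a gap that is below \<open>\<theta>\<close>.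
  So frozen edges are inert and active ones stay active; a nonempty active edge stays nonempty
  unless it emits, and when it emits to the right the next edge takes over.\<close>

lemma no_collision_step:
  assumes v: "valid_marks F \<omega>" and iso: "isolated m \<omega> L R k" and e: "L \<le> e" "e < R"
    and nc: "\<not> receives collision m \<omega> k e"
  shows "\<theta> < gap m \<omega> k e \<Longrightarrow> opin m \<omega> (Suc k) e = opin m \<omega> k e \<and> opin m \<omega> (Suc k) (e + 1) = opin m \<omega> k (e + 1)"
    and "gap m \<omega> k e \<le> \<theta> \<Longrightarrow> gap m \<omega> (Suc k) e \<le> \<theta>"
    and "1 \<le> gap m \<omega> k e \<Longrightarrow> gap m \<omega> k e \<le> \<theta> \<Longrightarrow> source m \<omega> k e \<noteq> e + 1 \<Longrightarrow> source m \<omega> k (e + 1) \<noteq> e \<Longrightarrow> 1 \<le> gap m \<omega> (Suc k) e"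
    and "1 \<le> gap m \<omega> k e \<Longrightarrow> gap m \<omega> k e \<le> \<theta> \<Longrightarrow> source m \<omega> k (e + 1) = e \<Longrightarrow> e + 1 < R \<Longrightarrow>
      \<not> receives collision m \<omega> k (e + 1) \<Longrightarrow> 1 \<le> gap m \<omega> (Suc k) (e + 1) \<and> gap m \<omega> k (e + 1) < \<theta>"
proof -
  have eq: "opin m \<omega> (Suc k) e = opin m \<omega> k e \<Longrightarrow> opin m \<omega> (Suc k) (e + 1) = opin m \<omega> k (e + 1) \<Longrightarrow> gap m \<omega> (Suc k) e = gap m \<omega> k e"
    by (simp add: gap_def del: opin.simps)
  have ch: "gap m \<omega> k e \<le> \<theta> \<and> gap m \<omega> (Suc k) e \<le> \<theta> \<and>
      (1 \<le> gap m \<omega> (Suc k) e \<or> source m \<omega> k e = e + 1 \<or> source m \<omega> k (e + 1) = e)"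
    if ne: "opin m \<omega> (Suc k) e \<noteq> opin m \<omega> k e \<or> opin m \<omega> (Suc k) (e + 1) \<noteq> opin m \<omega> k (e + 1)"
    using v iso
  proof (cases rule: isolated_cases)
    case idle
    then show ?thesis using ne e by force
  next
    case (change x)
    have x: "x = e \<or> x = e + 1" using ne e change(5)[of e] change(5)[of "e + 1"] by force
    have l: "opin m \<omega> (Suc k) (x - 1) = opin m \<omega> k (x - 1)" and r: "opin m \<omega> (Suc k) (x + 1) = opin m \<omega> k (x + 1)"
      using change(1,2) by (auto intro!: change(5) simp del: opin.simps)
    obtain em rc where er: "source m \<omega> k x = x + 1 \<and> em = x \<and> rc = x - 1 \<or> source m \<omega> k x = x - 1 \<and> em = x - 1 \<and> rc = x"
      "1 \<le> gap m \<omega> k em" "gap m \<omega> k em \<le> \<theta>" "gap m \<omega> (Suc k) em + 1 = gap m \<omega> k em"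
      "gap m \<omega> (Suc k) rc = gap m \<omega> k rc + 1 \<or> gap m \<omega> (Suc k) rc + 1 = gap m \<omega> k rc"
      by (rule opin_change[OF v change(4) l r]) blast
    have "e = em \<or> e = rc" using x er(1) by auto
    then show ?thesis
    proof
      assume "e = em"
      then show ?thesis using er x by auto
    next
      assume "e = rc"
      then have "x = e \<and> source m \<omega> k e = e - 1 \<or> x = e + 1 \<and> source m \<omega> k (e + 1) = e + 2" using er(1) by auto
      then have "\<not> collision (gap m \<omega> k e) (gap m \<omega> (Suc k) e)"
        using nc change(4) unfolding receives_def by (auto simp del: opin.simps)
      then show ?thesis by (auto simp: collision_def)
    qed
  qed
  show "\<theta> < gap m \<omega> k e \<Longrightarrow> opin m \<omega> (Suc k) e = opin m \<omega> k e \<and> opin m \<omega> (Suc k) (e + 1) = opin m \<omega> k (e + 1)"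
    using ch by (metis not_less)
  show "gap m \<omega> k e \<le> \<theta> \<Longrightarrow> gap m \<omega> (Suc k) e \<le> \<theta>"
    using ch eq by metis
  show "1 \<le> gap m \<omega> k e \<Longrightarrow> gap m \<omega> k e \<le> \<theta> \<Longrightarrow> source m \<omega> k e \<noteq> e + 1 \<Longrightarrow> source m \<omega> k (e + 1) \<noteq> e \<Longrightarrow> 1 \<le> gap m \<omega> (Suc k) e"
    using ch eq by metis
  \<comment> \<open>Emission to the right: site \<open>e + 1\<close> copies \<open>e\<close>, and
    the disagreement passes to the edge \<open>e + 1\<close>.\<close>
  assume a: "1 \<le> gap m \<omega> k e" "gap m \<omega> k e \<le> \<theta>" "source m \<omega> k (e + 1) = e" "e + 1 < R" "\<not> receives collision m \<omega> k (e + 1)"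
  let ?p = "perm_of \<omega> (e + 1) (ring_index m \<omega> k (e + 1))" and ?u = "opin m \<omega> k (e + 1)" and ?w = "opin m \<omega> k e"
  have p: "?p permutes {..<F}" using v by (simp add: valid_marks_def)
  have H: "1 \<le> hamming F ?u ?w" "hamming F ?u ?w \<le> \<theta>" using a(1,2) by (simp_all add: gap_def hamming_commute)
  have rg: "rings m \<omega> k (e + 1)" using a(3) source_quiet by fastforce
  have "chosen ?p (disagree F ?u ?w) < F" using deffuant_step_flip(1)[OF p H] disagree_subset by blast
  then have "opin m \<omega> (Suc k) (e + 1) \<noteq> ?u"
    using deffuant_step_flip(2)[OF p H] a(3) by auto
  note ne = this
  have un: "opin m \<omega> (Suc k) y = opin m \<omega> k y" if y: "y \<in> {L..R}" "y \<noteq> e + 1" for y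
    using v iso
  proof (cases rule: isolated_cases)
    case idle then show ?thesis using y by blast
  next
    case (change x)
    have "e + 1 \<in> {L..R}" using e by auto
    then have "x = e + 1" using change(5) ne by blast
    then show ?thesis using change(5) y by blast
  qed
  have l: "opin m \<omega> (Suc k) (e + 1 - 1) = opin m \<omega> k (e + 1 - 1)" and r: "opin m \<omega> (Suc k) (e + 1 + 1) = opin m \<omega> k (e + 1 + 1)"
    using e a(4) by (auto intro!: un simp del: opin.simps)
  obtain em rc where er: "source m \<omega> k (e + 1) = e + 1 + 1 \<and> em = e + 1 \<and> rc = e + 1 - 1 \<or> source m \<omega> k (e + 1) = e + 1 - 1 \<and> em = e + 1 - 1 \<and> rc = e + 1"
    by (rule opin_change[OF v ne l r]) blast
  have "\<not> collision (gap m \<omega> k (e + 1)) (gap m \<omega> (Suc k) (e + 1))"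
    using a(3,5) ne unfolding receives_def by (auto simp del: opin.simps)
  then show "1 \<le> gap m \<omega> (Suc k) (e + 1) \<and> gap m \<omega> k (e + 1) < \<theta>"
    by (auto simp: collision_def)
qed

end

text \<open>Consecutive slots of length \<open>1 / (b - a)\<close> force the rings into
  left-to-right order. Copying the left neighbour at \<open>x\<close> moves a disagreement from edge
  \<open>x - 1\<close> to edge \<open>x\<close>, so a sweep pushes to the right. The last clause
  excludes further rings in that unit of time.\<close>

definition sweep :: "(int \<Rightarrow> site) \<Rightarrow> int \<Rightarrow> int \<Rightarrow> nat \<Rightarrow> bool" where
  "sweep \<omega> a b t \<longleftrightarrow> (\<forall>x\<in>{a<..b}. \<exists>n. real t + real_of_int (x - a - 1) / real_of_int (b - a) < arrival \<omega> x n \<and>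
     arrival \<omega> x n \<le> real t + real_of_int (x - a) / real_of_int (b - a) \<and> nbr \<omega> x n = x - 1 \<and>
     (\<forall>l. real t < arrival \<omega> x l \<longrightarrow> arrival \<omega> x l \<le> real t + 1 \<longrightarrow> l = n))"

text \<open>In a unit of time the prescribed rings have positive probability and are independent of
  everything later, so \<open>AE_infinitely_often_iterate\<close> applies with the unit time shift.
  There are countably many pairs \<open>a\<close>, \<open>b\<close>.\<close>

lemma AE_sweep: "AE \<omega> in site.P F. \<forall>a b. a < b \<longrightarrow> (\<forall>t0. \<exists>t\<ge>t0. sweep \<omega> a b t)"
proof -
  have "AE \<omega> in site.P F. a < b \<longrightarrow> (\<forall>t0. \<exists>t\<ge>t0. sweep \<omega> a b t)" for a b :: int
  proof (cases "a < b")
    case ab: True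
    \<comment> \<open>Advances the clock of a site by one unit of time and carries its initial
      opinion along.\<close>
    define T :: "site \<Rightarrow> site" where "T = (\<lambda>(u, s). (u, after_time 1 s))"
    define B :: "(int \<times> (nat \<Rightarrow> nat)) set" where "B = {-1} \<times> UNIV"
    define lo hi where "lo = (\<lambda>x. real_of_int (x - a - 1) / real_of_int (b - a))" and "hi = (\<lambda>x. real_of_int (x - a) / real_of_int (b - a))"
    define J where "J = (\<lambda>x (z :: site). rings_once (lo x) (hi x) B (snd z))"
    have B: "B \<in> sets (label_law F)" and pB: "measure (label_law F) B > 0"
      unfolding B_def by (intro label_direction; simp)+
    have lh: "0 \<le> lo x" "lo x < hi x" "hi x \<le> 1" if "x \<in> {a<..b}" for x
      using that ab unfolding lo_def hi_def by (auto simp: divide_le_eq intro!: divide_strict_right_mono)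
    have mT[measurable]: "T \<in> site_law F \<rightarrow>\<^sub>M site_law F"
      unfolding T_def site_law_eq by measurable
    have dT: "distr (site_law F) (site_law F) T = site_law F"
    proof -
      have "init_law F \<Otimes>\<^sub>M label.S F = distr (init_law F) (init_law F) (\<lambda>u. u) \<Otimes>\<^sub>M distr (label.S F) (label.S F) (after_time 1)"
        using label.distr_after_time[of 1 F] by (simp add: distr_id)
      also have "\<dots> = distr (init_law F \<Otimes>\<^sub>M label.S F) (init_law F \<Otimes>\<^sub>M label.S F) (\<lambda>(u, s). (u, after_time 1 s))"
        by (rule pair_measure_distr) (auto simp: label.distr_after_time intro!: prob_space_imp_sigma_finite label.seq.P.prob_space_axioms)
      finally show ?thesis by (simp add: site_law_eq T_def)
    qed
    have snd_prob: "measure (site_law F) {z. snd z \<in> A} = label.seq.prob F A" if "A \<in> sets (label.S F)" for A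
      using measure_distr[OF measurable_snd that, of "init_law F", unfolded distr_pair_snd[OF prob_space_init_law label.seq.P.prob_space_axioms]]
      by (simp add: site_law_eq[symmetric] vimage_def)
    have mJ: "{s. rings_once (lo x) (hi x) B s} \<in> sets (label.S F)" for x
      using label.measurable_rings_once[OF B, of "lo x" "hi x"] by (simp add: pred_def)
    have "AE \<omega> in site.P F. \<forall>t0. \<exists>t\<ge>t0. \<forall>x\<in>{a<..b}. J x ((T ^^ t) (\<omega> x))"
    proof (rule site.AE_infinitely_often_iterate[OF mT dT])
      show "Measurable.pred (site_law F) (J x)" for x
        unfolding J_def site_law_eq by (rule measurable_compose[OF measurable_snd label.measurable_rings_once[OF B]])
      show "measure (site_law F) {s. J x s} > 0" if "x \<in> {a<..b}" for x
        using label.rings_once_indep(1)[OF B lh[OF that] pB] snd_prob[OF mJ[of x]] by (simp add: J_def)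
      show "measure (site_law F) {s. J x s \<and> T s \<in> A} = measure (site_law F) {s. J x s} * measure (site_law F) A"
        if x: "x \<in> {a<..b}" and A: "A \<in> sets (site_law F)" for x A
      proof -
        let ?R = "{s. rings_once (lo x) (hi x) B s}"
        have sm: "{z. J x z} \<in> sets (site_law F)"
          using measurable_sets[OF measurable_snd[of "init_law F" "label.S F"] mJ[of x]]
          by (simp only: site_law_eq[symmetric] site.space_M J_def vimage_def Int_UNIV_right mem_Collect_eq)
        have TA: "{z. T z \<in> A} \<in> sets (site_law F)"
          using measurable_sets[OF mT A] by (simp add: vimage_def)
        have JT: "{z. J x z \<and> T z \<in> A} \<in> sets (init_law F \<Otimes>\<^sub>M label.S F)"
          using sets.Int[OF sm TA] by (simp add: Int_def site_law_eq)
        have A': "A \<in> sets (init_law F \<Otimes>\<^sub>M label.S F)" using A by (simp add: site_law_eq)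
        \<comment> \<open>Independence on each section with fixed initial opinion \<open>u\<close>;
          integrating over \<open>u\<close> gives it for the site.\<close>
        have sec: "emeasure (label.S F) (Pair u -` {z. J x z \<and> T z \<in> A}) = emeasure (label.S F) ?R * emeasure (label.S F) (Pair u -` A)" for u
        proof -
          have "Pair u -` {z. J x z \<and> T z \<in> A} = {s. rings_once (lo x) (hi x) B s \<and> after_time 1 s \<in> Pair u -` A}"
            by (auto simp: J_def T_def)
          then show ?thesis
            using label.rings_once_indep(2)[OF B lh[OF x] pB sets_Pair1[OF A'], of u]
            by (simp add: label.seq.P.emeasure_eq_measure ennreal_mult)
        qed
        have "emeasure (site_law F) {z. J x z \<and> T z \<in> A} = (\<integral>\<^sup>+u. emeasure (label.S F) ?R * emeasure (label.S F) (Pair u -` A) \<partial>init_law F)"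
          unfolding site_law_eq by (subst label.seq.emeasure_pair_measure_alt[OF JT]) (simp only: sec)
        also have "\<dots> = emeasure (label.S F) ?R * emeasure (site_law F) A"
          unfolding site_law_eq using A'
          by (subst label.seq.emeasure_pair_measure_alt[OF A']) (intro nn_integral_cmult label.seq.measurable_emeasure_Pair)
        also have "emeasure (label.S F) ?R = emeasure (site_law F) {s. J x s}"
          using snd_prob[OF mJ[of x]]
          by (simp add: label.seq.P.emeasure_eq_measure finite_measure.emeasure_eq_measure prob_space.finite_measure prob_space_site_law J_def)
        finally show ?thesis
          by (simp add: measure_def enn2real_mult)
      qed
    qed simp
    with AE_valid_marks have "AE \<omega> in site.P F. \<forall>t0. \<exists>t\<ge>t0. sweep \<omega> a b t"
    proof eventually_elim
      case (elim \<omega>)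
      show ?case
      proof
        fix t0
        obtain t where t: "t \<ge> t0" "\<forall>x\<in>{a<..b}. J x ((T ^^ t) (\<omega> x))" using elim(2) by blast
        have Tt: "(T ^^ t) z = (fst z, (after_time 1 ^^ t) (snd z))" for z
          by (induction t) (auto simp: T_def)
        have "sweep \<omega> a b t"
          unfolding sweep_def
        proof
          fix x assume x: "x \<in> {a<..b}"
          let ?s = "(after_time 1 ^^ t) (snd (\<omega> x))"
          have J: "rings_once (lo x) (hi x) B ?s" using t(2) x by (simp add: J_def Tt)
          obtain c where c: "\<And>i. ringing ?s i = arrival \<omega> x (c + i) - real t" "\<And>i. snd (?s i) = snd (mark_of \<omega> x (c + i))"
            "\<And>n. n < c \<Longrightarrow> arrival \<omega> x n \<le> real t"
            using after_time_funpow[of t "snd (\<omega> x)"] unfolding arrival_eq_ringing mark_of_def by blast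
          \<comment> \<open>The ring in \<open>(t, t + 1]\<close> is unique: marks before
            \<open>c\<close> have rung by time \<open>t\<close>, and mark \<open>Suc c\<close> rings
            after \<open>t + 1\<close>.\<close>
          have l: "l = c" if "real t < arrival \<omega> x l" "arrival \<omega> x l \<le> real t + 1" for l
          proof (rule antisym)
            show "c \<le> l" using that(1) c(3)[of l] by (meson leI not_le)
            have "real t + 1 < arrival \<omega> x (Suc c)" using J c(1)[of 1] by (simp add: rings_once_def)
            then have "arrival \<omega> x l < arrival \<omega> x (Suc c)" using that by simp
            then show "l \<le> c" using strict_mono_less[OF strict_mono_arrival[OF elim(1), of x]] by simp
          qed
          have "nbr \<omega> x c = x - 1"
            using J c(2)[of 0] by (auto simp: rings_once_def B_def nbr_def)
          moreover have "real t + lo x < arrival \<omega> x c" "arrival \<omega> x c \<le> real t + hi x"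
            using J c(1)[of 0] by (simp_all add: rings_once_def)
          ultimately show "\<exists>n. real t + real_of_int (x - a - 1) / real_of_int (b - a) < arrival \<omega> x n \<and>
             arrival \<omega> x n \<le> real t + real_of_int (x - a) / real_of_int (b - a) \<and> nbr \<omega> x n = x - 1 \<and>
             (\<forall>l. real t < arrival \<omega> x l \<longrightarrow> arrival \<omega> x l \<le> real t + 1 \<longrightarrow> l = n)"
            using l unfolding lo_def hi_def by blast
        qed
        with t(1) show "\<exists>t\<ge>t0. sweep \<omega> a b t" by blast
      qed
    qed
    then show ?thesis by simp
  qed simp
  then show ?thesis by (simp only: AE_all_countable simp_thms)
qed

section \<open>Finitely many collisions, and calm edges\<close>

context deffuant_process
begin

text \<open>The mean of \<open>- min j \<theta>\<close> stays between \<open>- \<theta>\<close> and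
  0 and rises in each unit of time by at least the collision probability. These probabilities are
  therefore summable and Borel-Cantelli applies at the edge 0; translation carries this to all
  edges.\<close>

lemma AE_finitely_many_collisions:
  "AE \<omega> in site.P F. \<forall>e. \<forall>\<^sub>F t in sequentially. \<not> lreceives collision \<omega> t (Suc t) e"
proof -
  define pot :: "nat \<Rightarrow> real" where "pot = (\<lambda>j. - real (min j \<theta>))"
  define a where "a = (\<lambda>t. expectation (\<lambda>\<omega>. pot (lgap t \<omega> 0)))"
  define p where "p = (\<lambda>t. prob {\<omega>. lreceives collision \<omega> t (Suc t) 0})"
  have meas: "{\<omega>. lreceives collision \<omega> t (Suc t) e} \<in> sets (site.P F)" for t e
    using measurable_lreceives[of collision t "Suc t" e] by (simp add: pred_def)
  have ap: "a t + p t \<le> a (Suc t)" for t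
  proof -
    have "expectation (\<lambda>\<omega>. pot (lgap t \<omega> 0)) + 1 * prob {\<omega>. lreceives collision \<omega> t (Suc t) 0} \<le> expectation (\<lambda>\<omega>. pot (lgap (Suc t) \<omega> 0))"
    proof (rule drift)
      fix a b b' :: nat assume "1 \<le> a" "a \<le> \<theta>" "b' = b + 1 \<or> b' + 1 = b"
      then show "pot a + pot b + (if collision b b' then 1 else 0) \<le> pot (a - 1) + pot b'"
        by (auto simp: pot_def collision_def min_def)
    qed auto
    then show ?thesis by (simp add: a_def p_def)
  qed
  have int: "integrable (site.P F) (\<lambda>\<omega>. pot (lgap t \<omega> 0))" for t
    unfolding pot_def by (intro site.line.integrable_const_bound[where B=\<theta>]) auto
  have ab: "- real \<theta> \<le> a t" "a t \<le> 0" for t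
  proof -
    have "expectation (\<lambda>_. - real \<theta>) \<le> a t" "a t \<le> expectation (\<lambda>_. 0)"
      unfolding a_def by (intro integral_mono int; simp add: pot_def)+
    then show "- real \<theta> \<le> a t" "a t \<le> 0" by (simp_all add: site.prob_UNIV)
  qed
  have "(\<Sum>t<n. p t) \<le> a n - a 0" for n
  proof (induction n)
    case (Suc n)
    then show ?case using ap[of n] by simp
  qed simp
  then have "(\<Sum>t<n. p t) \<le> real \<theta>" for n
    using ab(2)[of n] ab(1)[of 0] by (smt (verit))
  then have "summable p"
    by (intro summableI_nonneg_bounded[where x="real \<theta>"]) (auto simp: p_def)
  then have "AE \<omega> in site.P F. \<forall>\<^sub>F t in sequentially. \<omega> \<in> space (site.P F) - {\<omega>. lreceives collision \<omega> t (Suc t) 0}"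
    unfolding p_def by (intro borel_cantelli_AE1 meas) (auto simp: site.line.P.emeasure_eq_measure)
  then have z: "AE \<omega> in site.P F. \<forall>\<^sub>F t in sequentially. \<not> lreceives collision \<omega> t (Suc t) 0"
    by eventually_elim simp
  have "AE \<omega> in site.P F. \<forall>\<^sub>F t in sequentially. \<not> lreceives collision \<omega> t (Suc t) e" for e
    using site.AE_translate[OF z, of e] by (simp add: lreceives_translate)
  then show ?thesis by (simp only: AE_all_countable simp_thms)
qed

definition calm :: "(int \<Rightarrow> site) \<Rightarrow> nat \<Rightarrow> int \<Rightarrow> bool" where
  "calm \<omega> T e \<longleftrightarrow> (\<forall>t\<ge>T. \<not> lreceives collision \<omega> t (Suc t) e)"

lemma AE_eventually_calm: "AE \<omega> in site.P F. \<forall>e. \<exists>T. calm \<omega> T e"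
  using AE_finitely_many_collisions by (simp add: calm_def eventually_sequentially)

lemma calm_mono: "calm \<omega> T e \<Longrightarrow> T \<le> T' \<Longrightarrow> calm \<omega> T' e"
  unfolding calm_def by auto

lemma calm_no_collision:
  assumes r: "regular \<omega>" and s: "separated m \<omega> L R T'" and e: "L \<le> e" "e < R" and c: "calm \<omega> T e"
    and k: "T * 2 ^ m \<le> k" "k < T' * 2 ^ m"
  shows "\<not> receives collision m \<omega> k e"
proof
  assume rc: "receives collision m \<omega> k e"
  \<comment> \<open>The unit interval of time that contains step \<open>k\<close>.\<close>
  let ?t = "k div 2 ^ m"
  have t: "?t * 2 ^ m \<le> k" "k < Suc ?t * 2 ^ m" using dividend_less_div_times[of "2 ^ m" k] by (auto simp: ac_simps)
  have "T \<le> ?t" using k(1) by (simp add: less_eq_div_iff_mult_less_eq)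
  have "Suc ?t \<le> T'" using k(2) by (simp add: Suc_le_eq less_mult_imp_div_less)
  moreover have "window_receives collision m \<omega> ?t (Suc ?t) e"
    using rc t unfolding window_receives_def by (intro bexI[of _ k]) auto
  ultimately have "lreceives collision \<omega> ?t (Suc ?t) e"
    using r s e by (auto simp: regular_def lreceives_iff_path[OF r] window_receives_iff_path)
  then show False using c \<open>T \<le> ?t\<close> unfolding calm_def by blast
qed

lemma calm_frozen:
  assumes r: "regular \<omega>" and s: "separated m \<omega> L R T'" and e: "L \<le> e" "e < R" and c: "calm \<omega> T e"
    and fr: "\<theta> < gap m \<omega> (T * 2 ^ m) e"
  shows "T * 2 ^ m \<le> k \<Longrightarrow> k \<le> T' * 2 ^ m \<Longrightarrow> opin m \<omega> k e = opin m \<omega> (T * 2 ^ m) e \<and>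
    opin m \<omega> k (e + 1) = opin m \<omega> (T * 2 ^ m) (e + 1)"
proof (induction k rule: dec_induct)
  case (step k)
  have v: "valid_marks F \<omega>" using r by (simp add: regular_def good_def)
  have k: "k < T' * 2 ^ m" using step by simp
  have IH: "opin m \<omega> k e = opin m \<omega> (T * 2 ^ m) e \<and> opin m \<omega> k (e + 1) = opin m \<omega> (T * 2 ^ m) (e + 1)"
    using step.IH k by simp
  then have "\<theta> < gap m \<omega> k e" using fr by (simp add: gap_def)
  from no_collision_step(1)[OF v separated_isolated[OF v s k] e calm_no_collision[OF r s e c step(1) k] this] IH
  show ?case by (simp del: opin.simps)
qed simp

lemma calm_active:
  assumes r: "regular \<omega>" and s: "separated m \<omega> L R T'" and e: "L \<le> e" "e < R" and c: "calm \<omega> T e"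
    and ac: "gap m \<omega> (T * 2 ^ m) e \<le> \<theta>"
  shows "T * 2 ^ m \<le> k \<Longrightarrow> k \<le> T' * 2 ^ m \<Longrightarrow> gap m \<omega> k e \<le> \<theta>"
proof (induction k rule: dec_induct)
  case (step k)
  have v: "valid_marks F \<omega>" using r by (simp add: regular_def good_def)
  have k: "k < T' * 2 ^ m" using step by simp
  show ?case
    by (rule no_collision_step(2)[OF v separated_isolated[OF v s k] e calm_no_collision[OF r s e c step(1) k]]) (use step.IH k in simp)
qed (rule ac)

text \<open>Lets the limiting gaps of finitely many edges at two times be read off from a single
  discretised evolution.\<close>

lemma obtain_resolution:
  assumes r: "regular \<omega>"
  obtains m L R where "separated m \<omega> L R T" "L < a" "b < R"
    "\<And>e. e \<in> {a..b} \<Longrightarrow> gap m \<omega> (t * 2 ^ m) e = lgap t \<omega> e" "\<And>e. e \<in> {a..b} \<Longrightarrow> gap m \<omega> (u * 2 ^ m) e = lgap u \<omega> e"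
proof -
  obtain L R where LR: "L < a" "b < R" "\<forall>\<^sub>F m in sequentially. separated m \<omega> L R T"
    using good_block r unfolding regular_def by metis
  have "\<forall>\<^sub>F m in sequentially. \<forall>e\<in>{a..b}. gap m \<omega> (t * 2 ^ m) e = lgap t \<omega> e \<and> gap m \<omega> (u * 2 ^ m) e = lgap u \<omega> e"
    by (intro eventually_ball_finite ballI eventually_conj eventually_gap_eq_lgap[OF r]) simp
  from eventually_happens'[OF sequentially_bot eventually_conj[OF LR(3) this]] show ?thesis
    using that LR by blast
qed

text \<open>From time \<open>T\<close> on a frozen edge keeps both end opinions and an active edge
  stays active, so the status at \<open>T\<close> is final.\<close>

lemma calm_lgap_iff:
  assumes r: "regular \<omega>" and c: "calm \<omega> T e" and t: "T \<le> t"
  shows "\<theta> < lgap t \<omega> e \<longleftrightarrow> \<theta> < lgap T \<omega> e"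
proof -
  obtain m L R where m: "separated m \<omega> L R t" "L < e" "e < R"
    "\<And>e'. e' \<in> {e..e} \<Longrightarrow> gap m \<omega> (t * 2 ^ m) e' = lgap t \<omega> e'" "\<And>e'. e' \<in> {e..e} \<Longrightarrow> gap m \<omega> (T * 2 ^ m) e' = lgap T \<omega> e'"
    using obtain_resolution[OF r] by metis
  have LR: "L \<le> e" "e < R" using m by auto
  have le: "T * 2 ^ m \<le> t * 2 ^ m" using t by simp
  show ?thesis
  proof (cases "\<theta> < lgap T \<omega> e")
    case True
    then have "\<theta> < gap m \<omega> (T * 2 ^ m) e" using m(5) by simp
    from calm_frozen[OF r m(1) LR c this le order_refl]
    have "gap m \<omega> (t * 2 ^ m) e = gap m \<omega> (T * 2 ^ m) e" by (simp add: gap_def)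
    then show ?thesis using m(4,5)[of e] by simp
  next
    case False
    then have "gap m \<omega> (T * 2 ^ m) e \<le> \<theta>" using m(5)[of e] by simp
    from calm_active[OF r m(1) LR c this le order_refl] show ?thesis using m(4)[of e] False by simp
  qed
qed

definition frozen :: "(int \<Rightarrow> site) \<Rightarrow> int \<Rightarrow> bool" where
  "frozen \<omega> e \<longleftrightarrow> (\<forall>\<^sub>F t in sequentially. \<theta> < lgap t \<omega> e)"

lemma measurable_frozen [measurable]: "Measurable.pred (site.P F) (\<lambda>\<omega>. frozen \<omega> e)"
  unfolding frozen_def by measurable

lemma frozen_translate: "frozen (translate z \<omega>) e = frozen \<omega> (e + z)"
  by (simp add: frozen_def lgap_translate)

lemma frozen_dichotomy:
  assumes r: "regular \<omega>" and c: "calm \<omega> T e"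
  shows "frozen \<omega> e \<longleftrightarrow> \<theta> < lgap T \<omega> e" and "\<not> frozen \<omega> e \<Longrightarrow> \<forall>\<^sub>F t in sequentially. lgap t \<omega> e \<le> \<theta>"
proof -
  have ev: "\<forall>\<^sub>F t in sequentially. \<theta> < lgap t \<omega> e \<longleftrightarrow> \<theta> < lgap T \<omega> e"
    using eventually_ge_at_top[of T] by eventually_elim (rule calm_lgap_iff[OF r c])
  then have "frozen \<omega> e \<longleftrightarrow> (\<forall>\<^sub>F t::nat in sequentially. \<theta> < lgap T \<omega> e)"
    unfolding frozen_def by (rule eventually_cong) auto
  then show *: "frozen \<omega> e \<longleftrightarrow> \<theta> < lgap T \<omega> e" by simp
  assume "\<not> frozen \<omega> e"
  then show "\<forall>\<^sub>F t in sequentially. lgap t \<omega> e \<le> \<theta>" using ev * by (auto elim: eventually_mono)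
qed

end

section \<open>Fixation between frozen edges\<close>

context deffuant_process
begin

text \<open>The ring of \<open>x\<close> in \<open>(t, t + 1]\<close> is unique, so a ring in a step
  of that interval is the one prescribed by the sweep. The two bounds locate the step relative to
  the slot of \<open>x\<close>.\<close>

lemma sweep_source:
  assumes r: "regular \<omega>" and s: "separated m \<omega> L R T" and sw: "sweep \<omega> a b t" and t: "Suc t \<le> T"
    and x: "x \<in> {a<..b}" "x \<in> {L..R}" and k: "t * 2 ^ m \<le> k" "k < Suc t * 2 ^ m" and rg: "rings m \<omega> k x"
  shows "source m \<omega> k x = x - 1"
    and "real t + real_of_int (x - a - 1) / real_of_int (b - a) < real (Suc k) / 2 ^ m"
    and "real k / 2 ^ m < real t + real_of_int (x - a) / real_of_int (b - a)"
proof -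
  have kT: "k < T * 2 ^ m" using k(2) t by (meson less_le_trans mult_le_mono1)
  obtain n where n: "real t + real_of_int (x - a - 1) / real_of_int (b - a) < arrival \<omega> x n"
     "arrival \<omega> x n \<le> real t + real_of_int (x - a) / real_of_int (b - a)" "nbr \<omega> x n = x - 1"
     "\<And>l. real t < arrival \<omega> x l \<Longrightarrow> arrival \<omega> x l \<le> real t + 1 \<Longrightarrow> l = n"
    using sw x(1) unfolding sweep_def by blast
  define l where "l = ring_index m \<omega> k x"
  have rl: "rung m \<omega> k x l" unfolding l_def by (rule rung_ring_index[OF rg])
  have "real t \<le> real k / 2 ^ m"
    using of_nat_mono[OF k(1), where 'a=real] by (simp add: le_divide_eq)
  moreover have "real (Suc k) / 2 ^ m \<le> real (Suc t)" by (rule step_time_le[OF k(2)])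
  ultimately have "l = n" using rl unfolding rung_def by (intro n(4)) auto
  then show "source m \<omega> k x = x - 1"
    "real t + real_of_int (x - a - 1) / real_of_int (b - a) < real (Suc k) / 2 ^ m"
    "real k / 2 ^ m < real t + real_of_int (x - a) / real_of_int (b - a)"
    using n rl rg unfolding rung_def by (auto simp: source_def l_def)
qed

lemma sweep_rings:
  assumes sw: "sweep \<omega> a b t" and x: "x \<in> {a<..b}"
  shows "\<exists>k\<in>{t * 2 ^ m..<Suc t * 2 ^ m}. rings m \<omega> k x"
proof -
  obtain n where n: "real t + real_of_int (x - a - 1) / real_of_int (b - a) < arrival \<omega> x n"
     "arrival \<omega> x n \<le> real t + real_of_int (x - a) / real_of_int (b - a)"
    using sw x unfolding sweep_def by blast
  have "0 \<le> real_of_int (x - a - 1) / real_of_int (b - a)" "real_of_int (x - a) / real_of_int (b - a) \<le> 1"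
    using x by (auto simp: divide_le_eq)
  with n have "real t < arrival \<omega> x n" "arrival \<omega> x n \<le> real (Suc t)" by auto
  from obtain_step[OF this, of m] obtain k where "t * 2 ^ m \<le> k" "k < Suc t * 2 ^ m" "rung m \<omega> k x n"
    unfolding rung_def by metis
  then show ?thesis unfolding rings_def by auto
qed

text \<open>A sweep carries a disagreement from any active edge to the right until it meets another one.
  Without collisions, no active edge can therefore be left between two frozen edges.\<close>

lemma sweep_clears:
  assumes r: "regular \<omega>" and ab: "a < b" and sw: "sweep \<omega> a b t"
    and calm: "\<And>e. e \<in> {a..b} \<Longrightarrow> calm \<omega> t e" and fb: "\<theta> < lgap t \<omega> b" and e: "a < e" "e < b"
  shows "lgap t \<omega> e = 0 \<or> \<theta> < lgap t \<omega> e"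
proof (rule ccontr)
  assume act: "\<not> (lgap t \<omega> e = 0 \<or> \<theta> < lgap t \<omega> e)"
  obtain m L R where m: "separated m \<omega> L R (Suc t)" "L < a" "b + 1 < R"
    "\<And>e. e \<in> {a..b + 1} \<Longrightarrow> gap m \<omega> (t * 2 ^ m) e = lgap t \<omega> e"
    using obtain_resolution[OF r] by metis
  have v: "valid_marks F \<omega>" using r by (simp add: regular_def good_def)
  let ?k0 = "t * 2 ^ m" and ?k1 = "Suc t * 2 ^ m"
  have nc: "\<not> receives collision m \<omega> k f" if "f \<in> {a..b}" "?k0 \<le> k" "k < ?k1" for f k
    using calm_no_collision[OF r m(1) _ _ calm[OF that(1)] that(2,3)] that(1) m(2,3) by auto
  have fb': "\<theta> < gap m \<omega> k b" if "?k0 \<le> k" "k < ?k1" for k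
  proof -
    have "\<theta> < gap m \<omega> ?k0 b" using m(4)[of b] fb ab by simp
    from calm_frozen[OF r m(1) _ _ calm this that(1)] show ?thesis
      using that m(2,3) ab \<open>\<theta> < gap m \<omega> ?k0 b\<close> by (simp add: gap_def)
  qed
  \<comment> \<open>The edge \<open>f\<close> that holds the tracked disagreement moves right with
    the sweep; site \<open>f + 1\<close>, whose ring would push the disagreement on, has not rung
    yet. At the end of the sweep every site has rung, a contradiction.\<close>
  have inv: "\<exists>f\<in>{e..<b}. 1 \<le> gap m \<omega> k f \<and> gap m \<omega> k f \<le> \<theta> \<and> (\<forall>j. ?k0 \<le> j \<longrightarrow> j < k \<longrightarrow> \<not> rings m \<omega> j (f + 1))"
    if "?k0 \<le> k" "k \<le> ?k1" for k
    using that
  proof (induction k rule: dec_induct)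
    case base
    show ?case using act m(4)[of e] e by (intro bexI[of _ e]) auto
  next
    case (step k)
    then obtain f where f: "f \<in> {e..<b}" "1 \<le> gap m \<omega> k f" "gap m \<omega> k f \<le> \<theta>"
      "\<And>j. ?k0 \<le> j \<Longrightarrow> j < k \<Longrightarrow> \<not> rings m \<omega> j (f + 1)" by auto
    have k: "?k0 \<le> k" "k < ?k1" using step by auto
    have iso: "isolated m \<omega> L R k" by (rule separated_isolated[OF v m(1) k(2)])
    have fLR: "L \<le> f" "f < R" "f + 1 < R" using f(1) e m(2,3) by auto
    have f_ab: "f \<in> {a..b}" "f + 1 \<in> {a..b}" using f(1) e by auto
    note nf = nc[OF f_ab(1) k]
    have le: "gap m \<omega> (Suc k) f \<le> \<theta>" by (rule no_collision_step(2)[OF v iso fLR(1,2) nf f(3)])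
    show ?case
    proof (cases "rings m \<omega> k (f + 1)")
      case False
      \<comment> \<open>During the sweep site \<open>f\<close> copies only \<open>f - 1\<close>, so
        the edge \<open>f\<close> emits nothing to the left.\<close>
      have "source m \<omega> k f \<noteq> f + 1"
      proof (cases "rings m \<omega> k f")
        case True
        have "source m \<omega> k f = f - 1"
          by (rule sweep_source(1)[OF r m(1) sw order_refl _ _ k True]) (use f(1) e m(2,3) in auto)
        then show ?thesis by simp
      qed simp
      moreover have "source m \<omega> k (f + 1) \<noteq> f" using False by simp
      ultimately have "1 \<le> gap m \<omega> (Suc k) f" by (rule no_collision_step(3)[OF v iso fLR(1,2) nf f(2,3)])
      with le f False show ?thesis by (intro bexI[of _ f]) (auto simp: less_Suc_eq)
    next
      case True
      have x: "f + 1 \<in> {a<..b}" "f + 1 \<in> {L..R}" using f(1) e m(2,3) by auto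
      have src: "source m \<omega> k (f + 1) = f"
        using sweep_source(1)[OF r m(1) sw order_refl x k True] by simp
      have new: "1 \<le> gap m \<omega> (Suc k) (f + 1) \<and> gap m \<omega> k (f + 1) < \<theta>"
        by (rule no_collision_step(4)[OF v iso fLR(1,2) nf f(2,3) src fLR(3) nc[OF f_ab(2) k]])
      then have "f + 1 \<noteq> b" using fb'[OF k] by auto
      then have fb1: "f + 1 \<in> {e..<b}" using f(1) by auto
      have le': "gap m \<omega> (Suc k) (f + 1) \<le> \<theta>"
        by (rule no_collision_step(2)[OF v iso _ _ nc[OF f_ab(2) k]]) (use fLR new in auto)
      \<comment> \<open>The slot of site \<open>f + 2\<close> begins where that of
        \<open>f + 1\<close> ends.\<close>
      have "\<not> rings m \<omega> j (f + 1 + 1)" if j: "?k0 \<le> j" "j < Suc k" for j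
      proof
        assume rj: "rings m \<omega> j (f + 1 + 1)"
        have x2: "f + 1 + 1 \<in> {a<..b}" "f + 1 + 1 \<in> {L..R}" using fb1 e m(2,3) by auto
        have "j \<noteq> k"
        proof
          assume "j = k"
          then show False using iso True rj x(2) x2(2) unfolding isolated_def by force
        qed
        then have jk: "j < k" using j by simp
        have "real t + real_of_int (f + 1 + 1 - a - 1) / real_of_int (b - a) < real (Suc j) / 2 ^ m"
          by (rule sweep_source(2)[OF r m(1) sw order_refl x2 j(1) _ rj]) (use jk k in auto)
        also have "\<dots> \<le> real k / 2 ^ m" using jk by (intro divide_right_mono) auto
        also have "\<dots> < real t + real_of_int (f + 1 - a) / real_of_int (b - a)"
          by (rule sweep_source(3)[OF r m(1) sw order_refl x k True])
        finally show False by (simp add: algebra_simps)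
      qed
      with new le' fb1 show ?thesis by (intro bexI[of _ "f + 1"]) auto
    qed
  qed
  from inv[of ?k1] obtain f where f: "f \<in> {e..<b}" "\<And>j. ?k0 \<le> j \<Longrightarrow> j < ?k1 \<Longrightarrow> \<not> rings m \<omega> j (f + 1)" by auto
  have "f + 1 \<in> {a<..b}" using f(1) e by auto
  from sweep_rings[OF sw this, of m] show False using f(2) by auto
qed

text \<open>Take a sweep after all edges of \<open>[a, b]\<close> have become calm. At its start
  every edge there must already be empty or frozen, so none can emit; every further change of
  opinion inside would need an emission from an edge next to it.\<close>

lemma fixation_between_frozen:
  assumes r: "regular \<omega>" and ab: "a < b" and sw: "\<And>t0. \<exists>t\<ge>t0. sweep \<omega> a b t"
    and calm: "\<And>e. \<exists>T. calm \<omega> T e" and fr: "frozen \<omega> a" "frozen \<omega> b"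
  shows "\<exists>t. \<forall>x\<in>{a..b + 1}. \<forall>r>real t. \<eta> \<omega> r x = \<eta> \<omega> t x"
proof -
  obtain T where T: "\<And>e. calm \<omega> (T e) e" using calm by metis
  obtain t where t: "t \<ge> Max (T ` {a..b})" "sweep \<omega> a b t" using sw by blast
  have c: "calm \<omega> t e" if "e \<in> {a..b}" for e
    using calm_mono[OF T[of e]] t(1) that by (meson Max_ge finite_atLeastAtMost_int finite_imageI image_eqI order_trans)
  have fa: "\<theta> < lgap t \<omega> a" "\<theta> < lgap t \<omega> b"
    using fr frozen_dichotomy(1)[OF r c] ab by auto
  have clear: "lgap t \<omega> e = 0 \<or> \<theta> < lgap t \<omega> e" if "e \<in> {a..b}" for e
    using sweep_clears[OF r ab t(2) c fa(2), of e] fa that by (cases "e = a \<or> e = b") auto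
  have v: "valid_marks F \<omega>" and g: "good F \<omega>" and p: "is_deffuant_path F \<theta> \<omega> (\<eta> \<omega>)"
    using r by (simp_all add: regular_def good_def)
  have "\<eta> \<omega> s x = \<eta> \<omega> t x" if x: "x \<in> {a..b + 1}" and s: "s > real t" for x s
  proof -
    define T' where "T' = nat \<lceil>s\<rceil>"
    have sT: "s \<le> real T'" unfolding T'_def by linarith
    have tT: "t \<le> T'" using s sT by simp
    obtain m L R where m: "separated m \<omega> L R T'" "L < a" "b + 1 < R"
      "\<And>e. e \<in> {a..b + 1} \<Longrightarrow> gap m \<omega> (t * 2 ^ m) e = lgap t \<omega> e"
      using obtain_resolution[OF r] by metis
    have const: "\<forall>y\<in>{a..b + 1}. opin m \<omega> k y = opin m \<omega> (t * 2 ^ m) y" if "t * 2 ^ m \<le> k" "k \<le> T' * 2 ^ m" for k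
      using that
    proof (induction k rule: dec_induct)
      case (step k)
      have k: "k < T' * 2 ^ m" using step by simp
      have IH: "\<And>y. y \<in> {a..b + 1} \<Longrightarrow> opin m \<omega> k y = opin m \<omega> (t * 2 ^ m) y" using step k by auto
      have gk: "gap m \<omega> k e = lgap t \<omega> e" if "e \<in> {a..b}" for e
        using IH[of e] IH[of "e + 1"] m(4)[of e] that by (simp add: gap_def)
      \<comment> \<open>Site \<open>a\<close> could still copy from outside the interval; the calm
        frozen edge at \<open>a\<close> excludes this, and likewise the one at \<open>b\<close> for
        site \<open>b + 1\<close>.\<close>
      have ends: "opin m \<omega> (Suc k) a = opin m \<omega> k a" "opin m \<omega> (Suc k) (b + 1) = opin m \<omega> k (b + 1)"
        using calm_frozen[OF r m(1) _ _ c[of a], of "Suc k"] calm_frozen[OF r m(1) _ _ c[of b], of "Suc k"]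
          IH[of a] IH[of "b + 1"] m(2,3) m(4)[of a] m(4)[of b] fa step(1) k ab by (auto simp del: opin.simps)
      show ?case
      proof
        fix y assume y: "y \<in> {a..b + 1}"
        have "opin m \<omega> (Suc k) y = opin m \<omega> k y"
          using v separated_isolated[OF v m(1) k]
        proof (cases rule: isolated_cases)
          case idle then show ?thesis using y m(2,3) by auto
        next
          case (change x)
          show ?thesis
          proof (cases "y = x")
            case False then show ?thesis using change(5) y m(2,3) by (auto simp del: opin.simps)
          next
            case True
            show ?thesis
            proof (rule ccontr)
              assume "opin m \<omega> (Suc k) y \<noteq> opin m \<omega> k y"
              then have xx: "a < x" "x \<le> b" using ends True y by (auto simp: order_le_less simp del: opin.simps)
              have l: "opin m \<omega> (Suc k) (x - 1) = opin m \<omega> k (x - 1)" and rr: "opin m \<omega> (Suc k) (x + 1) = opin m \<omega> k (x + 1)"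
                using change(1,2) by (auto intro!: change(5) simp del: opin.simps)
              obtain em rc where er: "source m \<omega> k x = x + 1 \<and> em = x \<and> rc = x - 1 \<or> source m \<omega> k x = x - 1 \<and> em = x - 1 \<and> rc = x"
                "1 \<le> gap m \<omega> k em" "gap m \<omega> k em \<le> \<theta>"
                by (rule opin_change[OF v change(4) l rr]) blast
              have "em \<in> {a..b}" using er(1) xx by auto
              then show False using clear[of em] gk[of em] er(2,3) by auto
            qed
          qed
        qed
        then show "opin m \<omega> (Suc k) y = opin m \<omega> (t * 2 ^ m) y" using IH[OF y] by simp
      qed
    qed simp
    have xLR: "x \<in> {L..R}" using x m(2,3) by auto
    have "\<eta> \<omega> s x = opin m \<omega> (t * 2 ^ m) x"
      by (rule path_const_of_opin_const[OF p g m(1) xLR _ s sT]) (use const x in blast)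
    also have "\<dots> = \<eta> \<omega> t x"
      using path_agree[OF p g m(1) _ xLR, of "t * 2 ^ m"] tT by simp
    finally show ?thesis .
  qed
  then show ?thesis by blast
qed

lemma AE_fixation:
  assumes pos: "prob {\<omega>. frozen \<omega> 0} > 0"
  shows "AE \<omega> in site.P F. \<forall>x. \<exists>t::nat. \<forall>r>real t. \<eta> \<omega> r x = \<eta> \<omega> t x"
proof -
  have "AE \<omega> in site.P F. \<forall>x. (\<exists>z\<ge>x. frozen (translate z \<omega>) 0) \<and> (\<exists>z\<le>x. frozen (translate z \<omega>) 0)"
    by (rule site.AE_infinitely_often_translate[OF measurable_frozen pos])
  then show ?thesis
    using AE_regular AE_sweep AE_eventually_calm
  proof eventually_elim
    case (elim \<omega>)
    show ?case
    proof
      fix x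
      have fz: "\<forall>x. (\<exists>z\<ge>x. frozen \<omega> z) \<and> (\<exists>z\<le>x. frozen \<omega> z)"
        using elim(1) by (simp add: frozen_translate)
      obtain a where a: "a \<le> x - 1" "frozen \<omega> a" using fz by blast
      obtain b where b: "b \<ge> x + 1" "frozen \<omega> b" using fz by blast
      have "a < b" using a b by simp
      with fixation_between_frozen[OF elim(2) this _ _ a(2) b(2)] elim(3,4)
      obtain t :: nat where "\<forall>x\<in>{a..b + 1}. \<forall>r>real t. \<eta> \<omega> r x = \<eta> \<omega> t x" by metis
      then show "\<exists>t::nat. \<forall>r>real t. \<eta> \<omega> r x = \<eta> \<omega> t x" using a b by (intro exI[of _ t]) auto
    qed
  qed
qed

end

section \<open>First hits of a frozen edge\<close>

context deffuant_process
begin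

text \<open>The potential \<open>phi\<close> measures how many moving disagreements a frozen edge can absorb before it
  breaks up, net of those it then releases; a moving disagreement counts \<open>- 1\<close>.\<close>

definition phi :: "nat \<Rightarrow> real" where
  "phi j = (if j \<le> \<theta> then - real j else real j - 2 * real \<theta>)"

text \<open>For unit changes this says that the gap moves away from \<open>\<theta>\<close>: a fresh
  issue arrives at an edge with at least \<open>\<theta>\<close> of them, or a cancellation occurs
  on one with at most \<open>\<theta>\<close>.\<close>

definition gain :: "nat \<Rightarrow> nat \<Rightarrow> bool" where
  "gain b b' \<longleftrightarrow> phi b < phi b'"

definition initial_gap :: "(int \<Rightarrow> site) \<Rightarrow> nat set" where
  "initial_gap \<omega> = disagree F (opin 0 \<omega> 0 0) (opin 0 \<omega> 0 1)"

text \<open>Convergence of \<open>hit_level m\<close> in \<open>m\<close> is not established. The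
  least value taken for infinitely many \<open>m\<close> is measurable and inherits the invariance
  under flips, and infinitely many \<open>m\<close> suffice to match path events that do not involve
  \<open>m\<close>.\<close>

definition first_level :: "nat \<Rightarrow> (int \<Rightarrow> site) \<Rightarrow> nat" where
  "first_level t \<omega> = (LEAST i. \<exists>\<^sub>F m in sequentially. hit_level m t \<omega> = i)"

lemma gap_0: "gap m \<omega> 0 0 = card (initial_gap \<omega>)"
  by (simp add: gap_def initial_gap_def hamming_eq)

lemma lgap_0: "lgap 0 \<omega> 0 = card (initial_gap \<omega>)"
proof -
  have "(LEAST j. \<forall>\<^sub>F m in sequentially. gap m \<omega> (0 * 2 ^ m) 0 = j) = card (initial_gap \<omega>)"
    by (rule Least_equality) (simp_all add: gap_0)
  moreover have "card (initial_gap \<omega>) \<le> F" unfolding gap_0[of 0, symmetric] by (rule gap_le)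
  ultimately show ?thesis by (simp add: lgap_def)
qed

lemma initial_gap_subset: "initial_gap \<omega> \<subseteq> {..<F}"
  unfolding initial_gap_def by (rule disagree_subset)

lemma measurable_initial_gap [measurable]: "Measurable.pred (site.P F) (\<lambda>\<omega>. initial_gap \<omega> = A)"
  unfolding initial_gap_def by (rule measurable_opin2[of "\<lambda>u w. disagree F u w = A"]) simp

lemma measurable_first_level [measurable]: "(\<lambda>\<omega>. first_level t \<omega>) \<in> site.P F \<rightarrow>\<^sub>M count_space UNIV"
  unfolding first_level_def frequently_def by measurable

lemma right_of_0_subset: "D \<subseteq> A \<Longrightarrow> right_of_0 D x \<subseteq> A"
  by (simp add: right_of_0_def)

lemma initial_gap_recolor:
  assumes "D \<subseteq> {..<F}"
  shows "initial_gap (recolor (right_of_0 D) \<omega>) = symdiff (initial_gap \<omega>) D"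
proof -
  have f: "right_of_0 D x \<subseteq> {..<F}" for x using assms by (simp add: right_of_0_def)
  have "opin 0 (recolor (right_of_0 D) \<omega>) 0 x = symdiff (opin 0 \<omega> 0 x) (right_of_0 D x)" for x
    by (rule opin_0_recolor[OF f])
  then show ?thesis
    using assms unfolding initial_gap_def by (auto simp: right_of_0_def disagree_def simp del: opin.simps)
qed

lemma prob_recolor:
  assumes Q: "Measurable.pred (site.P F) Q" and f: "\<And>x. f x \<subseteq> {..<F}"
  shows "prob {\<omega>. Q (recolor f \<omega>)} = prob {\<omega>. Q \<omega>}"
proof -
  have "measure (distr (site.P F) (site.P F) (recolor f)) {\<omega>. Q \<omega>} = prob (recolor f -` {\<omega>. Q \<omega>} \<inter> space (site.P F))"
    using Q by (intro measure_distr[OF measurable_recolor]) (simp add: pred_def)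
  then show ?thesis by (simp add: distr_recolor[OF f])
qed

lemma symdiff_eq_iff: "symdiff u (symdiff A B) = B \<longleftrightarrow> u = A"
  unfolding symdiff_def by blast

text \<open>A flip to the right of 0 carries the event for \<open>B\<close> to that for
  \<open>A\<close>, so all \<open>2 ^ F\<close> disagreement sets are equally likely.\<close>

lemma prob_initial_gap:
  assumes "A \<subseteq> {..<F}" shows "prob {\<omega>. initial_gap \<omega> = A} = 1 / 2 ^ F"
proof -
  have eq: "prob {\<omega>. initial_gap \<omega> = B} = prob {\<omega>. initial_gap \<omega> = A}" if "B \<subseteq> {..<F}" for B
  proof -
    have D: "symdiff B A \<subseteq> {..<F}" using that assms by (auto simp: symdiff_def)
    have "{\<omega>. initial_gap (recolor (right_of_0 (symdiff B A)) \<omega>) = A} = {\<omega>. initial_gap \<omega> = B}"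
      by (simp add: initial_gap_recolor[OF D] symdiff_eq_iff)
    then show ?thesis using prob_recolor[where f="right_of_0 (symdiff B A)", OF measurable_initial_gap[of A] right_of_0_subset[OF D]] by simp
  qed
  have "1 = prob (\<Union>B\<in>Pow {..<F}. {\<omega>. initial_gap \<omega> = B})"
  proof -
    have "(\<Union>B\<in>Pow {..<F}. {\<omega>. initial_gap \<omega> = B}) = UNIV" using initial_gap_subset by auto
    then show ?thesis by (simp add: site.prob_UNIV)
  qed
  also have "\<dots> = (\<Sum>B\<in>Pow {..<F}. prob {\<omega>. initial_gap \<omega> = B})"
    using measurable_initial_gap by (intro site.line.finite_measure_finite_Union) (auto simp: pred_def disjoint_family_on_def)
  also have "\<dots> = 2 ^ F * prob {\<omega>. initial_gap \<omega> = A}"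
    using eq by (simp add: card_Pow)
  finally show ?thesis by (simp add: field_simps)
qed

lemma first_level_recolor:
  assumes v: "valid_marks F \<omega>" and D: "D \<subseteq> {..<F}"
    and fr: "\<theta> < card (initial_gap \<omega>)" "\<theta> < card (symdiff (initial_gap \<omega>) D)"
  shows "first_level t (recolor (right_of_0 D) \<omega>) = first_level t \<omega>"
proof -
  have "hit_level m t (recolor (right_of_0 D) \<omega>) = hit_level m t \<omega>" for m
    by (rule hit_level_recolor[OF v D]) (use fr in \<open>simp_all add: gap_0 initial_gap_recolor[OF D]\<close>)
  then show ?thesis by (simp add: first_level_def)
qed

definition hit_at :: "nat \<Rightarrow> nat set \<Rightarrow> nat \<Rightarrow> (int \<Rightarrow> site) \<Rightarrow> bool" where
  "hit_at t A i \<omega> \<longleftrightarrow> initial_gap \<omega> = A \<and> first_level t \<omega> = i"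

lemma measurable_hit_at [measurable]: "Measurable.pred (site.P F) (hit_at t A i)"
  unfolding hit_at_def[abs_def] by measurable

text \<open>The flip by \<open>symdiff A B\<close> to the right of 0 turns the disagreement set
  \<open>A\<close> into \<open>B\<close>, preserves the law and, since both sets are frozen, the
  first issue to arrive. So among frozen sets of a given size the first issue is independent of the
  set.\<close>

lemma prob_hit_at_eq:
  assumes A: "A \<subseteq> {..<F}" "B \<subseteq> {..<F}" and c: "card A = card B" "\<theta> < card B"
  shows "prob {\<omega>. hit_at t A i \<omega>} = prob {\<omega>. hit_at t B i \<omega>}"
proof -
  have D: "symdiff A B \<subseteq> {..<F}" using A by (auto simp: symdiff_def)
  have "prob {\<omega>. hit_at t A i \<omega>} = prob {\<omega>. hit_at t B i (recolor (right_of_0 (symdiff A B)) \<omega>)}"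
  proof (rule site.line.finite_measure_eq_AE)
    show "AE \<omega> in site.P F. (\<omega> \<in> {\<omega>. hit_at t A i \<omega>}) = (\<omega> \<in> {\<omega>. hit_at t B i (recolor (right_of_0 (symdiff A B)) \<omega>)})"
      using AE_valid_marks
    proof eventually_elim
      case (elim \<omega>)
      show ?case
        using first_level_recolor[OF elim D, of t] c
        by (auto simp: hit_at_def initial_gap_recolor[OF D] symdiff_eq_iff) (metis symdiff_eq_iff)+
    qed
    show "{\<omega>. hit_at t A i \<omega>} \<in> sets (site.P F)" using measurable_hit_at by (simp add: pred_def)
    show "{\<omega>. hit_at t B i (recolor (right_of_0 (symdiff A B)) \<omega>)} \<in> sets (site.P F)"
      using measurable_compose[OF measurable_recolor measurable_hit_at] by (simp add: pred_def)
  qed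
  also have "\<dots> = prob {\<omega>. hit_at t B i \<omega>}" by (rule prob_recolor[where f="right_of_0 (symdiff A B)", OF measurable_hit_at right_of_0_subset[OF D]])
  finally show ?thesis .
qed

lemma hit_level_less:
  assumes "\<exists>k<t * 2 ^ m. hit m \<omega> k" shows "hit_level m t \<omega> < F"
proof -
  define K where "K = (LEAST k. hit m \<omega> k)"
  have "hit m \<omega> K" unfolding K_def using assms LeastI_ex by blast
  then have "\<exists>i. i \<in> symdiff (opin m \<omega> (Suc K) 0) (opin m \<omega> K 0) \<union> symdiff (opin m \<omega> (Suc K) 1) (opin m \<omega> K 1)"
    unfolding hit_def by (auto simp del: opin.simps)
  from LeastI_ex[OF this]
  have "hit_level m t \<omega> \<in> symdiff (opin m \<omega> (Suc K) 0) (opin m \<omega> K 0) \<union> symdiff (opin m \<omega> (Suc K) 1) (opin m \<omega> K 1)"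
    using assms unfolding hit_level_def Let_def K_def by simp
  then show ?thesis
    using opin_subset[of m \<omega> K 0] opin_subset[of m \<omega> K 1] opin_subset[of m \<omega> "Suc K" 0] opin_subset[of m \<omega> "Suc K" 1]
    by (auto simp del: opin.simps)
qed

lemma hit_level_le: "hit_level m t \<omega> \<le> F"
  using hit_level_less[of t m \<omega>] by (cases "\<exists>k<t * 2 ^ m. hit m \<omega> k") (auto simp: hit_level_def)

text \<open>Pigeonhole: only the values up to \<open>F\<close> occur.\<close>

lemma frequently_first_level: "\<exists>\<^sub>F m in sequentially. hit_level m t \<omega> = first_level t \<omega>"
proof -
  have "\<exists>i\<in>{..F}. \<exists>\<^sub>F m in sequentially. hit_level m t \<omega> = i"
  proof (rule ccontr)
    assume "\<not> ?thesis"
    then have "\<forall>\<^sub>F m in sequentially. \<forall>i\<in>{..F}. hit_level m t \<omega> \<noteq> i"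
      by (intro eventually_ball_finite) (auto simp: not_frequently)
    then have "\<forall>\<^sub>F m::nat in sequentially. False"
      by eventually_elim (use hit_level_le in blast)
    then show False by simp
  qed
  then show ?thesis unfolding first_level_def by (intro LeastI_ex[of "\<lambda>i. \<exists>\<^sub>F m in sequentially. hit_level m t \<omega> = i"]) blast
qed

lemma not_hit_stays: "(\<And>j. j < k \<Longrightarrow> \<not> hit m \<omega> j) \<Longrightarrow> opin m \<omega> k 0 = opin m \<omega> 0 0 \<and> opin m \<omega> k 1 = opin m \<omega> 0 1"
proof (induction k)
  case (Suc k)
  then show ?case using Suc.prems[of k] unfolding hit_def by (simp del: opin.simps)
qed simp

text \<open>Without a hit both end opinions, and hence the gap, keep their initial values.\<close>

lemma thawed_imp_hit:
  assumes r: "regular \<omega>" and fr: "\<theta> < card (initial_gap \<omega>)" and t: "lgap t \<omega> 0 \<le> \<theta>"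
  shows "first_level t \<omega> < F"
proof -
  have "\<forall>\<^sub>F m in sequentially. hit_level m t \<omega> < F"
    using eventually_gap_eq_lgap[OF r, of t 0]
  proof eventually_elim
    case (elim m)
    have "\<exists>k<t * 2 ^ m. hit m \<omega> k"
    proof (rule ccontr)
      assume "\<not> ?thesis"
      then have "opin m \<omega> (t * 2 ^ m) 0 = opin m \<omega> 0 0 \<and> opin m \<omega> (t * 2 ^ m) 1 = opin m \<omega> 0 1"
        by (intro not_hit_stays) blast
      then have "gap m \<omega> (t * 2 ^ m) 0 = gap m \<omega> 0 0" by (simp add: gap_def)
      then show False using elim t fr by (simp add: gap_0)
    qed
    then show ?case by (rule hit_level_less)
  qed
  from frequently_eventually_frequently[OF frequently_first_level[of t \<omega>] this]
  have "\<exists>\<^sub>F m::nat in sequentially. first_level t \<omega> < F"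
    by (rule frequently_elim1) simp
  then show ?thesis by simp
qed

text \<open>A frozen edge emits nothing, so its first hit is an arrival from an adjacent edge. An
  issue outside \<open>A\<close> enlarges the disagreement set, and \<open>phi\<close> is increasing
  above \<open>\<theta>\<close>.\<close>

lemma fresh_hit_gains:
  assumes r: "regular \<omega>" and h: "hit_at t A i \<omega>" and A: "\<theta> < card A" and i: "i < F" "i \<notin> A"
  shows "lreceives gain \<omega> 0 t 0"
proof -
  have g: "good F \<omega>" and v: "valid_marks F \<omega>" and p: "is_deffuant_path F \<theta> \<omega> (\<eta> \<omega>)"
    using r by (simp_all add: regular_def good_def)
  obtain L R where LR: "L < -1" "2 < R" "\<forall>\<^sub>F m in sequentially. separated m \<omega> L R t" by (rule good_block[OF g])
  have "window_receives gain m \<omega> 0 t 0" if s: "separated m \<omega> L R t" and lv: "hit_level m t \<omega> = i" for m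
  proof -
    have ex: "\<exists>k<t * 2 ^ m. hit m \<omega> k" using lv i(1) unfolding hit_level_def by (auto split: if_splits)
    define K where "K = (LEAST k. hit m \<omega> k)"
    have K: "hit m \<omega> K" "\<And>j. j < K \<Longrightarrow> \<not> hit m \<omega> j"
      unfolding K_def using ex LeastI_ex not_less_Least by blast+
    have Kt: "K < t * 2 ^ m" using ex K(2) by (meson le_less_trans leI)
    have stay: "opin m \<omega> K 0 = opin m \<omega> 0 0" "opin m \<omega> K 1 = opin m \<omega> 0 1" using not_hit_stays[OF K(2)] by auto
    have dis: "disagree F (opin m \<omega> K 0) (opin m \<omega> K (0 + 1)) = A"
      using h stay unfolding hit_at_def initial_gap_def by simp
    then have gK: "gap m \<omega> K 0 = card A" by (simp add: gap_def hamming_eq)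
    have iso: "isolated m \<omega> L R K" by (rule separated_isolated[OF v s Kt])
    obtain x where x: "x \<in> {0, 1}" "opin m \<omega> (Suc K) x \<noteq> opin m \<omega> K x"
      "\<And>y. y \<in> {L..R} \<Longrightarrow> y \<noteq> x \<Longrightarrow> opin m \<omega> (Suc K) y = opin m \<omega> K y"
      using v iso
    proof (cases rule: isolated_cases)
      case idle then show ?thesis using K(1) LR unfolding hit_def by force
    next
      case (change x)
      then show ?thesis using that[of x] K(1) LR unfolding hit_def by (smt (verit) atLeastAtMost_iff insertCI)
    qed
    have l: "opin m \<omega> (Suc K) (x - 1) = opin m \<omega> K (x - 1)" and rr: "opin m \<omega> (Suc K) (x + 1) = opin m \<omega> K (x + 1)"
      using x(1) LR by (auto intro!: x(3) simp del: opin.simps)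
    obtain i' em rc where er: "i' < F" "opin m \<omega> (Suc K) x = symdiff (opin m \<omega> K x) {i'}"
      "source m \<omega> K x = x + 1 \<and> em = x \<and> rc = x - 1 \<or> source m \<omega> K x = x - 1 \<and> em = x - 1 \<and> rc = x"
      "gap m \<omega> K em \<le> \<theta>"
      "gap m \<omega> (Suc K) rc = gap m \<omega> K rc + 1 \<longleftrightarrow> i' \<notin> disagree F (opin m \<omega> K rc) (opin m \<omega> K (rc + 1))"
      by (rule opin_change[OF v x(2) l rr]) blast
    have em: "em \<noteq> 0" using er(4) gK A by auto
    then have rc: "rc = 0" "x = 0 \<and> source m \<omega> K 0 = - 1 \<or> x = 1 \<and> source m \<omega> K 1 = 2" using er(3) x(1) by auto
    have other: "opin m \<omega> (Suc K) (1 - x) = opin m \<omega> K (1 - x)" using x(1) LR by (auto intro!: x(3) simp del: opin.simps)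
    have "symdiff (opin m \<omega> (Suc K) 0) (opin m \<omega> K 0) \<union> symdiff (opin m \<omega> (Suc K) 1) (opin m \<omega> K 1) = {i'}"
      using x(1) er(2) other by (auto simp: symdiff_def simp del: opin.simps)
    then have "hit_level m t \<omega> = (LEAST j. j \<in> {i'})"
      using ex unfolding hit_level_def Let_def K_def[symmetric] by simp
    then have "i' = i" using lv by (simp add: Least_equality)
    then have "gap m \<omega> (Suc K) 0 = gap m \<omega> K 0 + 1" using er(5) dis i(2) rc(1) by simp
    then have "gain (gap m \<omega> K 0) (gap m \<omega> (Suc K) 0)" using gK A by (simp add: gain_def phi_def)
    then have "receives gain m \<omega> K 0" using rc(2) x(2) unfolding receives_def by (auto simp del: opin.simps)
    then show ?thesis using Kt unfolding window_receives_def by auto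
  qed
  moreover have "\<exists>\<^sub>F m in sequentially. hit_level m t \<omega> = i"
    using frequently_first_level[of t \<omega>] h by (simp add: hit_at_def)
  \<comment> \<open>Infinitely many \<open>m\<close> are enough, since for all large
    \<open>m\<close> the event coincides with a path event that does not involve
    \<open>m\<close>.\<close>
  ultimately have "\<exists>\<^sub>F m in sequentially. window_receives gain m \<omega> 0 t 0"
    using frequently_eventually_frequently[OF _ LR(3)] by (smt (verit) frequently_elim1)
  then have "\<exists>\<^sub>F m::nat in sequentially. path_receives gain \<omega> (\<eta> \<omega>) 0 t 0"
    using frequently_eventually_frequently[OF _ eventually_window_receives_iff[OF p g]] by (smt (verit) frequently_elim1)
  then show ?thesis by (simp add: lreceives_iff_path[OF r])
qed

end

section \<open>Edges freeze with positive probability\<close>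

text \<open>By Pascal's rule an entry of row \<open>n\<close> is the sum of two entries of row
  \<open>n - 1\<close>, whose total is \<open>2 ^ (n - 1)\<close>.\<close>

lemma binomial_le_half: "1 \<le> n \<Longrightarrow> n choose k \<le> 2 ^ (n - 1)"
proof -
  assume "1 \<le> n"
  then obtain m where n: "n = Suc m" by (cases n) auto
  show ?thesis
  proof (cases k)
    case 0
    then show ?thesis by simp
  next
    case (Suc j)
    have "(m choose j) + (m choose Suc j) = (\<Sum>i\<in>{j, Suc j}. m choose i)" by simp
    also have "\<dots> \<le> (\<Sum>i\<in>{..m} \<union> {j, Suc j}. m choose i)" by (intro sum_mono2) auto
    also have "\<dots> = (\<Sum>i\<le>m. m choose i)" by (intro sum.mono_neutral_right) (auto simp: binomial_eq_0)
    also have "\<dots> = 2 ^ m" by (rule choose_row_sum)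
    finally show ?thesis using Suc n by simp
  qed
qed

context deffuant_process
begin

text \<open>Divided by \<open>2 ^ F\<close>, the sum is the initial mean of \<open>phi\<close> plus
  twice the probability of a fresh first hit, if every initially frozen edge gets hit. Above
  \<open>\<theta>\<close> the coefficient is linear in \<open>j\<close>, and the linear part sums to
  \<open>(F + 2 - 4 * \<theta>) * 2 ^ (F - 1)\<close>, at least \<open>2 ^ (F - 1)\<close>; the
  correction \<open>r\<close> is negative only at \<open>j = \<theta>\<close>, where it costs at
  most \<open>2 ^ (F - 1)\<close>.\<close>

lemma initial_balance:
  assumes F: "4 * \<theta> - 1 \<le> F"
  shows "0 \<le> (\<Sum>j\<le>F. (phi j + (if \<theta> < j then 2 * (1 - real j / real F) else 0)) * real (F choose j))"
proof -
  have F3: "3 \<le> F" using F \<theta>_pos by linarith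
  have Fr: "4 * real \<theta> - 1 \<le> real F" using F \<theta>_pos by linarith
  \<comment> \<open>Difference between the actual coefficient and the linear one,
    \<open>(1 - 2 / F) * j + 2 - 2 * \<theta>\<close>.\<close>
  define r where "r = (\<lambda>j. if j \<le> \<theta> then 2 * (real \<theta> - 1 - real j + real j / real F) else 0)"
  have "(\<Sum>j\<le>F. (phi j + (if \<theta> < j then 2 * (1 - real j / real F) else 0)) * real (F choose j))
      = (\<Sum>j\<le>F. (1 - 2 / real F) * (real j * real (F choose j)) + (2 - 2 * real \<theta>) * real (F choose j) + r j * real (F choose j))"
  proof (rule sum.cong)
    fix j
    show "(phi j + (if \<theta> < j then 2 * (1 - real j / real F) else 0)) * real (F choose j)
      = (1 - 2 / real F) * (real j * real (F choose j)) + (2 - 2 * real \<theta>) * real (F choose j) + r j * real (F choose j)"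
      by (cases "j \<le> \<theta>") (simp_all add: phi_def r_def algebra_simps)
  qed simp
  also have "\<dots> = (1 - 2 / real F) * (\<Sum>j\<le>F. real j * real (F choose j)) + (2 - 2 * real \<theta>) * (\<Sum>j\<le>F. real (F choose j)) + (\<Sum>j\<le>F. r j * real (F choose j))"
    by (simp add: sum.distrib sum_distrib_left)
  also have "(\<Sum>j\<le>F. real j * real (F choose j)) = real F * 2 ^ (F - 1)"
    using choose_linear_sum[of F] by (metis (no_types, lifting) of_nat_mult of_nat_numeral of_nat_power of_nat_sum sum.cong)
  also have "(\<Sum>j\<le>F. real (F choose j)) = 2 ^ F"
    using choose_row_sum[of F] by (metis of_nat_numeral of_nat_power of_nat_sum)
  finally have eq: "(\<Sum>j\<le>F. (phi j + (if \<theta> < j then 2 * (1 - real j / real F) else 0)) * real (F choose j))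
    = (1 - 2 / real F) * (real F * 2 ^ (F - 1)) + (2 - 2 * real \<theta>) * 2 ^ F + (\<Sum>j\<le>F. r j * real (F choose j))" .
  have F2: "(2::real) ^ F = 2 * 2 ^ (F - 1)" "(2::real) ^ (F - 1) = 2 * 2 ^ (F - 2)"
    using F3 by (simp_all flip: power_Suc add: Suc_diff_Suc numeral_2_eq_2)
  have "- 2 * real (F - 1 choose \<theta>) \<le> (\<Sum>j\<le>F. r j * real (F choose j))"
  proof -
    have thF: "\<theta> \<le> F" using F \<theta>_pos by linarith
    have "real (F - \<theta>) * real (F choose \<theta>) = real F * real (F - 1 choose \<theta>)"
      using binomial_absorb_comp[of F \<theta>] by (metis of_nat_mult)
    then have "r \<theta> * real (F choose \<theta>) = - 2 * real (F - 1 choose \<theta>)"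
      using thF F3 by (simp add: r_def of_nat_diff field_simps)
    \<comment> \<open>For \<open>j < \<theta>\<close> already \<open>\<theta> - 1 - j\<close> is
      nonnegative.\<close>
    moreover have "0 \<le> (\<Sum>j\<in>{..F} - {\<theta>}. r j * real (F choose j))"
      by (intro sum_nonneg mult_nonneg_nonneg) (auto simp: r_def)
    ultimately show ?thesis using thF by (subst sum.remove[of _ \<theta>]) auto
  qed
  moreover have "real (F - 1 choose \<theta>) \<le> 2 ^ (F - 2)"
  proof -
    have "F - 1 choose \<theta> \<le> 2 ^ (F - 1 - 1)" using F3 by (intro binomial_le_half) simp
    then have "real (F - 1 choose \<theta>) \<le> real (2 ^ (F - 1 - 1))" by (rule of_nat_mono)
    then show ?thesis by (simp add: numeral_2_eq_2)
  qed
  moreover have "(1 - 2 / real F) * (real F * 2 ^ (F - 1)) + (2 - 2 * real \<theta>) * 2 ^ F = (real F + 2 - 4 * real \<theta>) * 2 ^ (F - 1)"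
    using F3 F2(1) by (simp add: field_simps)
  moreover have "1 * 2 ^ (F - 1) \<le> (real F + 2 - 4 * real \<theta>) * 2 ^ (F - 1)"
    using Fr by (intro mult_right_mono) auto
  ultimately show ?thesis using F2(2) unfolding eq by linarith
qed

lemma prob_card_initial_gap: "prob {\<omega>. card (initial_gap \<omega>) = j} = real (F choose j) / 2 ^ F"
proof -
  have "{\<omega>. card (initial_gap \<omega>) = j} = (\<Union>A\<in>{A. A \<subseteq> {..<F} \<and> card A = j}. {\<omega>. initial_gap \<omega> = A})"
    using initial_gap_subset by auto
  also have "prob \<dots> = (\<Sum>A\<in>{A. A \<subseteq> {..<F} \<and> card A = j}. prob {\<omega>. initial_gap \<omega> = A})"
    using measurable_initial_gap by (intro site.line.finite_measure_finite_Union) (auto simp: pred_def disjoint_family_on_def)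
  also have "\<dots> = real (card {A. A \<subseteq> {..<F} \<and> card A = j}) * (1 / 2 ^ F)"
    by (simp add: prob_initial_gap)
  also have "card {A. A \<subseteq> {..<F} \<and> card A = j} = F choose j"
    using n_subsets[of "{..<F}" j] by simp
  finally show ?thesis by simp
qed

text \<open>For sets \<open>A\<close> of size \<open>j\<close> the probabilities depend on
  \<open>i\<close> only, by \<open>prob_hit_at_eq\<close>. After exchanging the sums, a given issue
  \<open>i\<close> is missed by the fraction \<open>1 - j / F\<close> of these sets.\<close>

lemma prob_hit_sums:
  assumes j: "\<theta> < j" "j \<le> F"
  shows "(1 - real j / real F) * (\<Sum>A\<in>{A. A \<subseteq> {..<F} \<and> card A = j}. \<Sum>i<F. prob {\<omega>. hit_at t A i \<omega>})
    = (\<Sum>A\<in>{A. A \<subseteq> {..<F} \<and> card A = j}. \<Sum>i\<in>{..<F} - A. prob {\<omega>. hit_at t A i \<omega>})"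
proof -
  let ?S = "{A. A \<subseteq> {..<F} \<and> card A = j}"
  have fin: "finite ?S" by (rule finite_subset[of _ "Pow {..<F}"]) auto
  obtain B where B: "B \<in> ?S"
    using j(2) obtain_subset_with_card_n[of j "{..<F}"] by auto
  define q where "q = (\<lambda>i. prob {\<omega>. hit_at t B i \<omega>})"
  have q: "prob {\<omega>. hit_at t A i \<omega>} = q i" if "A \<in> ?S" for A i
    unfolding q_def using that B j by (intro prob_hit_at_eq) auto
  have "(\<Sum>A\<in>?S. \<Sum>i\<in>{..<F} - A. prob {\<omega>. hit_at t A i \<omega>}) = (\<Sum>A\<in>?S. \<Sum>i<F. if i \<notin> A then q i else 0)"
    using q by (intro sum.cong sum.mono_neutral_cong_left) auto
  also have "\<dots> = (\<Sum>i<F. \<Sum>A\<in>?S. if i \<notin> A then q i else 0)" by (rule sum.swap)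
  also have "\<dots> = (\<Sum>i<F. real (F - 1 choose j) * q i)"
  proof (rule sum.cong)
    fix i assume i: "i \<in> {..<F}"
    have "(\<Sum>A\<in>?S. if i \<notin> A then q i else 0) = real (card {A\<in>?S. i \<notin> A}) * q i"
      using fin by (simp add: sum.If_cases Int_def)
    also have "{A\<in>?S. i \<notin> A} = {A. A \<subseteq> {..<F} - {i} \<and> card A = j}" by auto
    also have "card \<dots> = F - 1 choose j"
      using n_subsets[of "{..<F} - {i}" j] i by simp
    finally show "(\<Sum>A\<in>?S. if i \<notin> A then q i else 0) = real (F - 1 choose j) * q i" .
  qed simp
  finally have 1: "(\<Sum>A\<in>?S. \<Sum>i\<in>{..<F} - A. prob {\<omega>. hit_at t A i \<omega>}) = real (F - 1 choose j) * (\<Sum>i<F. q i)"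
    by (simp add: sum_distrib_left)
  have 2: "(\<Sum>A\<in>?S. \<Sum>i<F. prob {\<omega>. hit_at t A i \<omega>}) = real (F choose j) * (\<Sum>i<F. q i)"
    using q n_subsets[of "{..<F}" j] by simp
  have "real (F - j) * real (F choose j) = real F * real (F - 1 choose j)"
    using binomial_absorb_comp[of F j] by (metis of_nat_mult)
  then have "(1 - real j / real F) * real (F choose j) = real (F - 1 choose j)"
    using j F_pos by (simp add: of_nat_diff field_simps)
  then show ?thesis unfolding 1 2 by (metis mult.assoc)
qed

text \<open>An initially frozen edge that is active at time \<open>t\<close> has been hit. By
  \<open>prob_hit_sums\<close> the first issue to arrive is fresh with conditional probability
  \<open>1 - j / F\<close>, and a fresh first hit is a gain.\<close>

lemma prob_gain_ge:
  assumes j: "\<theta> < j" "j \<le> F"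
  shows "(1 - real j / real F) * prob {\<omega>. card (initial_gap \<omega>) = j \<and> lgap t \<omega> 0 \<le> \<theta>}
    \<le> prob {\<omega>. card (initial_gap \<omega>) = j \<and> lreceives gain \<omega> 0 t 0}"
proof -
  let ?S = "{A. A \<subseteq> {..<F} \<and> card A = j}"
  have fin: "finite ?S" by (rule finite_subset[of _ "Pow {..<F}"]) auto
  have hm: "{\<omega>. hit_at t A i \<omega>} \<in> sets (site.P F)" for A i using measurable_hit_at by (simp add: pred_def)
  have cm: "Measurable.pred (site.P F) (\<lambda>\<omega>. card (initial_gap \<omega>) = j)"
    unfolding lgap_0[symmetric] by measurable
  have un: "prob (\<Union>(A, i)\<in>Sigma ?S I. {\<omega>. hit_at t A i \<omega>}) = (\<Sum>A\<in>?S. \<Sum>i\<in>I A. prob {\<omega>. hit_at t A i \<omega>})"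
    if "\<And>A. finite (I A)" for I
  proof -
    have "prob (\<Union>(A, i)\<in>Sigma ?S I. {\<omega>. hit_at t A i \<omega>}) = (\<Sum>(A, i)\<in>Sigma ?S I. prob {\<omega>. hit_at t A i \<omega>})"
      unfolding split_beta'
    proof (rule site.line.finite_measure_finite_Union)
      show "finite (Sigma ?S I)" using fin that by auto
      show "(\<lambda>z. {\<omega>. hit_at t (fst z) (snd z) \<omega>}) ` Sigma ?S I \<subseteq> sets (site.P F)" using hm by auto
      show "disjoint_family_on (\<lambda>z. {\<omega>. hit_at t (fst z) (snd z) \<omega>}) (Sigma ?S I)"
        by (auto simp: disjoint_family_on_def hit_at_def)
    qed
    also have "\<dots> = (\<Sum>A\<in>?S. \<Sum>i\<in>I A. prob {\<omega>. hit_at t A i \<omega>})"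
      using fin that by (subst sum.Sigma) auto
    finally show ?thesis .
  qed
  have "prob {\<omega>. card (initial_gap \<omega>) = j \<and> lgap t \<omega> 0 \<le> \<theta>} \<le> prob (\<Union>(A, i)\<in>Sigma ?S (\<lambda>_. {..<F}). {\<omega>. hit_at t A i \<omega>})"
  proof (rule site.line.finite_measure_mono_AE)
    show "AE \<omega> in site.P F. \<omega> \<in> {\<omega>. card (initial_gap \<omega>) = j \<and> lgap t \<omega> 0 \<le> \<theta>} \<longrightarrow> \<omega> \<in> (\<Union>(A, i)\<in>Sigma ?S (\<lambda>_. {..<F}). {\<omega>. hit_at t A i \<omega>})"
      using AE_regular
    proof (eventually_elim, intro impI)
      fix \<omega> assume r: "regular \<omega>" and "\<omega> \<in> {\<omega>. card (initial_gap \<omega>) = j \<and> lgap t \<omega> 0 \<le> \<theta>}"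
      then have "first_level t \<omega> < F" using thawed_imp_hit[OF r] j(1) by auto
      then show "\<omega> \<in> (\<Union>(A, i)\<in>Sigma ?S (\<lambda>_. {..<F}). {\<omega>. hit_at t A i \<omega>})"
        using \<open>\<omega> \<in> {\<omega>. card (initial_gap \<omega>) = j \<and> lgap t \<omega> 0 \<le> \<theta>}\<close> initial_gap_subset by (auto simp: hit_at_def)
    qed
    show "(\<Union>(A, i)\<in>Sigma ?S (\<lambda>_. {..<F}). {\<omega>. hit_at t A i \<omega>}) \<in> sets (site.P F)"
      using fin hm by (intro sets.finite_UN) auto
  qed
  also have "\<dots> = (\<Sum>A\<in>?S. \<Sum>i<F. prob {\<omega>. hit_at t A i \<omega>})" by (rule un) simp
  finally have "(1 - real j / real F) * prob {\<omega>. card (initial_gap \<omega>) = j \<and> lgap t \<omega> 0 \<le> \<theta>}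
      \<le> (1 - real j / real F) * (\<Sum>A\<in>?S. \<Sum>i<F. prob {\<omega>. hit_at t A i \<omega>})"
    using j by (intro mult_left_mono) (auto simp: divide_le_eq)
  also have "\<dots> = (\<Sum>A\<in>?S. \<Sum>i\<in>{..<F} - A. prob {\<omega>. hit_at t A i \<omega>})" by (rule prob_hit_sums[OF j])
  also have "\<dots> = prob (\<Union>(A, i)\<in>Sigma ?S (\<lambda>A. {..<F} - A). {\<omega>. hit_at t A i \<omega>})" by (rule un[symmetric]) simp
  also have "\<dots> \<le> prob {\<omega>. card (initial_gap \<omega>) = j \<and> lreceives gain \<omega> 0 t 0}"
  proof (rule site.line.finite_measure_mono_AE)
    show "AE \<omega> in site.P F. \<omega> \<in> (\<Union>(A, i)\<in>Sigma ?S (\<lambda>A. {..<F} - A). {\<omega>. hit_at t A i \<omega>}) \<longrightarrow> \<omega> \<in> {\<omega>. card (initial_gap \<omega>) = j \<and> lreceives gain \<omega> 0 t 0}"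
      using AE_regular
    proof (eventually_elim, intro impI)
      fix \<omega> assume r: "regular \<omega>" and "\<omega> \<in> (\<Union>(A, i)\<in>Sigma ?S (\<lambda>A. {..<F} - A). {\<omega>. hit_at t A i \<omega>})"
      then obtain A i where A: "card A = j" "i < F" "i \<notin> A" "hit_at t A i \<omega>" by auto
      then show "\<omega> \<in> {\<omega>. card (initial_gap \<omega>) = j \<and> lreceives gain \<omega> 0 t 0}"
        using fresh_hit_gains[OF r A(4)] j(1) by (auto simp: hit_at_def)
    qed
    show "{\<omega>. card (initial_gap \<omega>) = j \<and> lreceives gain \<omega> 0 t 0} \<in> sets (site.P F)"
    proof -
      have "Measurable.pred (site.P F) (\<lambda>\<omega>. card (initial_gap \<omega>) = j \<and> lreceives gain \<omega> 0 t 0)"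
        using cm by measurable
      then show ?thesis by (simp add: pred_def)
    qed
  qed
  finally show ?thesis .
qed

lemma sets_pred: "Measurable.pred (site.P F) Q \<Longrightarrow> {\<omega>. Q \<omega>} \<in> sets (site.P F)"
  by (simp add: pred_def)

text \<open>A concrete cancellation: the edges at 0 and 1 both carry just the issue 0, and both
  become empty when site 1 copies site 2.\<close>

lemma lreceives_gain_of_first_ring:
  assumes r: "regular \<omega>" and init: "init_op \<omega> 0 = {}" "init_op \<omega> 1 = {0}" "init_op \<omega> 2 = {}"
    and quiet: "1 < arrival \<omega> 0 0" "1 < arrival \<omega> 2 0" and first: "arrival \<omega> 1 0 \<le> 1" "nbr \<omega> 1 0 = 2"
  shows "lreceives gain \<omega> 0 1 0"
proof -
  have g: "good F \<omega>" and v: "valid_marks F \<omega>" using r by (simp_all add: regular_def good_def)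
  obtain L R where LR: "L < 0" "2 < R" "\<forall>\<^sub>F m in sequentially. separated m \<omega> L R 1" by (rule good_block[OF g])
  have "\<forall>\<^sub>F m in sequentially. window_receives gain m \<omega> 0 1 0"
    using LR(3)
  proof eventually_elim
    case (elim m)
    have late: "\<not> rings m \<omega> k x" if "k < 1 * 2 ^ m" "real (Suc k) / 2 ^ m < arrival \<omega> x 0" for k x
      using that(2) monoD[OF strict_mono_mono[OF strict_mono_arrival[OF v, of x]], of 0] unfolding rings_def rung_def by (auto simp: not_le) (meson le_less_trans not_le zero_le)
    have q: "\<not> rings m \<omega> k 0" "\<not> rings m \<omega> k 2" if "k < 1 * 2 ^ m" for k
    proof -
      have le: "real (Suc k) / 2 ^ m \<le> 1" using step_time_le[OF that] by simp
      show "\<not> rings m \<omega> k 0" "\<not> rings m \<omega> k 2"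
        by (rule late[OF that le_less_trans[OF le quiet(1)]], rule late[OF that le_less_trans[OF le quiet(2)]])
    qed
    obtain K where K: "0 * 2 ^ m \<le> K" "K < 1 * 2 ^ m" "real K / 2 ^ m < arrival \<omega> 1 0" "arrival \<omega> 1 0 \<le> real (Suc K) / 2 ^ m"
      by (rule obtain_step[of 0 "arrival \<omega> 1 0" 1 m]) (use arrival_pos[OF v, of 1 0] first(1) in auto)
    have rn: "rung m \<omega> K 1 0" using K by (simp add: rung_def)
    have idx: "ring_index m \<omega> K 1 = 0" by (rule rung_index[OF elim K(2) _ rn]) (use LR in auto)
    have src: "source m \<omega> K 1 = 2" using rn idx first(2) by (auto simp: source_def rings_def)
    have before: "opin m \<omega> k 0 = {} \<and> opin m \<omega> k 1 = {0} \<and> opin m \<omega> k 2 = {}" if "k \<le> K" for k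
      using that
    proof (induction k)
      case 0
      show ?case using init F_pos by auto
    next
      case (Suc k)
      have k: "k < 1 * 2 ^ m" using Suc K(2) by simp
      have "real (Suc k) / 2 ^ m \<le> real K / 2 ^ m" using Suc.prems by (intro divide_right_mono) auto
      then have "\<not> rings m \<omega> k 1" using K(3) by (intro late[OF k]) simp
      then show ?case using Suc q[OF k] opin_quiet[of m \<omega> k] by (simp del: opin.simps)
    qed
    have d: "disagree F {0} {} = {0}" using F_pos by (auto simp: disagree_def)
    have p: "perm_of \<omega> 1 0 permutes {..<F}" using v by (simp add: valid_marks_def)
    have H: "hamming F {0} {} = 1" by (simp add: hamming_eq d)
    have "chosen (perm_of \<omega> 1 0) {0} = 0"
      using deffuant_step_flip(1)[OF p, of "{0}" "{}" \<theta>] H d \<theta>_pos by simp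
    then have new: "opin m \<omega> (Suc K) 1 = {}"
      using deffuant_step_flip(2)[OF p, of "{0}" "{}" \<theta>] H d \<theta>_pos before[of K] by (simp add: src idx symdiff_def)
    have "opin m \<omega> (Suc K) 0 = {}" using before[of K] opin_quiet[OF q(1)[OF K(2)]] by simp
    then have "gap m \<omega> (Suc K) 0 = 0" using new by (simp add: gap_def del: opin.simps)
    moreover have "gap m \<omega> K 0 = 1" using before[of K] H by (simp add: gap_def hamming_commute)
    ultimately have "receives gain m \<omega> K 0"
      using new before[of K] src \<theta>_pos unfolding receives_def by (auto simp: gain_def phi_def simp del: opin.simps)
    then show ?case using K(1,2) unfolding window_receives_def by auto
  qed
  then show ?thesis by (simp add: lreceives_def)
qed

text \<open>Supplies the strict inequality that \<open>initial_balance\<close> does not give: this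
  gain occurs on an initially active edge and so is not counted among the hits of frozen
  edges.\<close>

lemma prob_early_gain: "prob {\<omega>. card (initial_gap \<omega>) \<le> \<theta> \<and> lreceives gain \<omega> 0 1 0} > 0"
proof -
  have U: "UNIV \<in> sets (label.S F)" using sets.top[of "label.S F"] by simp
  define Bq where "Bq = {s :: nat \<Rightarrow> mark. 1 < ringing s 0}"
  define Br where "Br = {s :: nat \<Rightarrow> mark. rings_once 0 1 ({1} \<times> UNIV) s}"
  have lab: "{1} \<times> UNIV \<in> sets (label_law F)" and plab: "measure (label_law F) ({1} \<times> UNIV) > 0"
    by (intro label_direction; simp)+
  have Bq: "Bq \<in> sets (label.S F)" "emeasure (label.S F) Bq > 0"
    using label.measurable_ringing[of 0 F] label.emeasure_in_gap_0[OF U, of 1] label.seq.P.emeasure_space_1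
    by (auto simp: Bq_def borel_measurable_iff_greater label.in_gap_def)
  have Br: "Br \<in> sets (label.S F)" "emeasure (label.S F) Br > 0"
    using label.measurable_rings_once[OF lab, of 0 1] label.rings_once_indep(1)[OF lab _ _ _ plab, of 0 1]
    by (simp_all add: Br_def pred_def label.seq.P.emeasure_eq_measure)
  define Z where "Z = (\<lambda>x::int. if x = 1 then {{0::nat}} \<times> Br else {{}} \<times> Bq)"
  have Z: "Z x \<in> sets (site_law F)" "emeasure (site_law F) (Z x) > 0" for x
  proof -
    have i: "{u} \<in> sets (init_law F)" for u by (simp add: init_law_def)
    have pu: "emeasure (init_law F) {u} > 0" if "u \<subseteq> {..<F}" for u
      unfolding init_law_def emeasure_pmf_single using that by (subst pmf_of_set) (auto simp: card_Pow)
    show "Z x \<in> sets (site_law F)" unfolding site_law_eq Z_def using Bq Br i by auto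
    have "emeasure (site_law F) ({u} \<times> B) > 0" if "u \<subseteq> {..<F}" "B \<in> sets (label.S F)" "emeasure (label.S F) B > 0" for u B
      unfolding site_law_eq using pu[OF that(1)] that i by (simp add: label.seq.emeasure_pair_measure_Times ennreal_zero_less_mult_iff)
    then show "emeasure (site_law F) (Z x) > 0" unfolding Z_def using Bq Br F_pos by auto
  qed
  have "emeasure (site.P F) {\<omega> \<in> space (site.P F). \<forall>x\<in>{0, 1, 2}. \<omega> x \<in> Z x} = (\<Prod>x\<in>{0, 1, 2}. emeasure (site_law F) (Z x))"
    using Z(1) by (intro site.line.emeasure_PiM_Collect) auto
  also have "\<dots> > 0" using Z(2) by (simp add: ennreal_zero_less_mult_iff)
  finally have "prob {\<omega>. \<forall>x\<in>{0, 1, 2}. \<omega> x \<in> Z x} > 0"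
    by (simp add: site.line.P.emeasure_eq_measure)
  also have "prob {\<omega>. \<forall>x\<in>{0, 1, 2}. \<omega> x \<in> Z x} \<le> prob {\<omega>. card (initial_gap \<omega>) \<le> \<theta> \<and> lreceives gain \<omega> 0 1 0}"
  proof (rule site.line.finite_measure_mono_AE)
    show "AE \<omega> in site.P F. \<omega> \<in> {\<omega>. \<forall>x\<in>{0, 1, 2}. \<omega> x \<in> Z x} \<longrightarrow> \<omega> \<in> {\<omega>. card (initial_gap \<omega>) \<le> \<theta> \<and> lreceives gain \<omega> 0 1 0}"
      using AE_regular
    proof (eventually_elim, intro impI)
      fix \<omega> assume r: "regular \<omega>" and z: "\<omega> \<in> {\<omega>. \<forall>x\<in>{0, 1, 2}. \<omega> x \<in> Z x}"
      then have i: "init_op \<omega> 0 = {}" "init_op \<omega> 1 = {0}" "init_op \<omega> 2 = {}"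
        by (auto simp: Z_def init_op_def)
      have a: "1 < arrival \<omega> 0 0" "1 < arrival \<omega> 2 0" "arrival \<omega> 1 0 \<le> 1" "nbr \<omega> 1 0 = 2"
        using z by (auto simp: Z_def Bq_def Br_def arrival_eq_ringing rings_once_def nbr_def mark_of_def)
      have "initial_gap \<omega> \<subseteq> {0}" using i by (auto simp: initial_gap_def disagree_def)
      then have "card (initial_gap \<omega>) \<le> 1" using card_mono[of "{0}" "initial_gap \<omega>"] by simp
      then show "\<omega> \<in> {\<omega>. card (initial_gap \<omega>) \<le> \<theta> \<and> lreceives gain \<omega> 0 1 0}"
        using lreceives_gain_of_first_ring[OF r i a] \<theta>_pos by simp
    qed
    have "Measurable.pred (site.P F) (\<lambda>\<omega>. lgap 0 \<omega> 0 \<le> \<theta> \<and> lreceives gain \<omega> 0 1 0)" by measurable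
    then show "{\<omega>. card (initial_gap \<omega>) \<le> \<theta> \<and> lreceives gain \<omega> 0 1 0} \<in> sets (site.P F)"
      unfolding lgap_0 by (rule sets_pred)
  qed
  finally show ?thesis .
qed

lemma tendsto_expectation:
  fixes f :: "nat \<Rightarrow> (int \<Rightarrow> site) \<Rightarrow> real"
  assumes f: "\<And>t. f t \<in> borel_measurable (site.P F)" "g \<in> borel_measurable (site.P F)" and B: "\<And>t \<omega>. \<bar>f t \<omega>\<bar> \<le> B"
    and ev: "AE \<omega> in site.P F. \<forall>\<^sub>F t in sequentially. f t \<omega> = g \<omega>"
  shows "(\<lambda>t. expectation (f t)) \<longlonglongrightarrow> expectation g"
proof (rule integral_dominated_convergence[where w="\<lambda>_. B"])
  show "AE \<omega> in site.P F. (\<lambda>t. f t \<omega>) \<longlonglongrightarrow> g \<omega>"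
    using ev by eventually_elim (rule tendsto_eventually)
qed (use f B in auto)

lemma prob_frozen_pos:
  assumes F: "4 * \<theta> - 1 \<le> F"
  shows "prob {\<omega>. frozen \<omega> 0} > 0"
proof (rule ccontr)
  assume "\<not> ?thesis"
  then have "prob {\<omega>. frozen \<omega> 0} = 0" using measure_nonneg[of "site.P F"] by (simp add: order_less_le)
  then have "AE \<omega> in site.P F. \<not> frozen \<omega> 0"
    using site.line.prob_eq_0[OF sets_pred[OF measurable_frozen]] by simp
  then have thaw: "AE \<omega> in site.P F. \<forall>\<^sub>F t in sequentially. lgap t \<omega> 0 \<le> \<theta>"
    using AE_regular AE_eventually_calm
  proof eventually_elim
    case (elim \<omega>)
    then show ?case using frozen_dichotomy(2) by blast
  qed
  define \<Phi> where "\<Phi> = (\<lambda>t. expectation (\<lambda>\<omega>. phi (lgap t \<omega> 0)))"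
  \<comment> \<open>The positive part of \<open>phi\<close> dominates \<open>phi\<close> and
    vanishes on active edges, so its mean tends to 0 by dominated convergence if the edge thaws
    almost surely.\<close>
  define G where "G = (\<lambda>t. expectation (\<lambda>\<omega>. max 0 (phi (lgap t \<omega> 0))))"
  define c where "c = prob {\<omega>. card (initial_gap \<omega>) \<le> \<theta> \<and> lreceives gain \<omega> 0 1 0}"
  define p where "p = (\<lambda>t j. prob {\<omega>. card (initial_gap \<omega>) = j \<and> lgap t \<omega> 0 \<le> \<theta>})"
  define P where "P = (\<lambda>j. prob {\<omega>. card (initial_gap \<omega>) = j})"
  have phi_le: "\<bar>phi j\<bar> \<le> real j + 2 * real \<theta>" for j by (auto simp: phi_def)
  have phi_b: "\<bar>phi (lgap t \<omega> 0)\<bar> \<le> real F + 2 * real \<theta>" for t \<omega>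
    using phi_le[of "lgap t \<omega> 0"] lgap_le[of t \<omega> 0] by linarith
  have cm[measurable]: "Measurable.pred (site.P F) (\<lambda>\<omega>. card (initial_gap \<omega>) = j)"
    "Measurable.pred (site.P F) (\<lambda>\<omega>. card (initial_gap \<omega>) \<le> \<theta>)" for j
    unfolding lgap_0[symmetric] by measurable
  have drift_t: "\<Phi> 0 + 2 * prob {\<omega>. lreceives gain \<omega> 0 t 0} \<le> \<Phi> t" for t
    unfolding \<Phi>_def
  proof (rule drift)
    \<comment> \<open>The emitting edge gains 1; the receiving edge gains 1 in case of
      \<open>gain\<close> and loses 1 otherwise.\<close>
    fix a b b' :: nat assume "1 \<le> a" "a \<le> \<theta>" "b' = b + 1 \<or> b' + 1 = b"
    then show "phi a + phi b + (if gain b b' then 2 else 0) \<le> phi (a - 1) + phi b'"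
      by (auto simp: phi_def gain_def)
  qed auto
  have \<Phi>G: "\<Phi> t \<le> G t" for t
  proof -
    have "integrable (site.P F) (\<lambda>\<omega>. phi (lgap t \<omega> 0))"
      using phi_b by (intro site.line.integrable_const_bound[where B="real F + 2 * real \<theta>"]) auto
    moreover have "integrable (site.P F) (\<lambda>\<omega>. max 0 (phi (lgap t \<omega> 0)))"
      using phi_b by (intro site.line.integrable_const_bound[where B="real F + 2 * real \<theta>"]) (auto intro!: AE_I2 simp: max_def intro: order_trans[OF abs_ge_self] order_trans[OF abs_ge_zero])
    ultimately show ?thesis unfolding \<Phi>_def G_def by (intro integral_mono) auto
  qed
  have G0: "G \<longlonglongrightarrow> 0"
  proof -
    have "G \<longlonglongrightarrow> expectation (\<lambda>_. 0)"
      unfolding G_def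
    proof (rule tendsto_expectation)
      show "\<bar>max 0 (phi (lgap t \<omega> 0))\<bar> \<le> real F + 2 * real \<theta>" for t \<omega>
        using phi_b[of t \<omega>] by (auto simp: max_def)
      show "AE \<omega> in site.P F. \<forall>\<^sub>F t in sequentially. max 0 (phi (lgap t \<omega> 0)) = 0"
        using thaw
      proof eventually_elim
        case (elim \<omega>)
        then show ?case by eventually_elim (simp add: phi_def)
      qed
    qed measurable
    then show ?thesis by simp
  qed
  have lim_p: "(\<lambda>t. p t j) \<longlonglongrightarrow> P j" for j
  proof -
    have "(\<lambda>t. expectation (indicat_real {\<omega>. card (initial_gap \<omega>) = j \<and> lgap t \<omega> 0 \<le> \<theta>})) \<longlonglongrightarrow> expectation (indicat_real {\<omega>. card (initial_gap \<omega>) = j})"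
    proof (rule tendsto_expectation[where B=1])
      show "AE \<omega> in site.P F. \<forall>\<^sub>F t in sequentially. indicat_real {\<omega>. card (initial_gap \<omega>) = j \<and> lgap t \<omega> 0 \<le> \<theta>} \<omega> = indicat_real {\<omega>. card (initial_gap \<omega>) = j} \<omega>"
        using thaw
      proof eventually_elim
        case (elim \<omega>)
        then show ?case by eventually_elim (simp add: indicator_def)
      qed
    qed (auto intro!: borel_measurable_indicator sets_pred)
    then show ?thesis by (simp add: p_def P_def)
  qed
  \<comment> \<open>Events with different initial gaps are disjoint, so the early gain and the fresh
    first hits of frozen edges add up.\<close>
  have gains: "c + (\<Sum>j\<in>{\<theta><..F}. (1 - real j / real F) * p t j) \<le> prob {\<omega>. lreceives gain \<omega> 0 t 0}" if t: "1 \<le> t" for t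
  proof -
    let ?A = "{\<omega>. card (initial_gap \<omega>) \<le> \<theta> \<and> lreceives gain \<omega> 0 t 0}"
    let ?B = "\<lambda>j. {\<omega>. card (initial_gap \<omega>) = j \<and> lreceives gain \<omega> 0 t 0}"
    have mA: "?A \<in> sets (site.P F)" and mB: "?B j \<in> sets (site.P F)" for j by (auto intro!: sets_pred)
    have "lreceives gain \<omega> 0 1 0 \<Longrightarrow> lreceives gain \<omega> 0 t 0" for \<omega>
      unfolding lreceives_def
    proof (elim eventually_mono)
      fix m assume "window_receives gain m \<omega> 0 1 0"
      moreover have "(1::nat) * 2 ^ m \<le> t * 2 ^ m" using t by simp
      ultimately show "window_receives gain m \<omega> 0 t 0" unfolding window_receives_def by (meson atLeastLessThan_iff less_le_trans)
    qed
    then have "c \<le> prob ?A" unfolding c_def using mA by (intro site.line.finite_measure_mono) auto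
    moreover have "(\<Sum>j\<in>{\<theta><..F}. (1 - real j / real F) * p t j) \<le> (\<Sum>j\<in>{\<theta><..F}. prob (?B j))"
      unfolding p_def by (intro sum_mono prob_gain_ge) auto
    moreover have "(\<Sum>j\<in>{\<theta><..F}. prob (?B j)) = prob (\<Union>j\<in>{\<theta><..F}. ?B j)"
      using mB by (intro site.line.finite_measure_finite_Union[symmetric]) (auto simp: disjoint_family_on_def)
    moreover have "prob ?A + prob (\<Union>j\<in>{\<theta><..F}. ?B j) = prob (?A \<union> (\<Union>j\<in>{\<theta><..F}. ?B j))"
      using mA mB by (intro site.line.finite_measure_Union[symmetric]) auto
    moreover have "\<dots> \<le> prob {\<omega>. lreceives gain \<omega> 0 t 0}"
      by (intro site.line.finite_measure_mono sets_pred) auto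
    ultimately show ?thesis by linarith
  qed
  have "(\<lambda>t. \<Phi> 0 + 2 * (c + (\<Sum>j\<in>{\<theta><..F}. (1 - real j / real F) * p t j)))
      \<longlonglongrightarrow> \<Phi> 0 + 2 * (c + (\<Sum>j\<in>{\<theta><..F}. (1 - real j / real F) * P j))"
    by (intro tendsto_intros lim_p)
  moreover have "\<forall>\<^sub>F t in sequentially. \<Phi> 0 + 2 * (c + (\<Sum>j\<in>{\<theta><..F}. (1 - real j / real F) * p t j)) \<le> G t"
    using eventually_ge_at_top[of 1]
  proof eventually_elim
    case (elim t)
    have "\<Phi> 0 + 2 * (c + (\<Sum>j\<in>{\<theta><..F}. (1 - real j / real F) * p t j)) \<le> \<Phi> 0 + 2 * prob {\<omega>. lreceives gain \<omega> 0 t 0}"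
      using gains[OF elim] by (intro add_left_mono mult_left_mono) auto
    also have "\<dots> \<le> \<Phi> t" by (rule drift_t)
    also have "\<dots> \<le> G t" by (rule \<Phi>G)
    finally show ?case .
  qed
  ultimately have le: "\<Phi> 0 + 2 * (c + (\<Sum>j\<in>{\<theta><..F}. (1 - real j / real F) * P j)) \<le> 0"
    using G0 by (intro tendsto_le[OF sequentially_bot]) auto
  have "\<Phi> 0 = (\<Sum>j\<le>F. phi j * P j)"
  proof -
    have "phi (lgap 0 \<omega> 0) = (\<Sum>j\<le>F. phi j * indicat_real {\<omega>. card (initial_gap \<omega>) = j} \<omega>)" for \<omega>
      using lgap_le[of 0 \<omega> 0] by (simp add: lgap_0 indicator_def if_distrib cong: if_cong)
    then have "\<Phi> 0 = expectation (\<lambda>\<omega>. \<Sum>j\<le>F. phi j * indicat_real {\<omega>. card (initial_gap \<omega>) = j} \<omega>)"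
      unfolding \<Phi>_def by simp
    also have "\<dots> = (\<Sum>j\<le>F. expectation (\<lambda>\<omega>. phi j * indicat_real {\<omega>. card (initial_gap \<omega>) = j} \<omega>))"
    proof (rule Bochner_Integration.integral_sum)
      fix j
      show "integrable (site.P F) (\<lambda>\<omega>. phi j * indicat_real {\<omega>. card (initial_gap \<omega>) = j} \<omega>)"
        by (intro integrable_mult_right site.line.integrable_const_bound[where B=1]) (auto intro!: borel_measurable_indicator sets_pred)
    qed
    finally show ?thesis by (simp add: P_def)
  qed
  moreover have "2 * (\<Sum>j\<in>{\<theta><..F}. (1 - real j / real F) * P j) = (\<Sum>j\<le>F. (if \<theta> < j then 2 * (1 - real j / real F) else 0) * P j)"
    unfolding sum_distrib_left by (intro sum.mono_neutral_cong_left) auto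
  ultimately have "\<Phi> 0 + 2 * (\<Sum>j\<in>{\<theta><..F}. (1 - real j / real F) * P j)
      = (\<Sum>j\<le>F. (phi j + (if \<theta> < j then 2 * (1 - real j / real F) else 0)) * P j)"
    by (simp add: sum.distrib distrib_right)
  also have "\<dots> = (\<Sum>j\<le>F. (phi j + (if \<theta> < j then 2 * (1 - real j / real F) else 0)) * real (F choose j)) / 2 ^ F"
    unfolding P_def prob_card_initial_gap sum_divide_distrib by simp
  also have "\<dots> \<ge> 0" using initial_balance[OF F] by simp
  finally show False using le prob_early_gain unfolding c_def[symmetric] by simp
qed

end

section \<open>Coexistence\<close>

context deffuant_process
begin

text \<open>Expressed by the recursion rather than by \<open>\<eta>\<close>, hence measurable and
  compatible with translations and global flips.\<close>

definition settles :: "nat set \<Rightarrow> (int \<Rightarrow> site) \<Rightarrow> int \<Rightarrow> bool" where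
  "settles u \<omega> x \<longleftrightarrow> (\<forall>\<^sub>F t in sequentially. \<forall>\<^sub>F m in sequentially. opin m \<omega> (t * 2 ^ m) x = u)"

lemma measurable_settles [measurable]: "Measurable.pred (site.P F) (\<lambda>\<omega>. settles u \<omega> x)"
  unfolding settles_def by measurable

lemma settles_iff_path:
  assumes "regular \<omega>"
  shows "settles u \<omega> x \<longleftrightarrow> (\<forall>\<^sub>F t in sequentially. \<eta> \<omega> (real t) x = u)"
proof -
  have "(\<forall>\<^sub>F m in sequentially. opin m \<omega> (t * 2 ^ m) x = u) \<longleftrightarrow> \<eta> \<omega> (real t) x = u" for t
  proof -
    have "\<forall>\<^sub>F m in sequentially. opin m \<omega> (t * 2 ^ m) x = \<eta> \<omega> (real t) x"
      using assms unfolding regular_def by (intro eventually_opin_eq_path) auto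
    then have "(\<forall>\<^sub>F m in sequentially. opin m \<omega> (t * 2 ^ m) x = u) \<longleftrightarrow> (\<forall>\<^sub>F m::nat in sequentially. \<eta> \<omega> (real t) x = u)"
      by (intro eventually_cong) (auto elim: eventually_mono)
    then show ?thesis by simp
  qed
  then show ?thesis by (simp add: settles_def)
qed

lemma AE_settles:
  assumes pos: "prob {\<omega>. frozen \<omega> 0} > 0"
  shows "AE \<omega> in site.P F. \<forall>x. \<exists>u\<in>Pow {..<F}. settles u \<omega> x \<and> (\<forall>\<^sub>F r in at_top. \<eta> \<omega> r x = u)"
  using AE_fixation[OF pos] AE_regular
proof eventually_elim
  case (elim \<omega>)
  show ?case
  proof
    fix x
    obtain t :: nat where t: "\<And>r. r > real t \<Longrightarrow> \<eta> \<omega> r x = \<eta> \<omega> t x" using elim(1) by blast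
    let ?u = "\<eta> \<omega> t x"
    have "\<forall>\<^sub>F n in sequentially. \<eta> \<omega> (real n) x = ?u"
      using eventually_gt_at_top[of t] by eventually_elim (rule t, simp)
    then have s: "settles ?u \<omega> x" by (simp add: settles_iff_path[OF elim(2)])
    have "\<forall>\<^sub>F m in sequentially. opin m \<omega> (t * 2 ^ m) x = ?u"
      using elim(2) unfolding regular_def by (intro eventually_opin_eq_path) auto
    then have "\<forall>\<^sub>F m::nat in sequentially. ?u \<subseteq> {..<F}"
      by eventually_elim (metis opin_subset)
    then have "?u \<in> Pow {..<F}" by simp
    moreover have "\<forall>\<^sub>F r in at_top. \<eta> \<omega> r x = ?u"
      using eventually_gt_at_top[of "real t"] by eventually_elim (rule t)
    ultimately show "\<exists>u\<in>Pow {..<F}. settles u \<omega> x \<and> (\<forall>\<^sub>F r in at_top. \<eta> \<omega> r x = u)" using s by blast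
  qed
qed

text \<open>A flip of all sites exchanges the limits \<open>w\<close> and \<open>u\<close> at the
  origin, so all opinions are equally likely there. As some opinion almost surely settles, each has
  positive probability, and ergodicity places it somewhere on the line.\<close>

lemma AE_every_opinion_settles:
  assumes pos: "prob {\<omega>. frozen \<omega> 0} > 0" and u: "u \<subseteq> {..<F}"
  shows "AE \<omega> in site.P F. \<exists>x. settles u \<omega> x"
proof -
  have eq: "prob {\<omega>. settles w \<omega> 0} = prob {\<omega>. settles u \<omega> 0}" if w: "w \<subseteq> {..<F}" for w
  proof -
    define D where "D = symdiff w u"
    have D: "D \<subseteq> {..<F}" using w u by (auto simp: D_def symdiff_def)
    have "prob {\<omega>. settles w \<omega> 0} = prob {\<omega>. settles u (recolor (\<lambda>_. D) \<omega>) 0}"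
    proof (rule site.line.finite_measure_eq_AE)
      show "AE \<omega> in site.P F. (\<omega> \<in> {\<omega>. settles w \<omega> 0}) = (\<omega> \<in> {\<omega>. settles u (recolor (\<lambda>_. D) \<omega>) 0})"
        using AE_valid_marks
      proof eventually_elim
        case (elim \<omega>)
        then have perm: "\<And>x n. perm_of \<omega> x n permutes {..<F}" by (simp add: valid_marks_def)
        have "symdiff v D = u \<longleftrightarrow> v = w" for v unfolding D_def by (rule symdiff_eq_iff)
        then show ?case by (simp add: settles_def opin_recolor_const[OF perm D])
      qed
      show "{\<omega>. settles w \<omega> 0} \<in> sets (site.P F)" by (intro sets_pred measurable_settles)
      show "{\<omega>. settles u (recolor (\<lambda>_. D) \<omega>) 0} \<in> sets (site.P F)"
        by (intro sets_pred measurable_compose[OF measurable_recolor measurable_settles])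
    qed
    also have "\<dots> = prob {\<omega>. settles u \<omega> 0}"
      by (rule prob_recolor[where f="\<lambda>_. D", OF measurable_settles D])
    finally show ?thesis .
  qed
  have "prob {\<omega>. settles u \<omega> 0} \<noteq> 0"
  proof
    assume "prob {\<omega>. settles u \<omega> 0} = 0"
    then have "AE \<omega> in site.P F. \<not> settles w \<omega> 0" if "w \<in> Pow {..<F}" for w
      using site.line.prob_eq_0[OF sets_pred[OF measurable_settles[of w 0]]] eq[of w] that by simp
    then have "AE \<omega> in site.P F. \<forall>w\<in>Pow {..<F}. \<not> settles w \<omega> 0"
      by (intro AE_finite_allI) auto
    with AE_settles[OF pos] have "AE \<omega> in site.P F. False" by eventually_elim blast
    then show False by (simp add: site.line.P.AE_False)
  qed
  then have "prob {\<omega>. settles u \<omega> 0} > 0" using measure_nonneg[of "site.P F"] by (simp add: order_less_le)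
  from site.AE_infinitely_often_translate[OF measurable_settles this]
  show ?thesis
  proof eventually_elim
    case (elim \<omega>)
    then obtain z where "settles u (translate z \<omega>) 0" by blast
    then have "settles u \<omega> z" by (simp add: settles_def opin_translate)
    then show ?case by blast
  qed
qed

lemma coexistence:
  assumes pos: "prob {\<omega>. frozen \<omega> 0} > 0"
  shows "AE \<omega> in site.P F. \<exists>f. (\<forall>x. \<forall>\<^sub>F r in at_top. \<eta> \<omega> r x = f x) \<and> range f = Pow {..<F}"
proof -
  have "AE \<omega> in site.P F. \<forall>u\<in>Pow {..<F}. \<exists>x. settles u \<omega> x"
    by (intro AE_finite_allI AE_every_opinion_settles[OF pos]) auto
  then show ?thesis
    using AE_settles[OF pos] AE_regular
  proof eventually_elim
    case (elim \<omega>)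
    from elim(2) obtain f where f: "\<And>x. f x \<in> Pow {..<F}" "\<And>x. settles (f x) \<omega> x" "\<And>x. \<forall>\<^sub>F r in at_top. \<eta> \<omega> r x = f x"
      by metis
    have "u \<in> range f" if "u \<in> Pow {..<F}" for u
    proof -
      from bspec[OF elim(1) that] obtain x where "settles u \<omega> x" ..
      then have "\<forall>\<^sub>F t in sequentially. \<eta> \<omega> (real t) x = u" by (simp add: settles_iff_path[OF elim(3)])
      moreover have "\<forall>\<^sub>F t in sequentially. \<eta> \<omega> (real t) x = f x" using f(2)[of x] by (simp add: settles_iff_path[OF elim(3)])
      ultimately have "\<forall>\<^sub>F t::nat in sequentially. u = f x" by eventually_elim simp
      then show ?thesis by simp
    qed
    then show ?case using f by (intro exI[of _ f]) auto
  qed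
qed

end

theorem theorem2:
  fixes F \<theta> :: nat
    and \<eta> :: "(int \<Rightarrow> site) \<Rightarrow> real \<Rightarrow> int \<Rightarrow> nat set"
  assumes "1 \<le> F" and "1 \<le> \<theta>" and "4 * \<theta> - 1 \<le> F"
    and "AE \<omega> in deffuant_space F. is_deffuant_path F \<theta> \<omega> (\<eta> \<omega>)"
  shows "\<exists>\<eta>_inf :: (int \<Rightarrow> site) \<Rightarrow> int \<Rightarrow> nat set.
           (\<forall>x. AE \<omega> in deffuant_space F. \<forall>\<^sub>F t in at_top. \<eta> \<omega> t x = \<eta>_inf \<omega> x) \<and>
           (AE \<omega> in deffuant_space F. card (range (\<eta>_inf \<omega>)) = 2 ^ F)"
proof -
  interpret deffuant_process F \<theta> \<eta>
    using assms(1,2) assms(4)[unfolded deffuant_space_eq] by unfold_locales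
  \<comment> \<open>Picks the limit wherever it exists with full range; on the remaining null set
    the value is arbitrary.\<close>
  define \<eta>_inf where "\<eta>_inf = (\<lambda>\<omega>. SOME f. (\<forall>x. \<forall>\<^sub>F r in at_top. \<eta> \<omega> r x = f x) \<and> range f = Pow {..<F})"
  have ex: "AE \<omega> in deffuant_space F. (\<forall>x. \<forall>\<^sub>F r in at_top. \<eta> \<omega> r x = \<eta>_inf \<omega> x) \<and> range (\<eta>_inf \<omega>) = Pow {..<F}"
    using coexistence[OF prob_frozen_pos[OF assms(3)]] unfolding deffuant_space_eq \<eta>_inf_def
  proof eventually_elim
    case (elim \<omega>)
    from someI_ex[OF elim] show ?case .
  qed
  show ?thesis
  proof (intro exI[of _ \<eta>_inf] conjI allI)
    fix x show "AE \<omega> in deffuant_space F. \<forall>\<^sub>F t in at_top. \<eta> \<omega> t x = \<eta>_inf \<omega> x"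
      using ex by eventually_elim blast
    show "AE \<omega> in deffuant_space F. card (range (\<eta>_inf \<omega>)) = 2 ^ F"
      using ex by eventually_elim (simp add: card_Pow)
  qed
qed

end
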